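(* Let $H=H^s(\mathbb{T}^d;\mathbb{R}^c)$ for some $s\ge 0$, let $\{S(t)\}_{t\ge 0}$ be the solution semigroup on $H$ of a dissipative PDE, let $\Delta t>0$, and let $$\mathcal{G}=S(\Delta t):H\to H$$ be the one-step solution operator, assumed continuous. Let $K\subset H$ be compact. Assume that: (1) the PDE admits a finite-dimensional flow-normally hyperbolic inertial manifold $\mathcal M\subset H$; (2) the associated asymptotic phase map $\Pi:H\to\mathcal M$ is continuous. Then, for every $\varepsilon>0$, there exists an IMNO model $\mathcal{G}_\theta:H\to H$ such that the following holds. For $u\in K$ write $$u=u^M+u^R,\qquad u^M:=\Pi(u),\qquad u^R:=u-\Pi(u),$$ $$\mathcal{G}(u)=u^{M,\mathrm{ref}}_{\mathrm{next}}+u^{R,\mathrm{ref}}_{\mathrm{next}},\qquad u^{M,\mathrm{ref}}_{\mathrm{next}}:=\Pi(\mathcal{G}(u)),\qquad u^{R,\mathrm{ref}}_{\mathrm{next}}:=\mathcal{G}(u)-\Pi(\mathcal{G}(u)),$$ and write the corresponding IMNO prediction as $\mathcal{G}_\theta(u)=u^M_{\mathrm{next}}+u^R_{\mathrm{next}}$, where $u^M_{\mathrm{next}}$ and $u^R_{\mathrm{next}}$ are the manifold and residual components produced by the model. Then $$\sup_{u\in K}\left(\|u^M_{\mathrm{next}}-u^{M,\mathrm{ref}}_{\mathrm{next}}\|_H+\|u^R_{\mathrm{next}}-u^{R,\mathrm{ref}}_{\mathrm{next}}\|_H\right)<\varepsilon .$$ In particular, $$\sup_{u\in K}\|\mathcal{G}_\theta(u)-\mathcal{G}(u)\|_H<\varepsilon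 .$$
   Context: **Dynamics.** $\mathbb{T}^d$ is the $d$-dimensional torus and $H^s$ the $L^2$-based Sobolev space. $\{S(t)\}_{t\ge0}$ is the solution semigroup, $S(t)u_0=u(t;u_0)$, of the PDE. "Dissipative" means that there is a bounded absorbing set $B\subset H$: every bounded subset of $H$ is eventually mapped into $B$ by $S(t)$. An *inertial manifold* is a set $\mathcal M\subset H$ such that: (i) $\mathcal M$ is a finite-dimensional Lipschitz manifold; (ii) $S(t)\mathcal M\subset\mathcal M$ for all $t\ge0$; (iii) there is $\mu>0$ such that for every $u_0\in H$ there is $C=C(u_0)$ with $\mathrm{dist}(S(t)u_0,\mathcal M)\le Ce^{-\mu t}$ for all $t\ge0$. $\mathcal M$, attracting at exponential rate $\mu>0$ as in (iii), is *flow-normally hyperbolic* if there exist $\gamma<\mu$ and a constant $C$ such that for any two trajectories $u_1(t),u_2(t)$ lying on $\mathcal M$ one has $\|u_1(t)-u_2(t)\|\le Ce^{-\gamma t}\|u_1(0)-u_2(0)\|$ for all $t\le 0$ such that both trajectories are defined on $[t,0]$; equivalently, $\|v_1-v_2\|\le Ce^{\gamma\tau}\|S(\tau)v_1-S(\tau)v_2\|$ for all $v_1,v_2\in\mathcal M$ and $\tau\ge0$. The *asymptotic phase* of $u\in H$ is the point $u^M\in\mathcal M$ with $\|S(t)u-S(t)u^M\|\le C(u)e^{-\mu t}$ for all $t\ge0$, for some constant $C(u)$. For a flow-normally hyperbolic inertial manifold it is known to exist and be unique for every $u\in H$. The associated asymptotic phase map is $\Pi:H\to\mathcal M$, $\Pi(u)=u^M$.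 **Fourier maps.** For $N\in\mathbb N$, $P_N:H\to H$ is the orthogonal projection onto the Fourier modes with $|k|_\infty\le N$. $\mathcal F_N:H\to\mathbb R^{D_N}$, $D_N=c(2N+1)^d$, is the (linear, continuous) map collecting the real and imaginary parts of the Fourier coefficients of $u$ with $|k|_\infty\le N$, and $\mathcal S_N:\mathbb R^{D_N}\to P_NH$ is the associated linear Fourier synthesis map, so that $\mathcal S_N(\mathcal F_N(u))=P_Nu$. **IMNO model.** It has a latent dimension $d_h\in\mathbb N$ and consists of the following components. - Encoder $E_\theta:H\to\mathbb R^{d_h}$, $E_\theta(u)=\varphi_\theta(\mathcal F_{k_E}(u))$, with $\varphi_\theta:\mathbb R^{D_{k_E}}\to\mathbb R^{d_h}$ a multilayer perceptron (MLP). - Decoder $D_\theta:\mathbb R^{d_h}\to H$, $D_\theta(h)=\mathcal S_{k_D}(\psi_\theta(h))$, with $\psi_\theta:\mathbb R^{d_h}\to\mathbb R^{D_{k_D}}$ an MLP. - Latent dynamics $h\mapsto h+\Delta t\,f_\theta(h)$, with $f_\theta:\mathbb R^{d_h}\to\mathbb R^{d_h}$ an MLP. - Conditioned residual operator $\mathcal R_\theta:H\times\mathbb R^{d_h}\to H$, $$\mathcal R_\theta(\cdot,h)=\mathcal Q\circ\mathcal L_L^{(h)}\circ\cdots\circ\mathcal L_1^{(h)}\circ\mathcal P,\qquad \mathcal L_\ell^{(h)}(v)(x)=\sigma\bigl(W_\ell v(x)+\beta_\ell(h)+(\mathcal K_\ell v)(x)\bigr).$$ Here $\mathcal P(u)(x)=P(u(x),x)$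 and $\mathcal Q(v)(x)=Q(v(x))$ are pointwise lifting and projection maps with $P:\mathbb R^{c+d}\to\mathbb R^{d_c}$ and $Q:\mathbb R^{d_c}\to\mathbb R^{c}$ MLPs, $x$ denoting the coordinates of the point of $\mathbb T^d$; $W_\ell\in\mathbb R^{d_c\times d_c}$; $\beta_\ell:\mathbb R^{d_h}\to\mathbb R^{d_c}$ is affine (its value is a spatially constant bias); and $(\mathcal K_\ell v)(x)=\mathcal F^{-1}(R_\ell(k)\widehat v(k))(x)$ is a Fourier multiplier over finitely many retained modes $k$, with matrices $R_\ell(k)\in\mathbb C^{d_c\times d_c}$ such that real-valued functions are mapped to real-valued functions. The function $\sigma:\mathbb R\to\mathbb R$ acts componentwise; it is part of the choice of the model and is chosen so that the standard finite-dimensional universal approximation theorem (uniform approximation of continuous maps on compact sets) applies to MLPs with activation $\sigma$. The numbers $d_h,k_E,k_D$, the MLP sizes, the width $d_c$, the depth $L$, and the number of retained Fourier modes are free. The one-step prediction of the IMNO model at $u\in H$ is computed by $$h_0=E_\theta(u),\quad u^R_0=u-D_\theta(h_0),\quad h_1=h_0+\Delta t\,f_\theta(h_0),\quad u^M_{\mathrm{next}}=D_\theta(h_1),\quad u^R_{\mathrm{next}}=\mathcal R_\theta(u^R_0,h_1),$$ and $\mathcal G_\theta(u)=u^M_{\mathrm{next}}+u^R_{\mathrm{next}}$. *)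

theory Defs
  imports "HOL-Analysis.Analysis"
begin

section \<open>Functions on the torus\<close>

text \<open>The torus is coordinatised by the fundamental cell $[0,2\pi)^d$; its characters are
  $x \mapsto e^{i k\cdot x}$ with integer frequency vectors $k$.  Periodicity enters the
  Sobolev spaces below only through these characters.\<close>

definition torus :: "(real^'d) measure" where
  "torus = restrict_space lborel {x. \<forall>i. 0 \<le> x $ i \<and> x $ i < 2 * pi}"

definition freq_dot :: "int^'d \<Rightarrow> real^'d \<Rightarrow> real" where
  "freq_dot k x = (\<Sum>i\<in>UNIV. real_of_int (k $ i) * x $ i)"

definition fcoef :: "(real^'d \<Rightarrow> real) \<Rightarrow> int^'d \<Rightarrow> complex" where
  "fcoef f k = (LINT x|torus. of_real (f x) * cis (- freq_dot k x)) / of_real ((2 * pi) ^ CARD('d))"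

definition L2_torus :: "(real^'d \<Rightarrow> real) set" where
  "L2_torus = {f \<in> borel_measurable torus. integrable torus (\<lambda>x. (f x)\<^sup>2)}"

definition ae_eq :: "(real^'d \<Rightarrow> real^'c) \<Rightarrow> (real^'d \<Rightarrow> real^'c) \<Rightarrow> bool" where
  "ae_eq f g \<longleftrightarrow> f \<in> borel_measurable torus \<and> g \<in> borel_measurable torus \<and> (AE x in torus. f x = g x)"

text \<open>Almost-everywhere classes of measurable functions from the $d$-torus to $R^c$.\<close>

quotient_type (overloaded) ('d, 'c) torus_fun =
  "(real^('d::finite)) \<Rightarrow> (real^('c::finite))" / partial: ae_eq
proof (rule part_equivpI)
  show "\<exists>f. ae_eq f f" by (rule exI[of _ "\<lambda>_. 0"]) (simp add: ae_eq_def)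
  show "symp ae_eq" by (auto simp: symp_def ae_eq_def)
  show "transp ae_eq" by (auto simp: transp_def ae_eq_def)
qed

instantiation torus_fun :: (finite, finite) ab_group_add
begin

lift_definition zero_torus_fun :: "('a, 'b) torus_fun" is "\<lambda>_. 0"
  by (simp add: ae_eq_def)

lift_definition plus_torus_fun ::
    "('a, 'b) torus_fun \<Rightarrow> ('a, 'b) torus_fun \<Rightarrow> ('a, 'b) torus_fun"
  is "\<lambda>f g x. f x + g x"
  by (auto simp: ae_eq_def)

lift_definition minus_torus_fun ::
    "('a, 'b) torus_fun \<Rightarrow> ('a, 'b) torus_fun \<Rightarrow> ('a, 'b) torus_fun"
  is "\<lambda>f g x. f x - g x"
  by (auto simp: ae_eq_def)

lift_definition uminus_torus_fun :: "('a, 'b) torus_fun \<Rightarrow> ('a, 'b) torus_fun"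
  is "\<lambda>f x. - f x"
  by (auto simp: ae_eq_def)

instance
  by standard (transfer; auto simp: ae_eq_def algebra_simps)+

end

lemma borel_measurable_vec_nth [measurable]:
  fixes f :: "'x \<Rightarrow> real^'n"
  assumes "f \<in> borel_measurable M"
  shows "(\<lambda>x. f x $ i) \<in> borel_measurable M"
  using assms
  by (rule measurable_compose) (intro borel_measurable_continuous_onI continuous_intros)

lemma borel_measurable_vec_lambda:
  fixes f :: "'x \<Rightarrow> 'n::finite \<Rightarrow> real"
  assumes "\<And>i. (\<lambda>x. f x i) \<in> borel_measurable M"
  shows "(\<lambda>x. \<chi> i. f x i) \<in> borel_measurable M"
  unfolding borel_measurable_euclidean_space[of "\<lambda>x. \<chi> i. f x i"]
  using assms by (auto simp: Basis_vec_def inner_axis)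

lemma torus_coord_measurable [measurable]: "(\<lambda>x. x $ i) \<in> borel_measurable torus"
  unfolding torus_def by (rule measurable_restrict_space1) simp

lift_definition square_integrable :: "('d::finite, 'c::finite) torus_fun \<Rightarrow> bool"
  is "\<lambda>f. integrable torus (\<lambda>x. (norm (f x))\<^sup>2)"
  unfolding ae_eq_def by (intro integrable_cong_AE) auto

lemma freq_dot_measurable [measurable]: "freq_dot k \<in> borel_measurable borel"
  unfolding freq_dot_def by measurable

lemma freq_dot_measurable_torus [measurable]: "freq_dot k \<in> borel_measurable torus"
  unfolding torus_def by (rule measurable_restrict_space1) simp

lemma fcoef_cong_AE:
  assumes "f \<in> borel_measurable torus" "g \<in> borel_measurable torus" "AE x in torus. f x = g x"
  shows "fcoef f k = fcoef g k"
proof -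
  have [measurable]: "(\<lambda>x. cis (- freq_dot k x)) \<in> borel_measurable torus"
    unfolding cis_conv_exp by measurable
  note assms(1,2) [measurable]
  have "(LINT x|torus. of_real (f x) * cis (- freq_dot k x)) =
        (LINT x|torus. of_real (g x) * cis (- freq_dot k x))"
    using assms(3) by (intro integral_cong_AE) auto
  then show ?thesis by (simp add: fcoef_def)
qed

lift_definition fourier :: "('d::finite, 'c::finite) torus_fun \<Rightarrow> int^'d \<Rightarrow> complex^'c"
  is "\<lambda>f k. \<chi> j. fcoef (\<lambda>x. f x $ j) k"
proof -
  fix f g :: "real^'d \<Rightarrow> real^'c"
  assume "ae_eq f g"
  then have "fcoef (\<lambda>x. f x $ j) k = fcoef (\<lambda>x. g x $ j) k" for j k
    by (intro fcoef_cong_AE) (auto simp: ae_eq_def)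
  then show "(\<lambda>k. \<chi> j. fcoef (\<lambda>x. f x $ j) k) = (\<lambda>k. \<chi> j. fcoef (\<lambda>x. g x $ j) k)"
    by simp
qed


section \<open>The Sobolev space $H^s$\<close>

definition sobolev_weight :: "real \<Rightarrow> int^'d \<Rightarrow> real" where
  "sobolev_weight s k = (1 + (\<Sum>i\<in>UNIV. (real_of_int (k $ i))\<^sup>2)) powr s"

definition Hs :: "real \<Rightarrow> ('d::finite, 'c::finite) torus_fun set" where
  "Hs s = {u. square_integrable u \<and> (\<lambda>k. sobolev_weight s k * (norm (fourier u k))\<^sup>2) summable_on UNIV}"

definition Hs_norm :: "real \<Rightarrow> ('d::finite, 'c::finite) torus_fun \<Rightarrow> real" where
  "Hs_norm s u = sqrt (\<Sum>\<^sub>\<infinity>k. sobolev_weight s k * (norm (fourier u k))\<^sup>2)"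

definition Hs_dist :: "real \<Rightarrow> ('d::finite, 'c::finite) torus_fun \<Rightarrow> ('d, 'c) torus_fun \<Rightarrow> real" where
  "Hs_dist s u v = Hs_norm s (u - v)"

definition Hs_topology :: "real \<Rightarrow> ('d::finite, 'c::finite) torus_fun topology" where
  "Hs_topology s = Metric_space.mtopology (Hs s) (Hs_dist s)"


section \<open>Dissipative semigroups and inertial manifolds\<close>

definition semigroup_on :: "'u set \<Rightarrow> (real \<Rightarrow> 'u \<Rightarrow> 'u) \<Rightarrow> bool" where
  "semigroup_on H S \<longleftrightarrow>
     (\<forall>t\<ge>0. S t \<in> H \<rightarrow> H) \<and> (\<forall>u\<in>H. S 0 u = u) \<and>
     (\<forall>t\<ge>0. \<forall>r\<ge>0. \<forall>u\<in>H. S (t + r) u = S t (S r u))"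

definition Hs_bounded :: "real \<Rightarrow> ('d::finite, 'c::finite) torus_fun set \<Rightarrow> bool" where
  "Hs_bounded s A \<longleftrightarrow> A \<subseteq> Hs s \<and> (\<exists>r. \<forall>u\<in>A. Hs_norm s u \<le> r)"

definition dissipative ::
    "real \<Rightarrow> (real \<Rightarrow> ('d::finite, 'c::finite) torus_fun \<Rightarrow> ('d, 'c) torus_fun) \<Rightarrow> bool" where
  "dissipative s S \<longleftrightarrow>
     (\<exists>B. Hs_bounded s B \<and> (\<forall>A. Hs_bounded s A \<longrightarrow> (\<exists>T\<ge>0. \<forall>t\<ge>T. S t ` A \<subseteq> B)))"

text \<open>\<^term>\<open>Euclidean_space n\<close> consists of the sequences that vanish from index \<open>n\<close> on; the following
  is the Euclidean distance there.\<close>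

definition eucl_dist :: "nat \<Rightarrow> (nat \<Rightarrow> real) \<Rightarrow> (nat \<Rightarrow> real) \<Rightarrow> real" where
  "eucl_dist n x y = L2_set (\<lambda>i. x i - y i) {..<n}"

text \<open>A finite-dimensional Lipschitz manifold: a nonempty subset of $H^s$ that is locally
  bi-Lipschitz homeomorphic to open subsets of $R^n$, for one fixed $n$.\<close>

definition lipschitz_manifold :: "real \<Rightarrow> nat \<Rightarrow> ('d::finite, 'c::finite) torus_fun set \<Rightarrow> bool" where
  "lipschitz_manifold s n M \<longleftrightarrow>
     M \<subseteq> Hs s \<and> M \<noteq> {} \<and>
     (\<forall>p\<in>M. \<exists>U V \<phi> \<Lambda>.
        p \<in> U \<and> openin (subtopology (Hs_topology s) M) U \<and>
        openin (Euclidean_space n) V \<and> bij_betw \<phi> U V \<and> \<Lambda> > 0 \<and>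
        (\<forall>u\<in>U. \<forall>v\<in>U. eucl_dist n (\<phi> u) (\<phi> v) \<le> \<Lambda> * Hs_dist s u v \<and>
                       Hs_dist s u v \<le> \<Lambda> * eucl_dist n (\<phi> u) (\<phi> v)))"

definition attracts_at_rate ::
    "real \<Rightarrow> (real \<Rightarrow> ('d::finite, 'c::finite) torus_fun \<Rightarrow> ('d, 'c) torus_fun) \<Rightarrow>
     ('d, 'c) torus_fun set \<Rightarrow> real \<Rightarrow> bool" where
  "attracts_at_rate s S M \<mu> \<longleftrightarrow>
     (\<forall>u\<in>Hs s. \<exists>C. \<forall>t\<ge>0. (INF m\<in>M. Hs_dist s (S t u) m) \<le> C * exp (- \<mu> * t))"

definition inertial_manifold ::
    "real \<Rightarrow> (real \<Rightarrow> ('d::finite, 'c::finite) torus_fun \<Rightarrow> ('d, 'c) torus_fun) \<Rightarrow>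
     ('d, 'c) torus_fun set \<Rightarrow> bool" where
  "inertial_manifold s S M \<longleftrightarrow>
     (\<exists>n. lipschitz_manifold s n M) \<and> (\<forall>t\<ge>0. S t ` M \<subseteq> M) \<and> (\<exists>\<mu>>0. attracts_at_rate s S M \<mu>)"

definition trajectory_on :: "(real \<Rightarrow> 'u \<Rightarrow> 'u) \<Rightarrow> 'u set \<Rightarrow> real \<Rightarrow> (real \<Rightarrow> 'u) \<Rightarrow> bool" where
  "trajectory_on S M t w \<longleftrightarrow>
     (\<forall>q\<in>{t..0}. w q \<in> M) \<and> (\<forall>q r. t \<le> q \<and> q \<le> r \<and> r \<le> 0 \<longrightarrow> w r = S (r - q) (w q))"

definition flow_normally_hyperbolic ::
    "real \<Rightarrow> (real \<Rightarrow> ('d::finite, 'c::finite) torus_fun \<Rightarrow> ('d, 'c) torus_fun) \<Rightarrow>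
     ('d, 'c) torus_fun set \<Rightarrow> real \<Rightarrow> bool" where
  "flow_normally_hyperbolic s S M \<mu> \<longleftrightarrow>
     \<mu> > 0 \<and> attracts_at_rate s S M \<mu> \<and>
     (\<exists>\<gamma><\<mu>. \<exists>C. \<forall>t\<le>0. \<forall>u1 u2. trajectory_on S M t u1 \<and> trajectory_on S M t u2 \<longrightarrow>
        Hs_dist s (u1 t) (u2 t) \<le> C * exp (- \<gamma> * t) * Hs_dist s (u1 0) (u2 0))"

text \<open>For a flow-normally hyperbolic inertial manifold the phase of a point is unique, since
  $\|v_1-v_2\|$ is bounded by a multiple of $e^{(\gamma-\mu)\tau}$ for every $\tau \ge 0$.\<close>

definition asymptotic_phase_map ::
    "real \<Rightarrow> (real \<Rightarrow> ('d::finite, 'c::finite) torus_fun \<Rightarrow> ('d, 'c) torus_fun) \<Rightarrow>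
     ('d, 'c) torus_fun set \<Rightarrow> real \<Rightarrow> (('d, 'c) torus_fun \<Rightarrow> ('d, 'c) torus_fun) \<Rightarrow> bool" where
  "asymptotic_phase_map s S M \<mu> phase \<longleftrightarrow>
     (\<forall>u\<in>Hs s. phase u \<in> M \<and> (\<exists>C. \<forall>t\<ge>0. Hs_dist s (S t u) (S t (phase u)) \<le> C * exp (- \<mu> * t)))"


section \<open>Fourier analysis and synthesis maps\<close>

text \<open>For real functions $\hat u(-k) = \overline{\hat u(k)}$, so exactly one real coordinate per
  frequency and component is independent: the real part at $k$ is stored in slot $k$ and the
  imaginary part at $k$ in slot $-k$, for $k$ in the half \<open>pos_freq\<close> of the nonzero frequencies
  (first nonzero entry positive, in an arbitrary fixed order of the coordinates).
  Thus $R^{D_N}$ is realised as real families on \<open>freq_box N \<times> UNIV\<close>.\<close>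

definition freq_box :: "nat \<Rightarrow> (int^'d) set" where
  "freq_box N = {k. \<forall>i. \<bar>k $ i\<bar> \<le> int N}"

definition pos_freq :: "int^('d::finite) \<Rightarrow> bool" where
  "pos_freq k \<longleftrightarrow> (\<exists>i. k $ i > 0 \<and> (\<forall>j. to_nat j < to_nat i \<longrightarrow> k $ j = 0))"

definition fourier_coords ::
    "nat \<Rightarrow> ('d::finite, 'c::finite) torus_fun \<Rightarrow> (int^'d) \<times> 'c \<Rightarrow> real" where
  "fourier_coords N u = (\<lambda>(k, j).
     if k \<notin> freq_box N then 0
     else if k = 0 \<or> pos_freq k then Re (fourier u k $ j)
     else Im (fourier u (- k) $ j))"

definition fourier_synth ::
    "nat \<Rightarrow> ((int^'d) \<times> 'c \<Rightarrow> real) \<Rightarrow> ('d::finite, 'c::finite) torus_fun" where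
  "fourier_synth N a = abs_torus_fun (\<lambda>x. \<chi> j. a (0, j) +
     (\<Sum>k | k \<in> freq_box N \<and> pos_freq k.
        2 * (a (k, j) * cos (freq_dot k x) - a (- k, j) * sin (freq_dot k x))))"

definition fourier_proj ::
    "nat \<Rightarrow> ('d::finite, 'c::finite) torus_fun \<Rightarrow> ('d, 'c) torus_fun" where
  "fourier_proj N u = abs_torus_fun (\<lambda>x. \<chi> j.
     Re (\<Sum>k\<in>freq_box N. fourier u k $ j * cis (freq_dot k x)))"

lemma freq_box_finite: "finite (freq_box N :: (int^'d) set)"
  and card_freq_box: "card (freq_box N :: (int^'d) set) = (2 * N + 1) ^ CARD('d)"
proof -
  let ?F = "UNIV \<rightarrow>\<^sub>E {- int N..int N} :: ('d \<Rightarrow> int) set"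
  have "bij_betw (\<lambda>k. ($) k) (freq_box N :: (int^'d) set) ?F"
    by (rule bij_betw_byWitness[where f' = "\<lambda>g. \<chi> i. g i"])
       (auto simp: freq_box_def abs_le_iff minus_le_iff vec_eq_iff PiE_def Pi_def extensional_def)
  moreover have "finite ?F" by (intro finite_PiE) auto
  moreover have "card {- int N..int N} = 2 * N + 1" by simp
  then have "card ?F = (2 * N + 1) ^ CARD('d)" by (simp add: card_PiE)
  ultimately show "finite (freq_box N :: (int^'d) set)"
    and "card (freq_box N :: (int^'d) set) = (2 * N + 1) ^ CARD('d)"
    by (simp_all add: bij_betw_finite bij_betw_same_card)
qed

lemma card_fourier_coords:
  "card (freq_box N \<times> UNIV :: ((int^'d) \<times> 'c::finite) set) = CARD('c) * (2 * N + 1) ^ CARD('d)"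
  by (simp add: card_cartesian_product card_freq_box)

lemma pos_freq_uminus:
  fixes k :: "int^('d::finite)"
  assumes "k \<noteq> 0"
  shows "pos_freq (- k) \<longleftrightarrow> \<not> pos_freq k"
proof -
  obtain i where i: "k $ i \<noteq> 0" and least: "\<And>j. to_nat j < to_nat i \<Longrightarrow> k $ j = 0"
  proof -
    have "\<exists>i. k $ i \<noteq> 0" using assms by (auto simp: vec_eq_iff)
    then have "\<exists>i. k $ i \<noteq> 0 \<and> (\<forall>j. k $ j \<noteq> 0 \<longrightarrow> to_nat i \<le> to_nat j)"
      using ex_has_least_nat[of "\<lambda>i. k $ i \<noteq> 0" _ to_nat] by blast
    then show ?thesis using that by (meson not_less)
  qed
  have uniq: "j = i" if "k $ j \<noteq> 0" "\<forall>l. to_nat l < to_nat j \<longrightarrow> k $ l = 0" for j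
    using that i least by (metis linorder_neqE_nat to_nat_split)
  have "pos_freq k \<longleftrightarrow> k $ i > 0" unfolding pos_freq_def using uniq least
    by (metis less_irrefl)
  moreover have "pos_freq (- k) \<longleftrightarrow> k $ i < 0"
    unfolding pos_freq_def uminus_vec_def vec_lambda_beta neg_0_less_iff_less neg_equal_0_iff_equal
    using uniq least by (metis less_irrefl)
  ultimately show ?thesis using i by linarith
qed

lemma fourier_uminus: "fourier u (- k) $ j = cnj (fourier u k $ j)"
proof (transfer)
  fix f :: "real^'d \<Rightarrow> real^'c" and k :: "int^'d" and j
  have [simp]: "freq_dot (- k) x = - freq_dot k x" for x
    by (simp add: freq_dot_def sum_negf)
  show "(\<chi> j. fcoef (\<lambda>x. f x $ j) (- k)) $ j = cnj ((\<chi> j. fcoef (\<lambda>x. f x $ j) k) $ j)"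
    unfolding fcoef_def
    using Bochner_Integration.integral_cnj[of torus "\<lambda>x. of_real (f x $ j) * cis (- freq_dot k x)"]
    by (simp add: cis_cnj)
qed

lemma fourier_synth_coords:
  fixes u :: "('d::finite, 'c::finite) torus_fun"
  shows "fourier_synth N (fourier_coords N u) = fourier_proj N u"
proof -
  let ?a = "fourier_coords N u" and ?P = "{k :: int^'d. k \<in> freq_box N \<and> pos_freq k}"
  have "Re (\<Sum>k\<in>freq_box N. fourier u k $ j * cis (freq_dot k x)) = ?a (0, j) +
     (\<Sum>k\<in>?P. 2 * (?a (k, j) * cos (freq_dot k x) - ?a (- k, j) * sin (freq_dot k x)))"
    (is "Re (sum ?g _) = _") for j and x :: "real^'d"
  proof -
    have npos0 [simp]: "\<not> pos_freq (0::int^'d)" by (simp add: pos_freq_def)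
    have neg: "- k \<in> freq_box N \<longleftrightarrow> k \<in> freq_box N" for k :: "int^'d"
      by (simp add: freq_box_def)
    have dot: "freq_dot (- k) x = - freq_dot k x" for k
      by (simp add: freq_dot_def sum_negf)
    have split: "freq_box N = {0} \<union> (?P \<union> uminus ` ?P)"
    proof (intro set_eqI iffI)
      fix k :: "int^'d" assume k: "k \<in> freq_box N"
      show "k \<in> {0} \<union> (?P \<union> uminus ` ?P)"
      proof (cases "k = 0 \<or> pos_freq k")
        case False
        then have "- k \<in> ?P" using k pos_freq_uminus[of k] neg by auto
        then have "k \<in> uminus ` ?P" by (metis imageI minus_minus)
        then show ?thesis by blast
      qed (use k in auto)
    next
      fix k :: "int^'d" assume "k \<in> {0} \<union> (?P \<union> uminus ` ?P)"
      then show "k \<in> freq_box N" by (auto simp: freq_box_def)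
    qed
    have fin: "finite ?P" by (rule finite_subset[OF _ freq_box_finite[of N]]) blast
    have disj: "?P \<inter> uminus ` ?P = {}"
    proof -
      have "\<not> pos_freq (- k)" if "pos_freq k" for k :: "int^'d"
        using that pos_freq_uminus[of k] npos0 by (cases "k = 0") auto
      then show ?thesis by auto
    qed
    have z: "0 \<notin> ?P \<union> uminus ` ?P" by auto
    have "sum ?g (freq_box N) = ?g 0 + (sum ?g ?P + sum ?g (uminus ` ?P))"
    proof -
      have "sum ?g (?P \<union> uminus ` ?P) = sum ?g ?P + sum ?g (uminus ` ?P)"
        using fin disj by (intro sum.union_disjoint) auto
      moreover have "sum ?g (insert 0 (?P \<union> uminus ` ?P)) = ?g 0 + sum ?g (?P \<union> uminus ` ?P)"
        using fin z by (intro sum.insert) auto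
      moreover have "freq_box N = insert 0 (?P \<union> uminus ` ?P)"
        using split by (simp only: Un_insert_left Un_empty_left)
      ultimately show ?thesis by metis
    qed
    also have "sum ?g (uminus ` ?P) = (\<Sum>k\<in>?P. ?g (- k))"
      by (subst sum.reindex) (auto simp: inj_on_def)
    finally have "Re (sum ?g (freq_box N)) = Re (?g 0) + (\<Sum>k\<in>?P. Re (?g k) + Re (?g (- k)))"
      by (simp add: sum.distrib)
    moreover have "Re (?g 0) = ?a (0, j)"
      by (simp add: freq_dot_def fourier_coords_def freq_box_def)
    moreover have "Re (?g k) + Re (?g (- k)) =
        2 * (?a (k, j) * cos (freq_dot k x) - ?a (- k, j) * sin (freq_dot k x))" if "k \<in> ?P" for k
    proof -
      have "k \<noteq> 0" using that by auto
      then have "\<not> pos_freq (- k)" "- k \<noteq> 0" using pos_freq_uminus that by auto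
      then show ?thesis using that
        by (simp add: fourier_coords_def neg dot fourier_uminus algebra_simps)
    qed
    ultimately show ?thesis by simp
  qed
  then show ?thesis by (simp add: fourier_synth_def fourier_proj_def)
qed


section \<open>Multilayer perceptrons\<close>

text \<open>Vectors are real families indexed by a finite set; hidden layers are indexed by
  \<open>{..<w}\<close>.  A multilayer perceptron has at least one hidden layer and an affine output layer.\<close>

definition affine_on ::
    "'a set \<Rightarrow> 'b set \<Rightarrow> ('b \<Rightarrow> 'a \<Rightarrow> real) \<Rightarrow> ('b \<Rightarrow> real) \<Rightarrow> ('a \<Rightarrow> real) \<Rightarrow> ('b \<Rightarrow> real)" where
  "affine_on I J A b x = (\<lambda>j. if j \<in> J then (\<Sum>i\<in>I. A j i * x i) + b j else 0)"

inductive mlp_tail ::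
    "(real \<Rightarrow> real) \<Rightarrow> nat \<Rightarrow> 'b set \<Rightarrow> ((nat \<Rightarrow> real) \<Rightarrow> ('b \<Rightarrow> real)) \<Rightarrow> bool"
  for \<sigma> :: "real \<Rightarrow> real" where
  output_layer: "mlp_tail \<sigma> w J (affine_on {..<w} J A b)"
| hidden_layer: "mlp_tail \<sigma> w' J F \<Longrightarrow>
    mlp_tail \<sigma> w J (\<lambda>x. F (\<lambda>i. \<sigma> (affine_on {..<w} {..<w'} A b x i)))"

definition mlp ::
    "(real \<Rightarrow> real) \<Rightarrow> 'a set \<Rightarrow> 'b set \<Rightarrow> (('a \<Rightarrow> real) \<Rightarrow> ('b \<Rightarrow> real)) \<Rightarrow> bool" where
  "mlp \<sigma> I J G \<longleftrightarrow> (\<exists>w A b F. mlp_tail \<sigma> w J F \<and>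
     G = (\<lambda>x. F (\<lambda>i. \<sigma> (affine_on I {..<w} A b x i))))"

definition universal_approximation :: "(real \<Rightarrow> real) \<Rightarrow> bool" where
  "universal_approximation \<sigma> \<longleftrightarrow>
     (\<forall>m n K g \<epsilon>. compactin (Euclidean_space m) K \<and>
        continuous_map (subtopology (Euclidean_space m) K) (Euclidean_space n) g \<and> \<epsilon> > 0 \<longrightarrow>
        (\<exists>F. mlp \<sigma> {..<m} {..<n} F \<and> (\<forall>x\<in>K. eucl_dist n (F x) (g x) < \<epsilon>)))"

lemma affine_on_measurable:
  assumes "\<And>i. i \<in> I \<Longrightarrow> (\<lambda>x. z x i) \<in> borel_measurable M"
  shows "(\<lambda>x. affine_on I J A b (z x) j) \<in> borel_measurable M"
  using assms unfolding affine_on_def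
  by (cases "j \<in> J") (simp_all add: borel_measurable_add borel_measurable_sum borel_measurable_times)

lemma mlp_tail_measurable:
  assumes "mlp_tail \<sigma> w J F" "\<sigma> \<in> borel_measurable borel"
    and "\<And>i. (\<lambda>x. z x i) \<in> borel_measurable M"
  shows "(\<lambda>x. F (z x) j) \<in> borel_measurable M"
  using assms(1,3)
proof (induction arbitrary: z)
  case (output_layer w J A b)
  then show ?case by (intro affine_on_measurable)
next
  case (hidden_layer w' J F w A b)
  then show ?case
    by (auto intro!: hidden_layer.IH affine_on_measurable measurable_compose[OF _ assms(2)])
qed

lemma mlp_measurable:
  assumes "mlp \<sigma> I J G" "\<sigma> \<in> borel_measurable borel"
    and "\<And>i. i \<in> I \<Longrightarrow> (\<lambda>x. z x i) \<in> borel_measurable M"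
  shows "(\<lambda>x. G (z x) j) \<in> borel_measurable M"
proof -
  obtain w A b F where F: "mlp_tail \<sigma> w J F"
    and G: "G = (\<lambda>x. F (\<lambda>i. \<sigma> (affine_on I {..<w} A b x i)))"
    using assms(1) unfolding mlp_def by blast
  have "(\<lambda>x. \<sigma> (affine_on I {..<w} A b (z x) i)) \<in> borel_measurable M" for i
    by (rule measurable_compose[OF affine_on_measurable[OF assms(3)] assms(2)])
  then show ?thesis
    unfolding G by (rule mlp_tail_measurable[OF F assms(2)])
qed


section \<open>IMNO models\<close>

record 'd fno_layer =
  weight :: "nat \<Rightarrow> nat \<Rightarrow> real"
  cond_mat :: "nat \<Rightarrow> nat \<Rightarrow> real"
  cond_vec :: "nat \<Rightarrow> real"
  modes :: "(int^('d::finite)) set"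
  multiplier :: "int^'d \<Rightarrow> nat \<Rightarrow> nat \<Rightarrow> complex"

record ('d, 'c) imno =
  activation :: "real \<Rightarrow> real"
  latent_dim :: nat
  enc_cutoff :: nat
  dec_cutoff :: nat
  enc_net :: "((int^('d::finite)) \<times> 'c \<Rightarrow> real) \<Rightarrow> (nat \<Rightarrow> real)"
  dec_net :: "(nat \<Rightarrow> real) \<Rightarrow> ((int^'d) \<times> 'c \<Rightarrow> real)"
  dyn_net :: "(nat \<Rightarrow> real) \<Rightarrow> (nat \<Rightarrow> real)"
  width :: nat
  lift_net :: "('c + 'd \<Rightarrow> real) \<Rightarrow> (nat \<Rightarrow> real)"
  layers :: "'d fno_layer list"
  proj_net :: "(nat \<Rightarrow> real) \<Rightarrow> ('c \<Rightarrow> real)"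

definition kernel_op ::
    "nat \<Rightarrow> 'd fno_layer \<Rightarrow> (real^'d \<Rightarrow> nat \<Rightarrow> real) \<Rightarrow> real^('d::finite) \<Rightarrow> nat \<Rightarrow> complex" where
  "kernel_op dc l v x i =
     (\<Sum>k\<in>modes l. (\<Sum>j<dc. multiplier l k i j * fcoef (\<lambda>y. v y j) k) * cis (freq_dot k x))"

definition layer_op ::
    "('d, 'c) imno \<Rightarrow> (nat \<Rightarrow> real) \<Rightarrow> 'd fno_layer \<Rightarrow>
     (real^'d \<Rightarrow> nat \<Rightarrow> real) \<Rightarrow> (real^('d::finite) \<Rightarrow> nat \<Rightarrow> real)" where
  "layer_op \<Theta> h l v = (\<lambda>x i. if i < width \<Theta> then
       activation \<Theta> ((\<Sum>j<width \<Theta>. weight l i j * v x j)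
         + affine_on {..<latent_dim \<Theta>} {..<width \<Theta>} (cond_mat l) (cond_vec l) h i
         + Re (kernel_op (width \<Theta>) l v x i))
     else 0)"

definition lifting ::
    "('d, 'c) imno \<Rightarrow> (real^'d \<Rightarrow> real^'c) \<Rightarrow> (real^('d::finite) \<Rightarrow> nat \<Rightarrow> real)" where
  "lifting \<Theta> f = (\<lambda>x. lift_net \<Theta> (case_sum (\<lambda>j. f x $ j) (\<lambda>i. x $ i)))"

definition residual_state ::
    "('d, 'c) imno \<Rightarrow> (nat \<Rightarrow> real) \<Rightarrow> nat \<Rightarrow> (real^'d \<Rightarrow> real^'c) \<Rightarrow>
     (real^('d::finite) \<Rightarrow> nat \<Rightarrow> real)" where
  "residual_state \<Theta> h n f = fold (layer_op \<Theta> h) (take n (layers \<Theta>)) (lifting \<Theta> f)"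

definition residual_fun ::
    "('d, 'c) imno \<Rightarrow> (nat \<Rightarrow> real) \<Rightarrow> (real^'d \<Rightarrow> real^'c) \<Rightarrow> (real^('d::finite) \<Rightarrow> real^'c)" where
  "residual_fun \<Theta> h f =
     (\<lambda>x. \<chi> j. proj_net \<Theta> (residual_state \<Theta> h (length (layers \<Theta>)) f x) j)"

text \<open>For an \<open>imno_model\<close> the choice of the representative is immaterial, see
  \<open>residual_abs\<close> below.\<close>

definition residual_op ::
    "('d, 'c) imno \<Rightarrow> ('d, 'c) torus_fun \<Rightarrow> (nat \<Rightarrow> real) \<Rightarrow> ('d::finite, 'c::finite) torus_fun" where
  "residual_op \<Theta> u h = abs_torus_fun (residual_fun \<Theta> h (rep_torus_fun u))"

definition encoder :: "('d, 'c) imno \<Rightarrow> ('d::finite, 'c::finite) torus_fun \<Rightarrow> (nat \<Rightarrow> real)" where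
  "encoder \<Theta> u = enc_net \<Theta> (fourier_coords (enc_cutoff \<Theta>) u)"

definition decoder :: "('d, 'c) imno \<Rightarrow> (nat \<Rightarrow> real) \<Rightarrow> ('d::finite, 'c::finite) torus_fun" where
  "decoder \<Theta> h = fourier_synth (dec_cutoff \<Theta>) (dec_net \<Theta> h)"

text \<open>Admissible parameters.  Continuity of the activation is part of the standard universal
  approximation setting and makes the pointwise maps respect almost-everywhere equality.  The last two conditions say that each Fourier multiplier maps real
  functions to real functions, and that the residual operator is well-defined as a map
  $H^s \times R^{d_h} \to H^s$ (its hidden states are square integrable, so that their Fourier
  coefficients make sense, and its output lies in $H^s$).\<close>

definition imno_model :: "real \<Rightarrow> ('d::finite, 'c::finite) imno \<Rightarrow> bool" where
  "imno_model s \<Theta> \<longleftrightarrow>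
     continuous_on UNIV (activation \<Theta>) \<and> universal_approximation (activation \<Theta>) \<and>
     latent_dim \<Theta> > 0 \<and> width \<Theta> > 0 \<and> layers \<Theta> \<noteq> [] \<and>
     mlp (activation \<Theta>) (freq_box (enc_cutoff \<Theta>) \<times> UNIV) {..<latent_dim \<Theta>} (enc_net \<Theta>) \<and>
     mlp (activation \<Theta>) {..<latent_dim \<Theta>} (freq_box (dec_cutoff \<Theta>) \<times> UNIV) (dec_net \<Theta>) \<and>
     mlp (activation \<Theta>) {..<latent_dim \<Theta>} {..<latent_dim \<Theta>} (dyn_net \<Theta>) \<and>
     mlp (activation \<Theta>) UNIV {..<width \<Theta>} (lift_net \<Theta>) \<and>
     mlp (activation \<Theta>) {..<width \<Theta>} UNIV (proj_net \<Theta>) \<and>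
     (\<forall>l\<in>set (layers \<Theta>). finite (modes l) \<and>
        (\<forall>v. (\<forall>j<width \<Theta>. (\<lambda>x. v x j) \<in> L2_torus) \<longrightarrow>
             (\<forall>x. \<forall>i<width \<Theta>. kernel_op (width \<Theta>) l v x i \<in> \<real>))) \<and>
     (\<forall>u\<in>Hs s. \<forall>h\<in>topspace (Euclidean_space (latent_dim \<Theta>)).
        (\<forall>n<length (layers \<Theta>). \<forall>j<width \<Theta>.
           (\<lambda>x. residual_state \<Theta> h n (rep_torus_fun u) x j) \<in> L2_torus) \<and>
        residual_op \<Theta> u h \<in> Hs s)"

lemma residual_fun_ae_eq:
  fixes \<Theta> :: "('d::finite, 'c::finite) imno"
  assumes "imno_model s \<Theta>" and fg: "ae_eq f g"
  shows "ae_eq (residual_fun \<Theta> h f) (residual_fun \<Theta> h g)"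
proof -
  have \<sigma>: "activation \<Theta> \<in> borel_measurable borel"
    using assms(1) by (auto simp: imno_model_def intro: borel_measurable_continuous_onI)
  define Eq where "Eq v v' \<longleftrightarrow> (\<forall>j. (\<lambda>x. v x j) \<in> borel_measurable torus) \<and>
      (\<forall>j. (\<lambda>x. v' x j) \<in> borel_measurable torus) \<and> (AE x in torus. v x = v' x)"
    for v v' :: "real^'d \<Rightarrow> nat \<Rightarrow> real"
  have "mlp (activation \<Theta>) UNIV {..<width \<Theta>} (lift_net \<Theta>)"
    using assms(1) by (simp add: imno_model_def)
  then have lift: "(\<lambda>x. lifting \<Theta> f x j) \<in> borel_measurable torus"
    if "f \<in> borel_measurable torus" for f j
    unfolding lifting_def
  proof (rule mlp_measurable[where z = "\<lambda>x. case_sum (\<lambda>j. f x $ j) (\<lambda>i. x $ i)", OF _ \<sigma>])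
    show "(\<lambda>x. case i of Inl j \<Rightarrow> f x $ j | Inr i \<Rightarrow> x $ i) \<in> borel_measurable torus" for i
      using that by (cases i) auto
  qed
  have "Eq (lifting \<Theta> f) (lifting \<Theta> g)"
    using fg by (auto simp: Eq_def ae_eq_def lifting_def intro!: lift[unfolded lifting_def])
  moreover have "Eq (layer_op \<Theta> h l v) (layer_op \<Theta> h l v')" if "Eq v v'" for l v v'
  proof -
    have "fcoef (\<lambda>y. v y j) k = fcoef (\<lambda>y. v' y j) k" for j k
      using that by (intro fcoef_cong_AE) (auto simp: Eq_def)
    then have *: "kernel_op (width \<Theta>) l v = kernel_op (width \<Theta>) l v'"
      by (simp add: kernel_op_def fun_eq_iff)
    have K: "(\<lambda>x. Re (kernel_op (width \<Theta>) l w x i)) \<in> borel_measurable torus" for w i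
      unfolding kernel_op_def cis_conv_exp by measurable
    have "(\<lambda>x. layer_op \<Theta> h l w x i) \<in> borel_measurable torus"
      if "\<And>j. (\<lambda>x. w x j) \<in> borel_measurable torus" for w i
      unfolding layer_op_def using that K
      by (cases "i < width \<Theta>") (auto intro!: measurable_compose[OF _ \<sigma>])
    moreover have "AE x in torus. layer_op \<Theta> h l v x = layer_op \<Theta> h l v' x"
      using that unfolding Eq_def layer_op_def * by (auto elim!: eventually_mono)
    ultimately show ?thesis using that by (auto simp: Eq_def)
  qed
  then have "Eq v v' \<Longrightarrow> Eq (fold (layer_op \<Theta> h) ls v) (fold (layer_op \<Theta> h) ls v')" for ls v v'
    by (induction ls arbitrary: v v') auto
  ultimately have state: "Eq (residual_state \<Theta> h n f) (residual_state \<Theta> h n g)" for n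
    by (simp add: residual_state_def)
  have proj: "mlp (activation \<Theta>) {..<width \<Theta>} UNIV (proj_net \<Theta>)"
    using assms(1) by (simp add: imno_model_def)
  have comp: "(\<lambda>x. proj_net \<Theta> (v x) j) \<in> borel_measurable torus"
    if "\<And>i. (\<lambda>x. v x i) \<in> borel_measurable torus" for v :: "real^'d \<Rightarrow> nat \<Rightarrow> real" and j
    by (rule mlp_measurable[where z = v, OF proj \<sigma>]) (rule that)
  have vec: "(\<lambda>x. \<chi> j. proj_net \<Theta> (v x) j) \<in> borel_measurable torus"
    if "\<And>i. (\<lambda>x. v x i) \<in> borel_measurable torus" for v :: "real^'d \<Rightarrow> nat \<Rightarrow> real"
    by (rule borel_measurable_vec_lambda[of "\<lambda>x. proj_net \<Theta> (v x)"], rule comp) (rule that)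
  show ?thesis
    using state[of "length (layers \<Theta>)"] unfolding ae_eq_def residual_fun_def Eq_def
    by (auto intro!: vec elim!: eventually_mono)
qed

lemma residual_abs:
  assumes "imno_model s \<Theta>" and "f \<in> borel_measurable torus"
  shows "residual_op \<Theta> (abs_torus_fun f) h = abs_torus_fun (residual_fun \<Theta> h f)"
proof -
  have "ae_eq f f" using assms(2) by (simp add: ae_eq_def)
  then have "ae_eq (rep_torus_fun (abs_torus_fun f)) f"
    using Quotient3_torus_fun by (rule rep_abs_rsp_left[rotated])
  then show ?thesis unfolding residual_op_def
    using Quotient3_rel_abs[OF Quotient3_torus_fun] residual_fun_ae_eq[OF assms(1)] by blast
qed

definition latent_step :: "('d::finite, 'c::finite) imno \<Rightarrow> real \<Rightarrow> (nat \<Rightarrow> real) \<Rightarrow> (nat \<Rightarrow> real)" where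
  "latent_step \<Theta> \<Delta>t h = (\<lambda>i. h i + \<Delta>t * dyn_net \<Theta> h i)"

definition manifold_next ::
    "('d, 'c) imno \<Rightarrow> real \<Rightarrow> ('d::finite, 'c::finite) torus_fun \<Rightarrow> ('d, 'c) torus_fun" where
  "manifold_next \<Theta> \<Delta>t u = decoder \<Theta> (latent_step \<Theta> \<Delta>t (encoder \<Theta> u))"

definition residual_next ::
    "('d, 'c) imno \<Rightarrow> real \<Rightarrow> ('d::finite, 'c::finite) torus_fun \<Rightarrow> ('d, 'c) torus_fun" where
  "residual_next \<Theta> \<Delta>t u =
     residual_op \<Theta> (u - decoder \<Theta> (encoder \<Theta> u)) (latent_step \<Theta> \<Delta>t (encoder \<Theta> u))"

definition imno_step ::
    "('d, 'c) imno \<Rightarrow> real \<Rightarrow> ('d::finite, 'c::finite) torus_fun \<Rightarrow> ('d, 'c) torus_fun" where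
  "imno_step \<Theta> \<Delta>t u = manifold_next \<Theta> \<Delta>t u + residual_next \<Theta> \<Delta>t u"

end

theory Submission
  imports Defs
begin

text \<open>
  The activation is $\sigma(t) = t + \sin t$.  From $\sigma(t) + \sigma(t+\pi) = 2t + \pi$ and
  $\sigma(t) - \sigma(t+\pi) = 2\sin t - \pi$, networks with this activation contain all affine
  maps and all finite sums of sines of affine functions, exactly.  Such sums form an algebra, so
  the Stone--Weierstrass theorem makes them dense in the continuous functions on any compact set
  of families whose points their inputs separate (\<open>mlp_dense\<close>).  This gives universal
  approximation, and, because a function in $H^s$ is determined by its Fourier coefficients, it
  also gives encoders: every finite list of continuous functionals on a compact subset of $H^s$ is
  uniformly approximated by a network in finitely many Fourier coordinates
  (\<open>encoder_dense\<close>).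

  Let $\Pi$ be the phase map and write $u^M = \Pi(\mathcal G(u))$, $u^R = \mathcal G(u) - u^M$ for the
  two reference components after one step.  On the compact images of $K$ the Fourier tails are uniformly small in $H^s$
  (\<open>compact_uniform_tail\<close>), so it suffices to predict the finitely many Fourier coordinates of
  $u^M$ and $u^R$ below some cutoff $N$.  The encoder produces approximations of all these
  data: the coordinates $a_p(u)$ of $u^M$ themselves, and, for the coordinates $b_p(u)$ of $u^R$, the
  angles $\theta_p(u) = \arccos (b_p(u)/R)$, where $R$ bounds them on $K$.  These depend
  continuously on $u$.  The latent dynamics is the identity (the network $f_\theta$ is zero) and the
  decoder reads off the coordinates $a_p$.

  The residual operator has to turn the angles, which enter only as spatially constant biases, into
  the trigonometric polynomial with coordinates $R\cos\theta_p$, and its error has to be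
  small in $H^s$, not only uniformly.  This is done without error, by
  $2\cos\theta\,\sin X = \sin(X+\theta) + \sin(X-\theta)$: the lifting produces the linear
  functions $x \mapsto k\cdot x$, one layer with biases $\pm\theta_p$ (and shifts by $\pi$, to
  extract sines from $\sigma$) produces the phase-modulated waves, and the projection combines them linearly
  (\<open>residual_fun_phase_imno\<close>).  The output is a trigonometric polynomial whatever the latent
  vector is, hence always lies in $H^s$.

  That the distance on $H^s$ is a metric is the uniqueness theorem for Fourier coefficients on the
  torus, proved in \<open>fcoef_zero_imp_AE_zero\<close>.
\<close>

section \<open>Integration over the torus\<close>

text \<open>The fundamental cell $[0,2\pi)^d$ that carries the measure \<^const>\<open>torus\<close>.\<close>

definition cell :: "(real^'d) set" where
  "cell = {x. \<forall>i. 0 \<le> x $ i \<and> x $ i < 2 * pi}"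

lemma cell_measurable [measurable]: "cell \<in> sets borel"
proof -
  have "cell = (\<Inter>i. {x \<in> space borel. 0 \<le> x $ i \<and> x $ i < 2 * pi})"
    by (auto simp: cell_def)
  also have "\<dots> \<in> sets borel" 
    by (intro sets.countable_INT'') (auto intro!: countable_finite)
  finally show ?thesis .
qed

lemma torus_restrict: "torus = restrict_space lborel cell"
  by (simp add: torus_def cell_def)

lemma space_torus: "space torus = cell"
  by (simp add: torus_restrict space_restrict_space)

lemma finite_measure_torus: "finite_measure (torus :: (real^'d) measure)"
proof
  have "cell \<subseteq> cbox 0 (\<chi> i. 2 * pi :: real^'d)"
    by (auto simp: cell_def mem_box_cart less_imp_le)
  then have "emeasure lborel (cell :: (real^'d) set) \<le> emeasure lborel (cbox 0 (\<chi> i. 2 * pi :: real^'d))"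
    by (intro emeasure_mono) auto
  also have "\<dots> < \<infinity>"
    by (simp add: emeasure_lborel_cbox_eq)
  finally show "emeasure torus (space (torus :: (real^'d) measure)) \<noteq> \<infinity>"
    by (simp add: space_torus) (simp add: torus_restrict emeasure_restrict_space)
qed

lemma integrable_torus_bounded:
  fixes f :: "real^'d \<Rightarrow> 'b::{banach, second_countable_topology}"
  assumes "f \<in> borel_measurable torus" "\<And>x. x \<in> cell \<Longrightarrow> norm (f x) \<le> B"
  shows "integrable torus f"
  using finite_measure_torus assms
  by (intro finite_measure.integrable_const_bound[where B = B]) (auto simp: space_torus intro!: AE_I2)

lemma integral_cis_period:
  "(LINT t|lborel. indicator {0..<2 * pi} t *\<^sub>R cis (real_of_int n * t)) =
     (if n = 0 then of_real (2 * pi) else 0)"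
proof -
  have "(LINT t|lborel. indicator {0..<2 * pi} t *\<^sub>R cis (real_of_int n * t)) =
        (LINT t|lborel. indicator {0..2 * pi} t *\<^sub>R cis (real_of_int n * t))"
  proof (rule integral_cong_AE)
    show "AE t in lborel. indicator {0..<2 * pi} t *\<^sub>R cis (real_of_int n * t) =
        indicator {0..2 * pi} t *\<^sub>R cis (real_of_int n * t)"
      using AE_lborel_singleton[of "2 * pi"]
      by eventually_elim (auto simp: indicator_def)
  qed (auto simp: cis_conv_exp)
  also have "\<dots> = (if n = 0 then of_real (2 * pi) else 0)"
  proof (cases "n = 0")
    case False
    have "(LINT t|lborel. indicator {0..2 * pi} t *\<^sub>R cis (real_of_int n * t)) =
        cis (real_of_int n * (2 * pi)) / (\<i> * of_int n) - cis (real_of_int n * 0) / (\<i> * of_int n)"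
    proof (rule integral_FTC_Icc)
      show "((\<lambda>t. cis (real_of_int n * t) / (\<i> * of_int n)) has_vector_derivative
          cis (real_of_int n * x)) (at x within {0..2 * pi})" for x
        unfolding cis_conv_exp of_real_mult of_real_of_int_eq using False
        by (intro has_vector_derivative_real_field)
           (auto intro!: derivative_eq_intros simp: algebra_simps)
    qed (auto intro!: continuous_intros)
    then show ?thesis using False
      using cis_multiple_2pi[of "of_int n"] by (simp add: ac_simps)
  qed (simp add: scaleR_conv_of_real)
  finally show ?thesis .
qed

lemma integral_cis_torus:
  "(LINT x|torus. cis (freq_dot k x)) =
     (if k = 0 then of_real ((2 * pi) ^ CARD('d)) else 0)" for k :: "int^'d"
proof -
  define \<kappa> :: "real^'d" where "\<kappa> = (\<chi> i. real_of_int (k $ i))"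
  define g where "g b t = indicator {0..<2 * pi} t *\<^sub>R cis ((\<kappa> \<bullet> b) * t)" for b :: "real^'d" and t :: real
  have Basis: "(Basis :: (real^'d) set) = (\<lambda>i. axis i 1) ` UNIV"
    by (auto simp: Basis_vec_def)
  have inj: "inj (\<lambda>i::'d. axis i (1::real))"
    by (auto simp: inj_on_def axis_eq_axis)
  have *: "indicator cell x *\<^sub>R cis (freq_dot k x) = (\<Prod>b\<in>Basis. g b (x \<bullet> b))" for x
  proof -
    have "cis (freq_dot k x) = (\<Prod>i\<in>UNIV. cis (real_of_int (k $ i) * x $ i))"
      by (simp add: freq_dot_def cis_conv_exp sum_distrib_left exp_sum)
    moreover have "indicator cell x = (\<Prod>i\<in>UNIV. indicator {0..<2 * pi} (x $ i) :: real)"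
      by (auto simp: cell_def indicator_def)
    ultimately have "indicator cell x *\<^sub>R cis (freq_dot k x) =
        (\<Prod>i\<in>UNIV. indicator {0..<2 * pi} (x $ i) *\<^sub>R cis (real_of_int (k $ i) * x $ i))"
      by (simp add: scaleR_conv_of_real prod.distrib)
    also have "\<dots> = (\<Prod>b\<in>Basis. g b (x \<bullet> b))"
      unfolding Basis by (subst prod.reindex[OF inj]) (simp add: g_def \<kappa>_def inner_axis)
    finally show ?thesis .
  qed
  interpret product_sigma_finite "\<lambda>_::real^'d. lborel :: real measure" ..
  have [measurable]: "g b \<in> borel_measurable borel" for b
    unfolding g_def cis_conv_exp by measurable
  have "(LINT x|torus. cis (freq_dot k x)) = (LINT x|lborel. indicator cell x *\<^sub>R cis (freq_dot k x))"
    unfolding torus_restrict by (subst integral_restrict_space) simp_all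
  also have "\<dots> = (LINT x|lborel. (\<Prod>b\<in>Basis. g b (x \<bullet> b)))"
    by (simp only: *)
  also have "\<dots> = (LINT f|Pi\<^sub>M Basis (\<lambda>_. lborel). (\<Prod>b\<in>Basis. g b ((\<Sum>b'\<in>Basis. f b' *\<^sub>R b') \<bullet> b)))"
    by (subst lborel_eq, subst integral_distr) simp_all
  also have "\<dots> = (LINT f|Pi\<^sub>M Basis (\<lambda>_. lborel). (\<Prod>b\<in>Basis. g b (f b)))"
    by (simp add: inner_sum_left inner_Basis if_distrib[of "\<lambda>z. _ * z"] sum.delta cong: if_cong)
  also have "\<dots> = (\<Prod>b\<in>Basis. LINT t|lborel. g b t)"
  proof (rule product_integral_prod)
    show "integrable lborel (g b)" for b
    proof (rule Bochner_Integration.integrable_bound[of _ "indicator {0..<2 * pi} :: real \<Rightarrow> real"])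
      show "AE t in lborel. norm (g b t) \<le> norm (indicator {0..<2 * pi} t :: real)"
        by (auto simp: g_def norm_mult indicator_def)
    qed simp_all
  qed simp
  also have "\<dots> = (\<Prod>i\<in>UNIV. LINT t|lborel. g (axis i 1) t)"
    unfolding Basis by (subst prod.reindex[OF inj]) simp
  also have "\<dots> = (\<Prod>i\<in>UNIV. if k $ i = 0 then of_real (2 * pi) else 0)"
    by (simp add: g_def \<kappa>_def inner_axis integral_cis_period)
  also have "\<dots> = (if k = 0 then of_real ((2 * pi) ^ CARD('d)) else 0)"
    by (auto simp: vec_eq_iff)
  finally show ?thesis .
qed

section \<open>Fourier coefficients and weighted sequence norms\<close>

lemma square_integrable_comp:
  fixes f :: "real^'d \<Rightarrow> real^'c"
  assumes "f \<in> borel_measurable torus" "integrable torus (\<lambda>x. (norm (f x))\<^sup>2)"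
  shows "integrable torus (\<lambda>x. f x $ j)"
proof (rule Bochner_Integration.integrable_bound)
  interpret finite_measure "torus :: (real^'d) measure" by (rule finite_measure_torus)
  show "integrable torus (\<lambda>x. 1 + (norm (f x))\<^sup>2)" using assms(2) by simp
  have "\<bar>f x $ j\<bar> \<le> 1 + (norm (f x))\<^sup>2" for x
  proof -
    have "\<bar>f x $ j\<bar> \<le> norm (f x)" by (rule component_le_norm_cart)
    also have "\<dots> \<le> 1 + (norm (f x))\<^sup>2"
      using zero_le_power2[of "norm (f x) - 1/2"] by (simp add: power2_eq_square algebra_simps)
    finally show ?thesis .
  qed
  then show "AE x in torus. norm (f x $ j) \<le> norm (1 + (norm (f x))\<^sup>2)"
    by (intro AE_I2) simp
qed (use assms in measurable)

lemma integrable_mult_cis: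
  assumes "integrable torus g"
  shows "integrable torus (\<lambda>x. complex_of_real (g x) * cis (freq_dot k x))"
    and "integrable torus (\<lambda>x. complex_of_real (g x) * cis (- freq_dot k x))"
proof -
  have [measurable]: "g \<in> borel_measurable torus" using assms by simp
  show "integrable torus (\<lambda>x. complex_of_real (g x) * cis (freq_dot k x))"
    by (rule Bochner_Integration.integrable_bound[OF assms]) (auto simp: norm_mult cis_conv_exp)
  show "integrable torus (\<lambda>x. complex_of_real (g x) * cis (- freq_dot k x))"
    by (rule Bochner_Integration.integrable_bound[OF assms]) (auto simp: norm_mult cis_conv_exp)
qed

lemma fcoef_add:
  assumes "integrable torus f" "integrable torus g"
  shows "fcoef (\<lambda>x. f x + g x) k = fcoef f k + fcoef g k"
  using integrable_mult_cis(2)[OF assms(1), of k] integrable_mult_cis(2)[OF assms(2), of k]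
  by (simp add: fcoef_def ring_distribs add_divide_distrib)

lemma fcoef_cmult: "fcoef (\<lambda>x. c * f x) k = of_real c * fcoef f k"
  by (simp add: fcoef_def mult.assoc)

lemma fcoef_sum:
  assumes "\<And>i. i \<in> A \<Longrightarrow> integrable torus (f i)"
  shows "fcoef (\<lambda>x. \<Sum>i\<in>A. f i x) k = (\<Sum>i\<in>A. fcoef (f i) k)"
proof -
  have "(LINT x|torus. (\<Sum>i\<in>A. of_real (f i x) * cis (- freq_dot k x))) =
      (\<Sum>i\<in>A. LINT x|torus. of_real (f i x) * cis (- freq_dot k x))"
    using integrable_mult_cis(2)[OF assms] by (intro Bochner_Integration.integral_sum)
  then show ?thesis by (simp add: fcoef_def sum_distrib_right sum_divide_distrib)
qed

lemma square_integrable_add: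
  assumes "square_integrable u" "square_integrable v"
  shows "square_integrable (u + v)"
  using assms
proof transfer
  fix f g :: "real^'d \<Rightarrow> real^'c"
  assume ae: "ae_eq f f" "ae_eq g g" and
    i: "integrable torus (\<lambda>x. (norm (f x))\<^sup>2)" "integrable torus (\<lambda>x. (norm (g x))\<^sup>2)"
  have [measurable]: "f \<in> borel_measurable torus" "g \<in> borel_measurable torus"
    using ae by (auto simp: ae_eq_def)
  show "integrable torus (\<lambda>x. (norm (f x + g x))\<^sup>2)"
  proof (rule Bochner_Integration.integrable_bound)
    show "integrable torus (\<lambda>x. 2 * (norm (f x))\<^sup>2 + 2 * (norm (g x))\<^sup>2)"
      using i by simp
    have "(norm (f x + g x))\<^sup>2 \<le> 2 * (norm (f x))\<^sup>2 + 2 * (norm (g x))\<^sup>2" for x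
    proof -
      have "(norm (f x + g x))\<^sup>2 \<le> (norm (f x) + norm (g x))\<^sup>2"
        by (intro power_mono norm_triangle_ineq) simp
      also have "\<dots> \<le> 2 * (norm (f x))\<^sup>2 + 2 * (norm (g x))\<^sup>2"
        using zero_le_power2[of "norm (f x) - norm (g x)"]
        by (simp add: power2_eq_square algebra_simps)
      finally show ?thesis .
    qed
    then show "AE x in torus. norm ((norm (f x + g x))\<^sup>2) \<le>
        norm (2 * (norm (f x))\<^sup>2 + 2 * (norm (g x))\<^sup>2)"
      by (intro AE_I2) simp
  qed simp
qed

lemma square_integrable_uminus: "square_integrable (- u) \<longleftrightarrow> square_integrable u"
  by transfer simp

lemma fourier_add:
  assumes "square_integrable u" "square_integrable v"
  shows "fourier (u + v) k = fourier u k + fourier v k"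
  using assms
proof transfer
  fix f g :: "real^'d \<Rightarrow> real^'c" and k
  assume ae: "ae_eq f f" "ae_eq g g" and
    i: "integrable torus (\<lambda>x. (norm (f x))\<^sup>2)" "integrable torus (\<lambda>x. (norm (g x))\<^sup>2)"
  have "integrable torus (\<lambda>x. f x $ j)" "integrable torus (\<lambda>x. g x $ j)" for j
    using ae i by (auto simp: ae_eq_def intro!: square_integrable_comp)
  then show "(\<chi> j. fcoef (\<lambda>x. (f x + g x) $ j) k) =
      (\<chi> j. fcoef (\<lambda>x. f x $ j) k) + (\<chi> j. fcoef (\<lambda>x. g x $ j) k)"
    by (simp add: vec_eq_iff fcoef_add)
qed

lemma fourier_minus_self: "fourier (- u) k = - fourier u k"
proof transfer
  fix f :: "real^'d \<Rightarrow> real^'c" and k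
  show "(\<chi> j. fcoef (\<lambda>x. (- f x) $ j) k) = - (\<chi> j. fcoef (\<lambda>x. f x $ j) k)"
    using fcoef_cmult[of "-1" "\<lambda>x. f x $ j" k for j] by (simp add: vec_eq_iff)
qed

lemma fourier_diff:
  assumes "square_integrable u" "square_integrable v"
  shows "fourier (u - v) k = fourier u k - fourier v k"
  using fourier_add[of u "- v" k] assms
  by (simp add: square_integrable_uminus fourier_minus_self)

lemma sobolev_weight_pos: "sobolev_weight s k > 0"
proof -
  have "0 \<le> (\<Sum>i\<in>UNIV. (real_of_int (k $ i))\<^sup>2)" by (intro sum_nonneg) simp
  then show ?thesis by (simp add: sobolev_weight_def)
qed

lemma sobolev_weight_ge_1:
  assumes "s \<ge> 0" shows "sobolev_weight s k \<ge> 1"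
proof -
  have "0 \<le> (\<Sum>i\<in>UNIV. (real_of_int (k $ i))\<^sup>2)" by (intro sum_nonneg) simp
  then show ?thesis using assms by (simp add: sobolev_weight_def ge_one_powr_ge_zero)
qed

text \<open>The $H^s$ seminorm of the part of \<open>u\<close> with frequencies in \<open>A\<close>; it is computed from the Fourier coefficients, without projecting \<open>u\<close>.\<close>

definition band_norm :: "real \<Rightarrow> (int^'d) set \<Rightarrow> ('d::finite, 'c::finite) torus_fun \<Rightarrow> real" where
  "band_norm s A u = sqrt (\<Sum>\<^sub>\<infinity>k\<in>A. sobolev_weight s k * (norm (fourier u k))\<^sup>2)"

lemma Hs_norm_band: "Hs_norm s u = band_norm s UNIV u"
  by (simp add: Hs_norm_def band_norm_def)

lemma weighted_summable:
  assumes "u \<in> Hs s"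
  shows "(\<lambda>k. sobolev_weight s k * (norm (fourier u k))\<^sup>2) summable_on A"
  using assms by (auto simp: Hs_def intro: summable_on_subset_banach)

lemma weighted_nonneg: "0 \<le> sobolev_weight s k * (norm (fourier u k))\<^sup>2"
  using sobolev_weight_pos[of s k] by simp

lemma band_norm_nonneg: "0 \<le> band_norm s A u"
  unfolding band_norm_def by (intro real_sqrt_ge_zero infsum_nonneg weighted_nonneg)

lemma L2_set_eq_band:
  "L2_set (\<lambda>k. sqrt (sobolev_weight s k) * norm (fourier u k)) F =
     sqrt (\<Sum>k\<in>F. sobolev_weight s k * (norm (fourier u k))\<^sup>2)"
  by (simp add: L2_set_def power_mult_distrib sobolev_weight_pos less_imp_le)

lemma L2_set_le_band_norm:
  assumes "u \<in> Hs s" "finite F" "F \<subseteq> A"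
  shows "L2_set (\<lambda>k. sqrt (sobolev_weight s k) * norm (fourier u k)) F \<le> band_norm s A u"
  unfolding L2_set_eq_band band_norm_def
  using assms by (intro real_sqrt_le_mono finite_sum_le_infsum weighted_summable weighted_nonneg)

text \<open>The seminorm is the supremum of Euclidean norms over finite sets of frequencies, which reduces statements about it to finite sums.\<close>

lemma summable_band_normI:
  assumes "\<And>F. finite F \<Longrightarrow> F \<subseteq> A \<Longrightarrow>
      L2_set (\<lambda>k. sqrt (sobolev_weight s k) * norm (fourier u k)) F \<le> B"
  shows "(\<lambda>k. sobolev_weight s k * (norm (fourier u k))\<^sup>2) summable_on A"
    and "band_norm s A u \<le> B"
proof -
  have B: "0 \<le> B" using assms[of "{}"] by simp
  have *: "(\<Sum>k\<in>F. sobolev_weight s k * (norm (fourier u k))\<^sup>2) \<le> B\<^sup>2"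
    if "finite F" "F \<subseteq> A" for F
  proof -
    have "sqrt (\<Sum>k\<in>F. sobolev_weight s k * (norm (fourier u k))\<^sup>2) \<le> B"
      using assms[OF that] by (simp add: L2_set_eq_band)
    then show ?thesis by (simp add: sqrt_le_D)
  qed
  show sm: "(\<lambda>k. sobolev_weight s k * (norm (fourier u k))\<^sup>2) summable_on A"
    using * by (intro nonneg_bdd_above_summable_on weighted_nonneg bdd_aboveI2) auto
  have "(\<Sum>\<^sub>\<infinity>k\<in>A. sobolev_weight s k * (norm (fourier u k))\<^sup>2) \<le> B\<^sup>2"
    using * by (intro infsum_le_finite_sums[OF sm])
  then show "band_norm s A u \<le> B"
    unfolding band_norm_def using B by (simp add: real_le_lsqrt infsum_nonneg weighted_nonneg)
qed

lemma Hs_add_band: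
  assumes "u \<in> Hs s" "v \<in> Hs s"
  shows "u + v \<in> Hs s" and "band_norm s A (u + v) \<le> band_norm s A u + band_norm s A v"
proof -
  have sq: "square_integrable u" "square_integrable v" using assms by (auto simp: Hs_def)
  have *: "L2_set (\<lambda>k. sqrt (sobolev_weight s k) * norm (fourier (u + v) k)) F
      \<le> band_norm s B u + band_norm s B v" if "finite F" "F \<subseteq> B" for F B
  proof -
    have "L2_set (\<lambda>k. sqrt (sobolev_weight s k) * norm (fourier (u + v) k)) F \<le>
        L2_set (\<lambda>k. sqrt (sobolev_weight s k) * norm (fourier u k) +
                    sqrt (sobolev_weight s k) * norm (fourier v k)) F"
      by (intro L2_set_mono)
         (auto simp: fourier_add[OF sq] distrib_left[symmetric] sobolev_weight_pos less_imp_le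
           intro!: mult_left_mono norm_triangle_ineq)
    also have "\<dots> \<le> L2_set (\<lambda>k. sqrt (sobolev_weight s k) * norm (fourier u k)) F +
        L2_set (\<lambda>k. sqrt (sobolev_weight s k) * norm (fourier v k)) F"
      by (rule L2_set_triangle_ineq)
    also have "\<dots> \<le> band_norm s B u + band_norm s B v"
      by (intro add_mono L2_set_le_band_norm assms that)
    finally show ?thesis .
  qed
  show "u + v \<in> Hs s"
    using summable_band_normI(1)[of UNIV s "u + v", OF *] sq
    by (auto simp: Hs_def square_integrable_add)
  show "band_norm s A (u + v) \<le> band_norm s A u + band_norm s A v"
    by (rule summable_band_normI(2)[OF *])
qed

lemma Hs_uminus: "- u \<in> Hs s \<longleftrightarrow> u \<in> Hs s"
  by (simp add: Hs_def square_integrable_uminus fourier_minus_self)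

lemma band_norm_uminus: "band_norm s A (- u) = band_norm s A u"
  by (simp add: band_norm_def fourier_minus_self)

lemma Hs_diff_band:
  assumes "u \<in> Hs s" "v \<in> Hs s"
  shows "u - v \<in> Hs s" and "band_norm s A (u - v) \<le> band_norm s A u + band_norm s A v"
  using Hs_add_band[of u s "- v"] assms by (simp_all add: Hs_uminus band_norm_uminus)

lemma band_norm_le_Hs_norm:
  assumes "u \<in> Hs s" shows "band_norm s A u \<le> Hs_norm s u"
  unfolding Hs_norm_band using assms by (intro summable_band_normI L2_set_le_band_norm) auto

lemma norm_fourier_le_Hs_norm:
  assumes "s \<ge> 0" "u \<in> Hs s" shows "norm (fourier u k) \<le> Hs_norm s u"
proof -
  have "1 * norm (fourier u k) \<le> sqrt (sobolev_weight s k) * norm (fourier u k)"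
    using sobolev_weight_ge_1[OF assms(1), of k] by (intro mult_right_mono) auto
  also have "\<dots> \<le> Hs_norm s u"
    using L2_set_le_band_norm[OF assms(2), of "{k}" UNIV] by (simp add: Hs_norm_band)
  finally show ?thesis by simp
qed

section \<open>Real Fourier coordinates and synthesis\<close>

text \<open>All real Fourier coordinates of \<open>u\<close>, in the same slots as \<^const>\<open>fourier_coords\<close> but without a cutoff.\<close>

definition coords :: "('d::finite, 'c::finite) torus_fun \<Rightarrow> (int^'d) \<times> 'c \<Rightarrow> real" where
  "coords u = (\<lambda>(k, j). if k = 0 \<or> pos_freq k then Re (fourier u k $ j) else Im (fourier u (- k) $ j))"

text \<open>The real character that the coordinate in slot \<open>k\<close> multiplies, written uniformly as a multiple \<open>char_amp k\<close> of a sine with frequency \<open>char_freq k\<close> and phase \<open>char_phase k\<close>: it is $1$ for $k = 0$, $2\cos(k\cdot x)$ for positive $k$, and $-2\sin(-k\cdot x)$ otherwise.\<close>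

definition char_freq :: "int^('d::finite) \<Rightarrow> int^'d" where
  "char_freq k = (if k = 0 \<or> pos_freq k then k else - k)"

text \<open>The phase $\pi/2$ turns the sine into a cosine, the phase $\pi$ into its negative.\<close>

definition char_phase :: "int^('d::finite) \<Rightarrow> real" where
  "char_phase k = (if k = 0 \<or> pos_freq k then pi / 2 else pi)"

text \<open>Every nonzero frequency represents a conjugate pair of coefficients, whence the factor $2$.\<close>

definition char_amp :: "int^('d::finite) \<Rightarrow> real" where
  "char_amp k = (if k = 0 then 1 else 2)"

text \<open>The real trigonometric polynomial with Fourier coordinates \<open>a\<close>, as an everywhere defined function.\<close>

definition trig_fun ::
    "nat \<Rightarrow> ((int^'d) \<times> 'c \<Rightarrow> real) \<Rightarrow> real^('d::finite) \<Rightarrow> real^('c::finite)" where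
  "trig_fun N a x = (\<chi> j. \<Sum>k\<in>freq_box N. a (k, j) * (char_amp k * sin (freq_dot (char_freq k) x + char_phase k)))"

lemma freq_dot_simps:
  "freq_dot 0 x = 0" "freq_dot (- k) x = - freq_dot k x"
  "freq_dot (k + l) x = freq_dot k x + freq_dot l x"
  "freq_dot (k - l) x = freq_dot k x - freq_dot l x"
  by (simp_all add: freq_dot_def sum_negf sum.distrib sum_subtractf algebra_simps)

lemma freq_box_uminus: "- k \<in> freq_box N \<longleftrightarrow> k \<in> freq_box N"
  by (simp add: freq_box_def)

lemma zero_in_freq_box: "0 \<in> freq_box N"
  by (simp add: freq_box_def)

lemma not_pos_freq_0: "\<not> pos_freq 0"
  by (simp add: pos_freq_def)

lemma sum_freq_box_halves:
  fixes F :: "int^('d::finite) \<Rightarrow> real"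
  shows "(\<Sum>k\<in>freq_box N. F k) = F 0 + (\<Sum>k | k \<in> freq_box N \<and> pos_freq k. F k + F (- k))"
proof -
  let ?P = "{k :: int^'d. k \<in> freq_box N \<and> pos_freq k}"
  let ?M = "{k :: int^'d. k \<in> freq_box N \<and> k \<noteq> 0 \<and> \<not> pos_freq k}"
  have fin: "finite ?P" "finite ?M"
    by (rule finite_subset[OF _ freq_box_finite[of N]], blast)+
  have box: "freq_box N = insert 0 (?P \<union> ?M)"
    by (auto simp: zero_in_freq_box)
  have "sum F (freq_box N) = sum F (insert 0 (?P \<union> ?M))"
    by (rule arg_cong[OF box])
  also have "\<dots> = F 0 + sum F (?P \<union> ?M)"
    by (rule sum.insert) (use fin not_pos_freq_0 in auto)
  also have "sum F (?P \<union> ?M) = sum F ?P + sum F ?M"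
    using fin by (intro sum.union_disjoint) auto
  also have "sum F ?M = (\<Sum>k\<in>?P. F (- k))"
  proof (rule sum.reindex_bij_witness[where i = uminus and j = uminus])
    show "- k \<in> ?P" if "k \<in> ?M" for k using that by (simp add: pos_freq_uminus freq_box_uminus)
    show "- k \<in> ?M" if "k \<in> ?P" for k
    proof -
      have "k \<noteq> 0" using that not_pos_freq_0 by auto
      then show ?thesis using that by (simp add: pos_freq_uminus freq_box_uminus)
    qed
  qed auto
  finally show ?thesis by (simp add: sum.distrib)
qed

lemma fourier_synth_trig_fun:
  fixes a :: "(int^('d::finite)) \<times> ('c::finite) \<Rightarrow> real"
  shows "fourier_synth N a = (abs_torus_fun (trig_fun N a) :: ('d::finite, 'c::finite) torus_fun)"
proof -
  have "trig_fun N a x $ j = a (0, j) + (\<Sum>k | k \<in> freq_box N \<and> pos_freq k.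
        2 * (a (k, j) * cos (freq_dot k x) - a (- k, j) * sin (freq_dot k x)))" for x j
  proof -
    have "2 * (a (k, j) * cos (freq_dot k x) - a (- k, j) * sin (freq_dot k x)) =
        a (k, j) * (char_amp k * sin (freq_dot (char_freq k) x + char_phase k)) +
        a (- k, j) * (char_amp (- k) * sin (freq_dot (char_freq (- k)) x + char_phase (- k)))"
      if "pos_freq k" for k
    proof -
      have "k \<noteq> 0" using that not_pos_freq_0 by auto
      then have "\<not> pos_freq (- k)" using that by (simp add: pos_freq_uminus)
      then show ?thesis using that \<open>k \<noteq> 0\<close>
        by (simp add: char_amp_def char_freq_def char_phase_def sin_add algebra_simps)
    qed
    then show ?thesis
      by (simp add: trig_fun_def sum_freq_box_halves)
         (simp add: char_amp_def char_freq_def char_phase_def freq_dot_simps)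
  qed
  then show ?thesis
    unfolding fourier_synth_def by (intro arg_cong[of _ _ abs_torus_fun] ext) (simp add: vec_eq_iff)
qed

lemma trig_fun_measurable [measurable]: "trig_fun N a \<in> borel_measurable torus"
  unfolding trig_fun_def by (intro borel_measurable_vec_lambda) measurable

lemma trig_fun_ae_eq: "ae_eq (trig_fun N a) (trig_fun N a)"
  by (simp add: ae_eq_def)

lemma norm_trig_fun_le:
  fixes a :: "(int^('d::finite)) \<times> ('c::finite) \<Rightarrow> real"
  shows "norm (trig_fun N a x) \<le> (\<Sum>j\<in>UNIV. \<Sum>k\<in>freq_box N. \<bar>a (k, j)\<bar> * 2)"
proof -
  have "norm (trig_fun N a x) \<le> (\<Sum>j\<in>UNIV. \<bar>trig_fun N a x $ j\<bar>)"
    by (rule norm_le_l1_cart)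
  also have "\<dots> \<le> (\<Sum>j\<in>UNIV. \<Sum>k\<in>freq_box N. \<bar>a (k, j)\<bar> * 2)"
  proof (intro sum_mono)
    fix j
    have "\<bar>trig_fun N a x $ j\<bar> \<le> (\<Sum>k\<in>freq_box N.
        \<bar>a (k, j) * (char_amp k * sin (freq_dot (char_freq k) x + char_phase k))\<bar>)"
      by (simp add: trig_fun_def sum_abs)
    also have "\<dots> \<le> (\<Sum>k\<in>freq_box N. \<bar>a (k, j)\<bar> * 2)"
    proof (intro sum_mono)
      fix k :: "int^'d"
      have "char_amp k * \<bar>sin (freq_dot (char_freq k) x + char_phase k)\<bar> \<le> 2 * 1"
        by (intro mult_mono) (auto simp: char_amp_def)
      then show "\<bar>a (k, j) * (char_amp k * sin (freq_dot (char_freq k) x + char_phase k))\<bar> \<le> \<bar>a (k, j)\<bar> * 2"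
        by (simp add: abs_mult char_amp_def mult_left_mono)
    qed
    finally show "\<bar>trig_fun N a x $ j\<bar> \<le> (\<Sum>k\<in>freq_box N. \<bar>a (k, j)\<bar> * 2)" .
  qed
  finally show ?thesis .
qed

lemma fcoef_two_chars:
  fixes k l m :: "int^'d"
  assumes "\<And>x. complex_of_real (f x) = \<alpha> * cis (freq_dot k x) + \<beta> * cis (freq_dot l x)"
  shows "fcoef f m = (if m = k then \<alpha> else 0) + (if m = l then \<beta> else 0)"
proof -
  have int: "integrable torus (\<lambda>x. cis (freq_dot q x))" for q :: "int^'d"
    by (rule integrable_torus_bounded[where B = 1]) (simp_all add: cis_conv_exp)
  have "complex_of_real (f x) * cis (- freq_dot m x) =
      \<alpha> * cis (freq_dot (k - m) x) + \<beta> * cis (freq_dot (l - m) x)" for x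
    by (simp add: assms cis_mult freq_dot_simps ring_distribs mult.assoc)
  then have "(LINT x|torus. complex_of_real (f x) * cis (- freq_dot m x)) =
      \<alpha> * (LINT x|torus. cis (freq_dot (k - m) x)) + \<beta> * (LINT x|torus. cis (freq_dot (l - m) x))"
    by (simp add: int)
  then show ?thesis
    by (simp add: fcoef_def integral_cis_torus add_divide_distrib)
qed

lemma fcoef_char:
  fixes k m :: "int^('d::finite)"
  assumes "m = 0 \<or> pos_freq m"
  shows "fcoef (\<lambda>x. char_amp k * sin (freq_dot (char_freq k) x + char_phase k)) m =
     (if m = k then 1 else 0) + (if k \<noteq> 0 \<and> m = - k then \<i> else 0)"
proof -
  have m: "- m \<noteq> k" if "pos_freq k" for k
    using that assms pos_freq_uminus[of m] not_pos_freq_0 by (cases "m = 0") auto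
  consider "k = 0" | "k \<noteq> 0" "pos_freq k" | "k \<noteq> 0" "\<not> pos_freq k" by blast
  then show ?thesis
  proof cases
    case 1
    show ?thesis
      by (subst fcoef_two_chars[where \<alpha> = 1 and k = 0 and \<beta> = 0 and l = 0])
         (simp_all add: 1 char_amp_def char_freq_def char_phase_def freq_dot_simps)
  next
    case 2
    show ?thesis
      by (subst fcoef_two_chars[where \<alpha> = 1 and k = k and \<beta> = 1 and l = "- k"])
         (use 2 m[of k] in \<open>auto simp: char_amp_def char_freq_def char_phase_def freq_dot_simps
            sin_add complex_eq_iff\<close>)
  next
    case 3
    then have "\<not> m = k" using assms by auto
    then show ?thesis
      by (subst fcoef_two_chars[where \<alpha> = \<i> and k = "- k" and \<beta> = "- \<i>" and l = k])
         (use 3 in \<open>auto simp: char_amp_def char_freq_def char_phase_def freq_dot_simps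
            sin_add complex_eq_iff\<close>)
  qed
qed

text \<open>Only one frequency of each conjugate pair is treated; the other follows from \<open>fourier_uminus\<close>.\<close>

lemma fourier_synth_half:
  fixes a :: "(int^('d::finite)) \<times> ('c::finite) \<Rightarrow> real"
  assumes m: "m = 0 \<or> pos_freq m"
  shows "fourier (fourier_synth N a :: ('d::finite, 'c::finite) torus_fun) m $ j =
     (if m \<in> freq_box N then of_real (a (m, j)) + (if m = 0 then 0 else \<i> * of_real (a (- m, j))) else 0)"
proof -
  let ?B = "\<lambda>k x. char_amp k * sin (freq_dot (char_freq k) x + char_phase k)"
  have int: "integrable torus (\<lambda>x. c * ?B k x)" for k :: "int^'d" and c
  proof (rule integrable_torus_bounded[where B = "\<bar>c\<bar> * (2 * 1)"])
    show "norm (c * ?B k x) \<le> \<bar>c\<bar> * (2 * 1)" for x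
      unfolding real_norm_def abs_mult by (intro mult_mono) (auto simp: char_amp_def)
  qed simp
  have m2: "m \<noteq> - m" if "m \<noteq> 0"
    using m that pos_freq_uminus[of m] by metis
  have summand: "of_real (a (k, j)) * fcoef (?B k) m = (if k = m then of_real (a (m, j)) else 0) +
      (if k = - m then (if m = 0 then 0 else \<i> * of_real (a (- m, j))) else 0)" for k
  proof -
    have eq: "k \<noteq> 0 \<and> m = - k \<longleftrightarrow> k = - m \<and> m \<noteq> 0" by (metis minus_minus minus_zero)
    have fc: "fcoef (?B k) m = (if k = m then 1 else 0) + (if k = - m \<and> m \<noteq> 0 then \<i> else 0)"
      by (simp only: fcoef_char[OF m] eq eq_commute[of m k])
    show ?thesis
      unfolding fc using m2 by (cases "m = 0"; cases "k = m"; cases "k = - m"; simp)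
  qed
  have "fourier (fourier_synth N a :: ('d, 'c) torus_fun) m $ j =
      fcoef (\<lambda>x. \<Sum>k\<in>freq_box N. a (k, j) * ?B k x) m"
    unfolding fourier_synth_trig_fun fourier.abs_eq[OF trig_fun_ae_eq] by (simp add: trig_fun_def)
  also have "\<dots> = (\<Sum>k\<in>freq_box N. fcoef (\<lambda>x. a (k, j) * ?B k x) m)"
    by (rule fcoef_sum[where f = "\<lambda>k x. a (k, j) * ?B k x"]) (rule int)
  also have "\<dots> = (\<Sum>k\<in>freq_box N. of_real (a (k, j)) * fcoef (?B k) m)"
    by (rule sum.cong[OF refl], rule fcoef_cmult)
  also have "\<dots> = (\<Sum>k\<in>freq_box N. (if k = m then of_real (a (m, j)) else 0) +
      (if k = - m then (if m = 0 then 0 else \<i> * of_real (a (- m, j))) else 0))"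
    by (intro sum.cong refl summand)
  also have "\<dots> = (if m \<in> freq_box N then of_real (a (m, j)) + (if m = 0 then 0 else \<i> * of_real (a (- m, j))) else 0)"
    by (simp only: sum.distrib sum.delta freq_box_finite freq_box_uminus) auto
  finally show ?thesis .
qed

lemma coords_synth:
  fixes a :: "(int^('d::finite)) \<times> ('c::finite) \<Rightarrow> real"
  shows "coords (fourier_synth N a :: ('d::finite, 'c::finite) torus_fun) (k, j) =
     (if k \<in> freq_box N then a (k, j) else 0)"
proof (cases "k = 0 \<or> pos_freq k")
  case True
  then show ?thesis by (simp add: coords_def fourier_synth_half)
next
  case False
  then have "pos_freq (- k)" by (simp add: pos_freq_uminus)
  then show ?thesis using False by (simp add: coords_def fourier_synth_half freq_box_uminus)
qed

lemma norm_fourier_le_coords: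
  "norm (fourier u k) \<le> (\<Sum>j\<in>UNIV. \<bar>coords u (k, j)\<bar> + \<bar>coords u (- k, j)\<bar>)"
proof -
  have *: "cmod (fourier u k $ j) \<le> \<bar>coords u (k, j)\<bar> + \<bar>coords u (- k, j)\<bar>" for j
  proof -
    have c: "fourier u (- k) $ j = cnj (fourier u k $ j)" by (rule fourier_uminus)
    consider "k = 0" | "k \<noteq> 0" "pos_freq k" | "k \<noteq> 0" "\<not> pos_freq k" by blast
    then have "\<bar>Re (fourier u k $ j)\<bar> + \<bar>Im (fourier u k $ j)\<bar> \<le> \<bar>coords u (k, j)\<bar> + \<bar>coords u (- k, j)\<bar>"
    proof cases
      case 1
      then have "Im (fourier u k $ j) = 0" using c by (simp add: complex_eq_iff)
      then show ?thesis using 1 by (simp add: coords_def)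
    qed (use c in \<open>simp_all add: coords_def pos_freq_uminus\<close>)
    then show ?thesis using cmod_le[of "fourier u k $ j"] by linarith
  qed
  have "norm (fourier u k) \<le> (\<Sum>j\<in>UNIV. cmod (fourier u k $ j))"
    unfolding norm_vec_def by (rule L2_set_le_sum) simp
  also have "\<dots> \<le> (\<Sum>j\<in>UNIV. \<bar>coords u (k, j)\<bar> + \<bar>coords u (- k, j)\<bar>)"
    by (intro sum_mono *)
  finally show ?thesis .
qed

lemma coords_diff:
  assumes "u \<in> Hs s" "v \<in> Hs s"
  shows "coords (u - v) p = coords u p - coords v p"
  using assms by (cases p) (simp add: coords_def fourier_diff Hs_def)

lemma abs_coords_le_Hs_norm:
  assumes "s \<ge> 0" "u \<in> Hs s"
  shows "\<bar>coords u p\<bar> \<le> Hs_norm s u"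
proof -
  obtain k j where p: "p = (k, j)" by force
  have "\<exists>l. \<bar>coords u p\<bar> \<le> cmod (fourier u l $ j)"
    using abs_Re_le_cmod abs_Im_le_cmod by (auto simp: p coords_def)
  then obtain l where "\<bar>coords u p\<bar> \<le> cmod (fourier u l $ j)" ..
  also have "\<dots> \<le> norm (fourier u l)" by (rule Finite_Cartesian_Product.norm_nth_le)
  also have "\<dots> \<le> Hs_norm s u" by (rule norm_fourier_le_Hs_norm[OF assms])
  finally show ?thesis .
qed

lemma fourier_synth_in_Hs: "(fourier_synth N a :: ('d::finite, 'c::finite) torus_fun) \<in> Hs s"
proof -
  have "integrable torus (\<lambda>x. (norm (trig_fun N a x))\<^sup>2)"
    by (rule integrable_torus_bounded[where B = "(\<Sum>j\<in>UNIV. \<Sum>k\<in>freq_box N. \<bar>a (k, j)\<bar> * 2)\<^sup>2"])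
       (auto intro!: power_mono norm_trig_fun_le)
  then have "square_integrable (fourier_synth N a :: ('d, 'c) torus_fun)"
    unfolding fourier_synth_trig_fun square_integrable.abs_eq[OF trig_fun_ae_eq] .
  moreover have "(\<lambda>k. sobolev_weight s k * (norm (fourier (fourier_synth N a :: ('d, 'c) torus_fun) k))\<^sup>2) summable_on UNIV"
  proof -
    have "fourier (fourier_synth N a :: ('d, 'c) torus_fun) k = 0" if "k \<notin> freq_box N" for k
      using norm_fourier_le_coords[of "fourier_synth N a" k] that
      by (simp add: coords_synth freq_box_uminus)
    then show ?thesis
      by (subst summable_on_cong_neutral[where T = "freq_box N" and g = "\<lambda>k. sobolev_weight s k * (norm (fourier (fourier_synth N a :: ('d, 'c) torus_fun) k))\<^sup>2"])
         (auto simp: freq_box_finite)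
  qed
  ultimately show ?thesis by (simp add: Hs_def)
qed

text \<open>The $H^s$ error of a synthesised function: the tail of the target, plus a multiple of the coordinate error below the cutoff.\<close>

lemma Hs_norm_synth_diff_le:
  fixes w :: "('d::finite, 'c::finite) torus_fun"
  assumes w: "w \<in> Hs s" and a: "\<And>k j. k \<in> freq_box N \<Longrightarrow> \<bar>a (k, j) - coords w (k, j)\<bar> \<le> \<delta>"
  shows "Hs_norm s (fourier_synth N a - w) \<le> band_norm s (- freq_box N) w +
     (\<Sum>k\<in>freq_box N. sqrt (sobolev_weight s (k :: int^'d)) * real (2 * CARD('c))) * \<delta>"
proof -
  let ?y = "fourier_synth N a - w"
  let ?f = "\<lambda>k. sqrt (sobolev_weight s k) * norm (fourier ?y k)"
  have [simp]: "sobolev_weight s k \<ge> 0" for k :: "int^'d"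
    using sobolev_weight_pos[of s k] by simp
  have y: "coords ?y (k, j) = (if k \<in> freq_box N then a (k, j) else 0) - coords w (k, j)" for k j
    using coords_diff[OF fourier_synth_in_Hs w] by (simp add: coords_synth)
  have inside: "norm (fourier ?y k) \<le> real (2 * CARD('c)) * \<delta>" if k: "k \<in> freq_box N" for k
  proof -
    have "norm (fourier ?y k) \<le> (\<Sum>j\<in>UNIV. \<bar>coords ?y (k, j)\<bar> + \<bar>coords ?y (- k, j)\<bar>)"
      by (rule norm_fourier_le_coords)
    also have "\<dots> \<le> (\<Sum>j\<in>(UNIV :: 'c set). \<delta> + \<delta>)"
      using k by (intro sum_mono add_mono) (auto simp: y freq_box_uminus intro: a)
    finally show ?thesis by simp
  qed
  have outside: "norm (fourier ?y k) = norm (fourier w k)" if "k \<notin> freq_box N" for k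
  proof -
    have "fourier (fourier_synth N a :: ('d, 'c) torus_fun) k = 0"
      using norm_fourier_le_coords[of "fourier_synth N a" k] that
      by (simp add: coords_synth freq_box_uminus)
    then show ?thesis
      using fourier_synth_in_Hs[of N a s] w by (simp add: fourier_diff Hs_def)
  qed
  have "L2_set ?f F \<le> band_norm s (- freq_box N) w +
      (\<Sum>k\<in>freq_box N. sqrt (sobolev_weight s (k :: int^'d)) * real (2 * CARD('c))) * \<delta>" if F: "finite F" for F
  proof -
    let ?g = "\<lambda>k. if k \<in> freq_box N then ?f k else 0"
    let ?h = "\<lambda>k. if k \<in> freq_box N then 0 else ?f k"
    have "L2_set ?f F = L2_set (\<lambda>k. ?g k + ?h k) F"
      by (intro L2_set_cong) auto
    also have "\<dots> \<le> L2_set ?g F + L2_set ?h F"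
      by (rule L2_set_triangle_ineq)
    also have "L2_set ?h F \<le> band_norm s (- freq_box N) w"
    proof -
      have "L2_set ?h F = L2_set (\<lambda>k. sqrt (sobolev_weight s k) * norm (fourier w k)) (F - freq_box N)"
        unfolding L2_set_def using F
        by (intro arg_cong[of _ _ sqrt] sum.mono_neutral_cong_right) (auto simp: outside)
      also have "\<dots> \<le> band_norm s (- freq_box N) w"
        using F by (intro L2_set_le_band_norm w) auto
      finally show ?thesis .
    qed
    also have "L2_set ?g F \<le> (\<Sum>k\<in>F. ?g k)"
      by (rule L2_set_le_sum) auto
    also have "(\<Sum>k\<in>F. ?g k) = (\<Sum>k\<in>F \<inter> freq_box N. ?f k)"
      using F by (intro sum.mono_neutral_cong_right) auto
    also have "\<dots> \<le> (\<Sum>k\<in>freq_box N. ?f k)"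
      by (intro sum_mono2) (auto simp: freq_box_finite)
    also have "\<dots> \<le> (\<Sum>k\<in>freq_box N. sqrt (sobolev_weight s (k :: int^'d)) * (real (2 * CARD('c)) * \<delta>))"
      by (rule sum_mono, rule mult_left_mono[OF inside]) simp_all
    also have "\<dots> = (\<Sum>k\<in>freq_box N. sqrt (sobolev_weight s (k :: int^'d)) * real (2 * CARD('c))) * \<delta>"
      by (simp add: sum_distrib_right mult.assoc)
    finally show ?thesis by (simp add: add.commute)
  qed
  then show ?thesis
    unfolding Hs_norm_band by (rule summable_band_normI(2))
qed

section \<open>Uniqueness of Fourier coefficients\<close>

text \<open>Real trigonometric polynomials, with integer frequencies.\<close>

inductive trig_poly :: "(real^'d \<Rightarrow> real) \<Rightarrow> bool" where
  trig_poly_cos: "trig_poly (\<lambda>x. c * cos (freq_dot k x + b))"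
| trig_poly_add: "trig_poly f \<Longrightarrow> trig_poly g \<Longrightarrow> trig_poly (\<lambda>x. f x + g x)"

lemma trig_poly_mult:
  assumes "trig_poly f" "trig_poly g"
  shows "trig_poly (\<lambda>x. f x * g x)"
  using assms(1)
proof induction
  case (trig_poly_cos c k b)
  show ?case using assms(2)
  proof induction
    case (trig_poly_cos c' k' b')
    have "c * cos (freq_dot k x + b) * (c' * cos (freq_dot k' x + b')) =
        (c * c' / 2) * cos (freq_dot (k - k') x + (b - b')) +
        (c * c' / 2) * cos (freq_dot (k + k') x + (b + b'))" for x
    proof -
      have "freq_dot (k - k') x + (b - b') = (freq_dot k x + b) - (freq_dot k' x + b')"
        "freq_dot (k + k') x + (b + b') = (freq_dot k x + b) + (freq_dot k' x + b')"
        by (simp_all add: freq_dot_simps)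
      then show ?thesis
        by (simp only: cos_add[of "freq_dot k x + b"] cos_diff[of "freq_dot k x + b"]) (simp add: field_simps)
    qed
    then show ?case by (simp only:) (intro trig_poly.intros)
  next
    case (trig_poly_add f' g')
    then show ?case by (simp only: distrib_left) (intro trig_poly.intros)
  qed
next
  case (trig_poly_add f' g')
  then show ?case by (simp only: distrib_right) (intro trig_poly.intros)
qed

lemma trig_poly_const: "trig_poly (\<lambda>_. c)"
  using trig_poly_cos[of c 0 0] by (simp add: freq_dot_simps)

lemma trig_poly_measurable: "trig_poly g \<Longrightarrow> g \<in> borel_measurable torus"
  by (induction rule: trig_poly.induct) auto

lemma trig_poly_bounded: "trig_poly g \<Longrightarrow> \<exists>B. \<forall>x. \<bar>g x\<bar> \<le> B"
proof (induction rule: trig_poly.induct)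
  case (trig_poly_cos c k b)
  have "\<bar>c * cos (freq_dot k x + b)\<bar> \<le> \<bar>c\<bar> * 1" for x
    unfolding abs_mult by (intro mult_left_mono) auto
  then show ?case by blast
next
  case (trig_poly_add f g)
  then obtain B C where "\<forall>x. \<bar>f x\<bar> \<le> B" "\<forall>x. \<bar>g x\<bar> \<le> C" by blast
  then have "\<forall>x. \<bar>f x + g x\<bar> \<le> B + C" by (meson abs_triangle_ineq add_mono order_trans)
  then show ?case by blast
qed

lemma integrable_mult_bounded:
  fixes f g :: "real^'d \<Rightarrow> real"
  assumes f: "integrable torus f" and [measurable]: "g \<in> borel_measurable torus"
    and "\<And>x. x \<in> cell \<Longrightarrow> \<bar>g x\<bar> \<le> B"
  shows "integrable torus (\<lambda>x. f x * g x)"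
proof (rule Bochner_Integration.integrable_bound)
  show "integrable torus (\<lambda>x. B * f x)" using f by simp
  have [measurable]: "f \<in> borel_measurable torus" using f by simp
  show "(\<lambda>x. f x * g x) \<in> borel_measurable torus" by measurable
  have "\<bar>f x\<bar> * \<bar>g x\<bar> \<le> \<bar>f x\<bar> * \<bar>B\<bar>" if "x \<in> cell" for x
    using assms(3)[OF that] by (intro mult_left_mono) auto
  then show "AE x in torus. norm (f x * g x) \<le> norm (B * f x)"
    by (intro AE_I2) (simp add: space_torus abs_mult mult.commute)
qed

lemma integral_trig_poly_eq_0:
  assumes f: "integrable torus f" and z: "\<And>k. fcoef f k = 0" and "trig_poly g"
  shows "(LINT x|torus. f x * g x) = 0"
  using assms(3)
proof induction
  case (trig_poly_cos c k b)
  have "(LINT x|torus. of_real (f x) * cis (- freq_dot k x)) = 0"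
    using z[of k] by (simp add: fcoef_def)
  then have "Re (of_real c * cis (- b) * (LINT x|torus. of_real (f x) * cis (- freq_dot k x))) = 0"
    by simp
  also have "of_real c * cis (- b) * (LINT x|torus. of_real (f x) * cis (- freq_dot k x)) =
      (LINT x|torus. of_real c * cis (- b) * (of_real (f x) * cis (- freq_dot k x)))"
    by (rule integral_mult_right_zero[symmetric])
  also have "Re \<dots> = (LINT x|torus. Re (of_real c * cis (- b) * (of_real (f x) * cis (- freq_dot k x))))"
    by (rule integral_Re[symmetric]) (intro integrable_mult_right integrable_mult_cis f)
  also have "(\<lambda>x. Re (of_real c * cis (- b) * (of_real (f x) * cis (- freq_dot k x)))) =
      (\<lambda>x. f x * (c * cos (freq_dot k x + b)))"
    by (rule ext) (simp add: cos_add algebra_simps)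
  finally show ?case .
next
  case (trig_poly_add g h)
  have "integrable torus (\<lambda>x. f x * g' x)" if "trig_poly g'" for g'
    using trig_poly_bounded[OF that] trig_poly_measurable[OF that]
    by (auto intro!: integrable_mult_bounded f)
  then show ?case using trig_poly_add by (simp add: distrib_left)
qed

text \<open>The quotient map onto the product of unit circles in $C^d$.  Continuous functions on its range are the continuous functions that are $2\pi$-periodic in every coordinate.\<close>

definition circle_map :: "real^'d \<Rightarrow> complex^'d" where
  "circle_map x = (\<chi> i. cis (x $ i))"

lemma circle_map_continuous: "continuous_on A circle_map"
  unfolding circle_map_def cis_conv_exp by (intro continuous_intros)

lemma circle_map_reduce:
  obtains y where "y \<in> cell" "circle_map y = circle_map x" "\<forall>i. 0 \<le> x $ i \<longrightarrow> y $ i \<le> x $ i"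
proof -
  define n where "n i = floor (x $ i / (2 * pi))" for i
  define y where "y = (\<chi> i. x $ i - 2 * pi * of_int (n i))"
  have n: "of_int (n i) \<le> x $ i / (2 * pi)" "x $ i / (2 * pi) < of_int (n i) + 1" for i
    unfolding n_def by linarith+
  have "y \<in> cell"
    using n by (auto simp: cell_def y_def field_simps)
  moreover have "circle_map y = circle_map x"
    by (simp add: circle_map_def y_def vec_eq_iff flip: cis_divide)
  moreover have "\<forall>i. 0 \<le> x $ i \<longrightarrow> y $ i \<le> x $ i"
    by (auto simp: y_def n_def)
  ultimately show ?thesis using that by blast
qed

lemma circle_map_inj:
  assumes "x \<in> cell" "y \<in> cell" "circle_map x = circle_map y"
  shows "x = y"
proof -
  have "x $ i = y $ i" for i
  proof -
    have "cis (x $ i) = cis (y $ i)" using assms(3) by (simp add: circle_map_def vec_eq_iff)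
    moreover have "Arg2pi (cis t) = t" if "0 \<le> t" "t < 2 * pi" for t
      using that Arg2pi_unique[of 1 t "cis t"] by (simp add: cis_conv_exp)
    ultimately show ?thesis using assms(1,2) unfolding cell_def by (metis (mono_tags, lifting) mem_Collect_eq)
  qed
  then show ?thesis by (simp add: vec_eq_iff)
qed

lemma range_circle_map:
  "range (circle_map :: real^'d \<Rightarrow> complex^'d) = circle_map ` cbox 0 (\<chi> i. 2 * pi)"
proof
  show "range (circle_map :: real^'d \<Rightarrow> complex^'d) \<subseteq> circle_map ` cbox 0 (\<chi> i. 2 * pi)"
  proof
    fix z assume "z \<in> range (circle_map :: real^'d \<Rightarrow> complex^'d)"
    then obtain x where z: "z = circle_map x" by blast
    obtain y where "y \<in> cell" "circle_map y = circle_map x" by (rule circle_map_reduce)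
    moreover have "cell \<subseteq> cbox 0 (\<chi> i. 2 * pi :: real^'d)"
      by (auto simp: cell_def mem_box_cart less_imp_le)
    ultimately show "z \<in> circle_map ` cbox 0 (\<chi> i. 2 * pi)" using z by (metis imageI subsetD)
  qed
qed auto

text \<open>Trigonometric polynomials are uniformly dense among the continuous periodic functions, by Stone--Weierstrass on the product of circles.\<close>

lemma integral_periodic_eq_0:
  fixes f :: "real^'d \<Rightarrow> real"
  assumes f: "integrable torus f" and z: "\<And>k. fcoef f k = 0"
    and G: "continuous_on (range circle_map) G"
  shows "(LINT x|torus. f x * G (circle_map x)) = 0"
proof -
  let ?S = "range (circle_map :: real^'d \<Rightarrow> complex^'d)"
  let ?P = "\<lambda>g. continuous_on ?S g \<and> trig_poly (\<lambda>x. g (circle_map x))"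
  have S: "compact ?S"
    unfolding range_circle_map by (intro compact_continuous_image circle_map_continuous compact_cbox)
  have meas: "(\<lambda>x. H (circle_map x)) \<in> borel_measurable torus" if "continuous_on ?S H" for H :: "_ \<Rightarrow> real"
  proof -
    have "(\<lambda>x. H (circle_map x)) \<in> borel_measurable borel"
      by (intro borel_measurable_continuous_onI continuous_on_compose2[OF that circle_map_continuous]) auto
    then show ?thesis
      unfolding torus_def by (intro measurable_restrict_space1) simp
  qed
  have bnd: "\<exists>B. \<forall>x. \<bar>H (circle_map x)\<bar> \<le> B" if "continuous_on ?S H" for H :: "_ \<Rightarrow> real"
  proof -
    have "bounded (H ` ?S)" using compact_continuous_image[OF that S] by (rule compact_imp_bounded)
    then show ?thesis by (auto simp: bounded_iff)
  qed
  have int: "integrable torus (\<lambda>x. f x * H (circle_map x))" if "continuous_on ?S H" for H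
    using bnd[OF that] meas[OF that] f by (auto intro!: integrable_mult_bounded)
  have small: "\<bar>LINT x|torus. f x * G (circle_map x)\<bar> \<le> e * (LINT x|torus. \<bar>f x\<bar>)" if e: "e > 0" for e
  proof -
    have "\<exists>g. ?P g \<and> (\<forall>x\<in>?S. \<bar>G x - g x\<bar> < e)"
    proof (rule Stone_Weierstrass_HOL[where P = ?P and S = ?S])
      show "?P (\<lambda>_. c)" for c by (simp add: trig_poly_const)
      show "?P (\<lambda>x. f x + g x)" if "?P f \<and> ?P g" for f g
        using that by (auto intro!: continuous_on_add trig_poly_add)
      show "?P (\<lambda>x. f x * g x)" if "?P f \<and> ?P g" for f g
        using that by (auto intro!: continuous_on_mult trig_poly_mult)
      show "\<exists>g. ?P g \<and> g z \<noteq> g w" if zw: "z \<in> ?S \<and> w \<in> ?S \<and> z \<noteq> w" for z w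
      proof -
        obtain i where "z $ i \<noteq> w $ i" using zw by (metis vec_eq_iff)
        then consider "Re (z $ i) \<noteq> Re (w $ i)" | "Im (z $ i) \<noteq> Im (w $ i)" by (auto simp: complex_eq_iff)
        moreover have fd: "freq_dot (axis i 1) x = x $ i" for x :: "real^'d"
        proof -
          have "freq_dot (axis i 1) x = (\<Sum>j\<in>UNIV. if j = i then x $ j else 0)"
            unfolding freq_dot_def by (intro sum.cong) (auto simp: axis_def)
          then show ?thesis by simp
        qed
        have "?P (\<lambda>z. Re (z $ i))"
          using trig_poly_cos[of 1 "axis i 1" 0]
          by (auto simp: circle_map_def fd intro!: continuous_intros)
        moreover have "?P (\<lambda>z. Im (z $ i))"
          using trig_poly_cos[of 1 "axis i 1" "- pi / 2"]
          by (auto simp: circle_map_def fd cos_diff intro!: continuous_intros)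
        ultimately show ?thesis by cases blast+
      qed
    qed (use S G e in auto)
    then obtain g where g: "?P g" "\<And>x. \<bar>G (circle_map x) - g (circle_map x)\<bar> < e" by blast
    have "(LINT x|torus. f x * G (circle_map x)) =
        (LINT x|torus. f x * (G (circle_map x) - g (circle_map x)))"
      using integral_trig_poly_eq_0[OF f z, of "\<lambda>x. g (circle_map x)"] g int[of g] int[OF G]
      by (simp add: right_diff_distrib)
    also have "\<bar>\<dots>\<bar> \<le> (LINT x|torus. \<bar>f x * (G (circle_map x) - g (circle_map x))\<bar>)"
      by (rule integral_abs_bound)
    also have "\<dots> \<le> (LINT x|torus. e * \<bar>f x\<bar>)"
    proof (rule integral_mono)
      show "integrable torus (\<lambda>x. \<bar>f x * (G (circle_map x) - g (circle_map x))\<bar>)"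
        using int[OF G] int[of g] g by (auto simp: right_diff_distrib)
      show "integrable torus (\<lambda>x. e * \<bar>f x\<bar>)" using f by simp
      show "\<bar>f x * (G (circle_map x) - g (circle_map x))\<bar> \<le> e * \<bar>f x\<bar>" for x
        unfolding abs_mult using g(2)[of x] by (metis abs_ge_zero less_imp_le mult.commute mult_left_mono)
    qed
    finally show ?thesis by simp
  qed
  have "\<bar>LINT x|torus. f x * G (circle_map x)\<bar> \<le> 0"
  proof (rule field_le_epsilon)
    fix e :: real assume e: "e > 0"
    define I where "I = (LINT x|torus. \<bar>f x\<bar>)"
    have I: "I \<ge> 0" unfolding I_def by simp
    have "\<bar>LINT x|torus. f x * G (circle_map x)\<bar> \<le> e / (I + 1) * I"
    proof -
      have "e / (I + 1) > 0" using e I by simp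
      from small[OF this] show ?thesis by (simp only: I_def)
    qed
    also have "\<dots> \<le> e" using e I by (simp add: field_simps)
    finally show "\<bar>LINT x|torus. f x * G (circle_map x)\<bar> \<le> 0 + e" by simp
  qed
  then show ?thesis by simp
qed

text \<open>Lower orthants generate the Borel sets.  Within the cell, such an orthant is the preimage of a compact set of the product of circles, so that its indicator is a bounded limit of continuous periodic functions.\<close>

lemma integral_atMost_eq_0:
  fixes f :: "real^'d \<Rightarrow> real"
  assumes f: "integrable torus f" and z: "\<And>k. fcoef f k = 0"
  shows "(LINT x|torus. f x * indicator {..a} x) = 0"
proof (cases "0 \<le> a")
  case False
  have "f x * indicator {..a} x = 0" if "x \<in> cell" for x
  proof -
    have "\<not> x \<le> a"
    proof
      assume "x \<le> a"
      then have "0 \<le> a" using that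
        by (auto simp: cell_def less_eq_vec_def intro: order_trans)
      then show False using False by simp
    qed
    then show ?thesis by simp
  qed
  then have "(LINT x|torus. f x * indicator {..a} x) = (LINT x|(torus :: (real^'d) measure). 0)"
    by (intro Bochner_Integration.integral_cong refl) (simp only: space_torus)
  then show ?thesis by simp
next
  case True
  define C where "C = circle_map ` cbox 0 a"
  \<comment> \<open>Continuous functions decreasing to the indicator of the compact set \<open>C\<close>.\<close>
  define G where "G n z = max 0 (1 - real n * infdist z C)" for n z
  have C: "closed C" "C \<noteq> {}"
    using True unfolding C_def
    by (auto intro!: compact_imp_closed compact_continuous_image circle_map_continuous simp: box_ne_empty
        less_eq_vec_def Basis_vec_def inner_axis)
  have [measurable]: "f \<in> borel_measurable torus" using f by simp
  have Gm [measurable]: "(\<lambda>x. G n (circle_map x)) \<in> borel_measurable torus" for n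
  proof -
    have "(\<lambda>x. G n (circle_map x)) \<in> borel_measurable borel"
      unfolding G_def by (intro borel_measurable_continuous_onI continuous_intros circle_map_continuous)
    then show ?thesis
      unfolding torus_def by (intro measurable_restrict_space1) simp
  qed
  have mem: "circle_map x \<in> C \<longleftrightarrow> x \<le> a" if x: "x \<in> cell" for x
  proof
    assume "x \<le> a"
    then show "circle_map x \<in> C" using x
      by (auto simp: C_def mem_box_cart cell_def less_eq_vec_def)
  next
    assume "circle_map x \<in> C"
    then obtain w where w: "w \<in> cbox 0 a" "circle_map x = circle_map w" by (auto simp: C_def)
    \<comment> \<open>Reducing a nonnegative coordinate modulo $2\pi$ can only decrease it.\<close>
    obtain y where y: "y \<in> cell" "circle_map y = circle_map w" "\<forall>i. 0 \<le> w $ i \<longrightarrow> y $ i \<le> w $ i"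
      by (rule circle_map_reduce)
    have "x = y" using circle_map_inj[OF x y(1)] w y by simp
    then show "x \<le> a"
      using y(3) w(1) by (auto simp: less_eq_vec_def mem_box_cart intro: order_trans)
  qed
  have lim: "(\<lambda>n. G n (circle_map x)) \<longlonglongrightarrow> indicator {..a} x" if x: "x \<in> cell" for x
  proof (cases "x \<le> a")
    case True
    then show ?thesis using mem[OF x] by (simp add: G_def)
  next
    case False
    then have d: "infdist (circle_map x) C > 0"
      using mem[OF x] C by (simp add: infdist_pos_not_in_closed)
    obtain m :: nat where m: "1 / infdist (circle_map x) C < real m" using reals_Archimedean2 by blast
    have "G n (circle_map x) = 0" if "n \<ge> m" for n
    proof -
      have "1 < real m * infdist (circle_map x) C" using m d by (simp add: field_simps)
      also have "\<dots> \<le> real n * infdist (circle_map x) C" using that d by (intro mult_right_mono) auto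
      finally show ?thesis by (simp add: G_def)
    qed
    then have "\<forall>\<^sub>F n in sequentially. G n (circle_map x) = indicator {..a} x"
      using False by (auto simp: eventually_sequentially)
    then show ?thesis by (rule tendsto_eventually)
  qed
  have "(\<lambda>n. LINT x|torus. f x * G n (circle_map x)) \<longlonglongrightarrow> (LINT x|torus. f x * indicator {..a} x)"
  proof (rule integral_dominated_convergence[where w = "\<lambda>x. \<bar>f x\<bar>"])
    have "(indicator {..a} :: _ \<Rightarrow> real) \<in> borel_measurable (torus :: (real^'d) measure)"
      unfolding torus_def by (intro measurable_restrict_space1) simp
    then show "(\<lambda>x. f x * indicator {..a} x) \<in> borel_measurable torus" by simp
    show "(\<lambda>x. f x * G n (circle_map x)) \<in> borel_measurable torus" for n by simp
    show "integrable torus (\<lambda>x. \<bar>f x\<bar>)" using f by simp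
    show "AE x in torus. (\<lambda>n. f x * G n (circle_map x)) \<longlonglongrightarrow> f x * indicator {..a} x"
      by (intro AE_I2 tendsto_mult tendsto_const lim) (simp add: space_torus)
    show "AE x in torus. norm (f x * G n (circle_map x)) \<le> \<bar>f x\<bar>" for n
      by (intro AE_I2) (auto simp: G_def abs_mult intro!: mult_left_le mult_nonneg_nonneg infdist_nonneg)
  qed
  moreover have "(LINT x|torus. f x * G n (circle_map x)) = 0" for n
    unfolding G_def
    by (rule integral_periodic_eq_0[OF f z]) (intro continuous_intros)
  ultimately show ?thesis by (simp add: LIMSEQ_const_iff)
qed

lemma integral_borel_eq_0:
  fixes f :: "real^'d \<Rightarrow> real"
  assumes f: "integrable torus f" and z: "\<And>k. fcoef f k = 0" and A: "A \<in> sets borel"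
  shows "(LINT x|torus. f x * indicator A x) = 0"
proof -
  have im: "(indicator B :: _ \<Rightarrow> real) \<in> borel_measurable (torus :: (real^'d) measure)"
    if "B \<in> sets borel" for B :: "(real^'d) set"
    unfolding torus_def using that by (intro measurable_restrict_space1) simp
  have int: "integrable torus (\<lambda>x. f x * indicator B x)" if "B \<in> sets borel" for B
    by (rule integrable_mult_bounded[OF f im[OF that], where B = 1]) (simp add: indicator_def)
  have total: "(LINT x|torus. f x) = 0"
    using integral_trig_poly_eq_0[OF f z trig_poly_const[of 1]] by simp
  have gen: "sets (borel :: (real^'d) measure) = sigma_sets UNIV (range atMost)"
    by (subst borel_eq_atMost) simp
  have stable: "Int_stable (range (atMost :: real^'d \<Rightarrow> _))"
  proof (rule Int_stableI)
    fix B D assume "B \<in> range (atMost :: real^'d \<Rightarrow> _)" "D \<in> range (atMost :: real^'d \<Rightarrow> _)"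
    then obtain b d :: "real^'d" where "B = {..b}" "D = {..d}" by blast
    then have "B \<inter> D = {..inf b d}" by auto
    then show "B \<inter> D \<in> range (atMost :: real^'d \<Rightarrow> _)" by blast
  qed
  have pow: "range (atMost :: real^'d \<Rightarrow> _) \<subseteq> Pow UNIV" by simp
  from stable pow A[unfolded gen] show ?thesis
  proof (induction rule: sigma_sets_induct_disjoint)
    case (basic B)
    then show ?case using integral_atMost_eq_0[OF f z] by auto
  next
    case (compl B)
    then have "B \<in> sets borel" by (simp add: gen)
    then have "(LINT x|torus. f x - f x * indicator B x) = 0"
      using f int compl by (simp add: total)
    moreover have "f x - f x * indicator B x = f x * indicator (UNIV - B) x" for x
      by (simp add: indicator_def)
    ultimately show ?case by simp
  next
    case (union B)
    then have B: "B i \<in> sets borel" for i using gen by auto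
    have "(\<lambda>n. LINT x|torus. f x * indicator (\<Union>i<n. B i) x) \<longlonglongrightarrow>
        (LINT x|torus. f x * indicator (\<Union>i. B i) x)"
    proof (rule integral_dominated_convergence[where w = "\<lambda>x. \<bar>f x\<bar>"])
      show "integrable torus (\<lambda>x. \<bar>f x\<bar>)" using f by simp
      show "(\<lambda>x. f x * indicator (\<Union>i. B i) x) \<in> borel_measurable torus"
        using B by (intro borel_measurable_integrable int) auto
      show "(\<lambda>x. f x * indicator (\<Union>i<n. B i) x) \<in> borel_measurable torus" for n
        using B by (intro borel_measurable_integrable int) auto
      show "AE x in torus. (\<lambda>n. f x * indicator (\<Union>i<n. B i) x) \<longlonglongrightarrow> f x * indicator (\<Union>i. B i) x"
        by (intro AE_I2 tendsto_mult tendsto_const LIMSEQ_indicator_UN)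
      show "AE x in torus. norm (f x * indicator (\<Union>i<n. B i) x) \<le> \<bar>f x\<bar>" for n
        by (intro AE_I2) (simp add: indicator_def)
    qed
    moreover have "(LINT x|torus. f x * indicator (\<Union>i<n. B i) x) = 0" for n
    proof -
      have "disjoint_family_on B {..<n}"
        using union(1) by (auto simp: disjoint_family_on_def)
      then have "f x * indicator (\<Union>i<n. B i) x = (\<Sum>i<n. f x * indicator (B i) x)" for x
        by (subst indicator_UN_disjoint) (simp_all only: finite_lessThan sum_distrib_left)
      then have "(LINT x|torus. f x * indicator (\<Union>i<n. B i) x) =
          (LINT x|torus. (\<Sum>i<n. f x * indicator (B i) x))" by presburger
      also have "\<dots> = (\<Sum>i<n. LINT x|torus. f x * indicator (B i) x)"
        by (rule Bochner_Integration.integral_sum) (rule int[OF B])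
      finally have "(LINT x|torus. f x * indicator (\<Union>i<n. B i) x) =
          (\<Sum>i<n. LINT x|torus. f x * indicator (B i) x)" .
      then show ?thesis using union by simp
    qed
    ultimately show ?case by (simp add: LIMSEQ_const_iff)
  qed auto
qed

lemma fcoef_zero_imp_AE_zero:
  fixes f :: "real^'d \<Rightarrow> real"
  assumes f: "integrable torus f" and z: "\<And>k. fcoef f k = 0"
  shows "AE x in torus. f x = 0"
proof -
  have nonpos: "AE x in torus. g x \<le> 0"
    if g: "integrable torus g" and gz: "\<And>k. fcoef g k = 0" for g :: "real^'d \<Rightarrow> real"
  proof -
    have [measurable]: "g \<in> borel_measurable torus" using g by simp
    have "{x \<in> space torus. 0 < g x} \<in> sets torus" by measurable
    then have "{x \<in> space torus. 0 < g x} \<in> (\<inter>) cell ` sets lborel"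
      unfolding torus_restrict sets_restrict_space .
    then obtain A where "A \<in> sets lborel" and cA: "{x \<in> space torus. 0 < g x} = cell \<inter> A"
      by (rule imageE)
    then have A: "A \<in> sets borel" "{x \<in> space torus. 0 < g x} = cell \<inter> A"
      by (simp only: sets_lborel, simp only: cA)
    have eq: "g x * indicator A x = max 0 (g x)" if "x \<in> space torus" for x
    proof -
      have "x \<in> {x \<in> space torus. 0 < g x} \<longleftrightarrow> x \<in> cell \<inter> A" by (simp only: cA)
      then have "x \<in> A \<longleftrightarrow> 0 < g x" using that by (simp add: space_torus)
      then show ?thesis by (simp add: indicator_def)
    qed
    have "(LINT x|torus. max 0 (g x)) = 0"
      using integral_borel_eq_0[OF g gz A(1)] by (simp add: eq cong: Bochner_Integration.integral_cong)
    then have "AE x in torus. max 0 (g x) = 0"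
      using g by (subst (asm) integral_nonneg_eq_0_iff_AE) auto
    then show ?thesis by eventually_elim simp
  qed
  have "AE x in torus. - f x \<le> 0"
    using f z fcoef_cmult[of "-1" f] by (intro nonpos) simp_all
  with nonpos[OF f z] show ?thesis by eventually_elim simp
qed

lemma torus_fun_eqI:
  assumes "square_integrable u" "square_integrable v" "\<And>k. fourier u k = fourier v k"
  shows "u = v"
proof -
  have "w = 0" if "square_integrable w" "\<And>k. fourier w k = 0" for w :: "('a, 'b) torus_fun"
    using that
  proof (transfer, goal_cases)
    case (1 f)
    then have f: "f \<in> borel_measurable torus" by (simp add: ae_eq_def)
    have "AE x in torus. f x $ j = 0" for j
      using 1 by (intro fcoef_zero_imp_AE_zero square_integrable_comp f) (simp_all add: vec_eq_iff)
    then have "AE x in torus. \<forall>j\<in>UNIV. f x $ j = 0"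
      by (intro AE_finite_allI) auto
    then have "AE x in torus. f x = 0"
      by eventually_elim (simp add: vec_eq_iff)
    then show ?case using f by (simp add: ae_eq_def)
  qed
  from this[of "u - v"] show ?thesis
    using assms square_integrable_add[of u "- v"] by (simp add: square_integrable_uminus fourier_diff)
qed

section \<open>The Sobolev space as a metric space\<close>

lemma Metric_space_Hs:
  "Metric_space (Hs s :: ('d::finite, 'c::finite) torus_fun set) (Hs_dist s)"
proof
  fix u v w :: "('d, 'c) torus_fun"
  show "0 \<le> Hs_dist s u v"
    by (simp add: Hs_dist_def Hs_norm_band band_norm_nonneg)
  show "Hs_dist s u v = Hs_dist s v u"
    using band_norm_uminus[of s UNIV "u - v"] by (simp add: Hs_dist_def Hs_norm_band)
  assume uv: "u \<in> Hs s" "v \<in> Hs s"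
  show "Hs_dist s u v = 0 \<longleftrightarrow> u = v"
  proof
    assume "Hs_dist s u v = 0"
    then have "sobolev_weight s k * (norm (fourier (u - v) k))\<^sup>2 = 0" for k
      using nonneg_infsum_le_0D[OF _ weighted_summable[OF Hs_diff_band(1)[OF uv]] weighted_nonneg, of UNIV k]
      by (simp add: Hs_dist_def Hs_norm_def)
    then have "fourier (u - v) k = 0" for k
      using sobolev_weight_pos[of s k] by (metis less_irrefl mult_eq_0_iff norm_eq_zero power2_eq_square)
    then show "u = v"
      using uv by (intro torus_fun_eqI) (auto simp: Hs_def fourier_diff)
  next
    assume "u = v"
    moreover have "fourier (0 :: ('d, 'c) torus_fun) k = 0" for k
      using fourier_minus_self[of "0 :: ('d, 'c) torus_fun" k] by (simp add: eq_neg_iff_add_eq_0 vec_eq_iff)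
    ultimately show "Hs_dist s u v = 0" by (simp add: Hs_dist_def Hs_norm_def)
  qed
  assume w: "w \<in> Hs s"
  show "Hs_dist s u w \<le> Hs_dist s u v + Hs_dist s v w"
    using Hs_add_band(2)[OF Hs_diff_band(1)[OF uv] Hs_diff_band(1)[OF uv(2) w], of UNIV]
    by (simp add: Hs_dist_def Hs_norm_band)
qed

section \<open>Fourier tails on compact subsets of the Sobolev space\<close>

lemma topspace_Hs: "topspace (Hs_topology s) = Hs s"
  unfolding Hs_topology_def by (rule Metric_space.topspace_mtopology[OF Metric_space_Hs])

lemma lipschitz_continuous_map_Hs:
  fixes g :: "('d::finite, 'c::finite) torus_fun \<Rightarrow> real"
  assumes lip: "\<And>u v. u \<in> Hs s \<Longrightarrow> v \<in> Hs s \<Longrightarrow> \<bar>g u - g v\<bar> \<le> Hs_dist s u v"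
  shows "continuous_map (Hs_topology s) euclideanreal g"
proof -
  interpret Metric_space "Hs s :: ('d, 'c) torus_fun set" "Hs_dist s" by (rule Metric_space_Hs)
  show ?thesis
    unfolding continuous_map_def
  proof (intro conjI allI impI)
    fix U :: "real set" assume "openin euclideanreal U"
    then have U: "open U" by simp
    have "\<exists>r>0. mball u r \<subseteq> {x \<in> Hs s. g x \<in> U}" if u: "u \<in> Hs s" "g u \<in> U" for u
    proof -
      obtain e where e: "e > 0" "ball (g u) e \<subseteq> U" using U u(2) open_contains_ball by blast
      have "mball u e \<subseteq> {x \<in> Hs s. g x \<in> U}"
      proof
        fix v assume "v \<in> mball u e"
        then have v: "v \<in> Hs s" "Hs_dist s u v < e" by auto
        then have "\<bar>g u - g v\<bar> < e" using lip[OF u(1) v(1)] by simp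
        then have "g v \<in> ball (g u) e" by (simp add: dist_real_def)
        then show "v \<in> {x \<in> Hs s. g x \<in> U}" using e v by blast
      qed
      then show ?thesis using e(1) by blast
    qed
    then show "openin (Hs_topology s) {x \<in> topspace (Hs_topology s). g x \<in> U}"
      unfolding topspace_Hs unfolding Hs_topology_def openin_mtopology by auto
  qed auto
qed

lemma continuous_map_coords:
  assumes "s \<ge> 0"
  shows "continuous_map (Hs_topology s) euclideanreal (\<lambda>u. coords u p)"
proof (rule lipschitz_continuous_map_Hs)
  fix u v :: "('a, 'b) torus_fun" assume "u \<in> Hs s" "v \<in> Hs s"
  then show "\<bar>coords u p - coords v p\<bar> \<le> Hs_dist s u v"
    using abs_coords_le_Hs_norm[OF assms Hs_diff_band(1), of u v p] coords_diff[of u s v p]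
    by (simp add: Hs_dist_def)
qed

lemma band_norm_diff_le:
  assumes "u \<in> Hs s" "v \<in> Hs s"
  shows "band_norm s A u \<le> band_norm s A v + Hs_norm s (u - v)"
  using Hs_add_band(2)[OF assms(2) Hs_diff_band(1)[OF assms], of A]
    band_norm_le_Hs_norm[OF Hs_diff_band(1)[OF assms], of A] by simp

lemma continuous_map_band_norm: "continuous_map (Hs_topology s) euclideanreal (band_norm s A)"
proof (rule lipschitz_continuous_map_Hs)
  fix u v :: "('a, 'b) torus_fun" assume uv: "u \<in> Hs s" "v \<in> Hs s"
  have "Hs_norm s (v - u) = Hs_norm s (u - v)"
    using band_norm_uminus[of s UNIV "u - v"] by (simp add: Hs_norm_band)
  then show "\<bar>band_norm s A u - band_norm s A v\<bar> \<le> Hs_dist s u v"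
    using band_norm_diff_le[OF uv, of A] band_norm_diff_le[OF uv(2,1), of A]
    by (simp add: Hs_dist_def)
qed

lemma freq_box_mono: "N \<le> N' \<Longrightarrow> freq_box N \<subseteq> freq_box N'"
  unfolding freq_box_def by (auto intro: order_trans)

lemma finite_subset_freq_box:
  fixes F :: "(int^'d) set"
  assumes "finite F" shows "\<exists>N. F \<subseteq> freq_box N"
  using assms
proof induction
  case (insert k F)
  then obtain N where N: "F \<subseteq> freq_box N" by blast
  define M where "M = (\<Sum>i\<in>UNIV. nat \<bar>k $ i\<bar>)"
  have "k \<in> freq_box M"
  proof -
    have "nat \<bar>k $ i\<bar> \<le> M" for i unfolding M_def by (rule member_le_sum) auto
    then show ?thesis by (auto simp: freq_box_def nat_le_iff)
  qed
  then have "insert k F \<subseteq> freq_box (max N M)"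
    using N freq_box_mono[of N "max N M"] freq_box_mono[of M "max N M"] by auto
  then show ?case ..
qed simp

lemma band_norm_antimono:
  assumes "u \<in> Hs s" "A \<subseteq> B" shows "band_norm s A u \<le> band_norm s B u"
  by (rule summable_band_normI(2)) (use assms in \<open>auto intro!: L2_set_le_band_norm\<close>)

lemma band_norm_tail:
  assumes u: "u \<in> Hs s" and \<tau>: "\<tau> > 0"
  shows "\<exists>N. band_norm s (- freq_box N) u < \<tau>"
proof -
  let ?f = "\<lambda>k. sobolev_weight s k * (norm (fourier u k))\<^sup>2"
  have \<tau>2: "\<tau>\<^sup>2 / 2 > 0" using \<tau> by simp
  obtain F where F: "finite F" "dist (sum ?f F) (infsum ?f UNIV) \<le> \<tau>\<^sup>2 / 2"
    using infsum_finite_approximation[OF weighted_summable[OF u, of UNIV] \<tau>2] by blast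
  obtain N where N: "F \<subseteq> freq_box N" using finite_subset_freq_box[OF F(1)] by blast
  have "infsum ?f UNIV = infsum ?f (freq_box N) + infsum ?f (- freq_box N)"
    using infsum_Un_disjoint[of ?f "freq_box N" "- freq_box N"] weighted_summable[OF u] by simp
  moreover have "infsum ?f (freq_box N) = sum ?f (freq_box N)"
    by (simp add: freq_box_finite)
  moreover have "sum ?f F \<le> sum ?f (freq_box N)"
    using N by (intro sum_mono2) (auto simp: freq_box_finite weighted_nonneg)
  ultimately have "infsum ?f (- freq_box N) \<le> \<tau>\<^sup>2 / 2"
    using F(2) unfolding dist_real_def by linarith
  also have "\<dots> < \<tau>\<^sup>2" using \<tau> by simp
  finally have "band_norm s (- freq_box N) u < sqrt (\<tau>\<^sup>2)"
    unfolding band_norm_def by (rule real_sqrt_less_mono)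
  then show ?thesis using \<tau> by auto
qed

text \<open>A Dini argument: the sets of functions with small tail beyond \<open>N\<close> are open, increase with \<open>N\<close> and cover the space.\<close>

lemma compact_uniform_tail:
  fixes V :: "('d::finite, 'c::finite) torus_fun set"
  assumes V: "compactin (Hs_topology s) V" and \<tau>: "\<tau> > 0"
  shows "\<exists>N. \<forall>N'\<ge>N. \<forall>w\<in>V. band_norm s (- freq_box N') w < \<tau>"
proof -
  define U where "U N = {w \<in> Hs s :: ('d, 'c) torus_fun set. band_norm s (- freq_box N) w < \<tau>}" for N
  have Vs: "V \<subseteq> Hs s" using compactin_subset_topspace[OF V] by (simp add: topspace_Hs)
  have open_U: "openin (Hs_topology s) (U N)" for N
    using openin_continuous_map_preimage[OF continuous_map_band_norm, of "{..<\<tau>}" s "- freq_box N"]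
    by (simp add: U_def topspace_Hs)
  have mono: "U N \<subseteq> U N'" if "N \<le> N'" for N N'
  proof
    fix w assume "w \<in> U N"
    moreover have "band_norm s (- freq_box N') w \<le> band_norm s (- freq_box N) w" if "w \<in> Hs s"
      using that freq_box_mono[OF \<open>N \<le> N'\<close>] by (intro band_norm_antimono) auto
    ultimately show "w \<in> U N'" by (auto simp: U_def)
  qed
  have "V \<subseteq> \<Union>(range U)"
    using Vs band_norm_tail[OF _ \<tau>] by (fastforce simp: U_def)
  then obtain \<F> where \<F>: "finite \<F>" "\<F> \<subseteq> range U" "V \<subseteq> \<Union>\<F>"
    using V open_U unfolding compactin_def by (metis (no_types, lifting) imageE)
  then obtain J where J: "finite J" "\<F> = U ` J" by (meson finite_subset_image)
  have "V \<subseteq> U N'" if "N' \<ge> Max (insert 0 J)" for N'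
  proof
    fix w assume "w \<in> V"
    then obtain N where "N \<in> J" "w \<in> U N" using \<F> J by blast
    moreover have "N \<le> N'" using that J \<open>N \<in> J\<close> by simp
    ultimately show "w \<in> U N'" using mono by blast
  qed
  then show ?thesis by (auto simp: U_def)
qed

section \<open>Networks with activation $t + \sin t$\<close>

text \<open>The activation function of the model.\<close>

definition shifted_sine :: "real \<Rightarrow> real" where
  "shifted_sine t = t + sin t"

lemma shifted_sine_id: "t = (shifted_sine t + shifted_sine (t + pi) - pi) / 2"
  by (simp add: shifted_sine_def)

lemma shifted_sine_sin: "sin t = (shifted_sine t - shifted_sine (t + pi) + pi) / 2"
  by (simp add: shifted_sine_def)

text \<open>Finite sums of sines of affine functions of finitely many of the coordinates in \<open>I\<close>.\<close>

inductive sine_span :: "'i set \<Rightarrow> (('i \<Rightarrow> real) \<Rightarrow> real) \<Rightarrow> bool" for I where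
  sine_unit: "finite J \<Longrightarrow> J \<subseteq> I \<Longrightarrow> sine_span I (\<lambda>z. a * sin ((\<Sum>i\<in>J. w i * z i) + b))"
| sine_add: "sine_span I f \<Longrightarrow> sine_span I g \<Longrightarrow> sine_span I (\<lambda>z. f z + g z)"

text \<open>Products of sines are sums of cosines, which are phase-shifted sines.\<close>

lemma sine_span_mult:
  assumes "sine_span I f" "sine_span I g"
  shows "sine_span I (\<lambda>z. f z * g z)"
  using assms(1)
proof induction
  case (sine_unit J a w b)
  note J = sine_unit
  show ?case using assms(2)
  proof induction
    case (sine_unit J' a' w' b')
    define v where "v = (\<lambda>i. if i \<in> J then w i else 0)"
    define v' where "v' = (\<lambda>i. if i \<in> J' then w' i else 0)"
    have v: "(\<Sum>i\<in>J. w i * z i) = (\<Sum>i\<in>J \<union> J'. v i * z i)" for z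
      using J sine_unit by (intro sum.mono_neutral_cong_left) (auto simp: v_def)
    have v': "(\<Sum>i\<in>J'. w' i * z i) = (\<Sum>i\<in>J \<union> J'. v' i * z i)" for z
      using J sine_unit by (intro sum.mono_neutral_cong_left) (auto simp: v'_def)
    have eq: "a * sin ((\<Sum>i\<in>J. w i * z i) + b) * (a' * sin ((\<Sum>i\<in>J'. w' i * z i) + b')) =
        (a * a' / 2) * sin ((\<Sum>i\<in>J \<union> J'. (v i - v' i) * z i) + (b - b' + pi / 2)) +
        (a * a' / 2) * sin ((\<Sum>i\<in>J \<union> J'. (v i + v' i) * z i) + (b + b' - pi / 2))" for z
    proof -
      define X where "X = (\<Sum>i\<in>J \<union> J'. v i * z i) + b"
      define Y where "Y = (\<Sum>i\<in>J \<union> J'. v' i * z i) + b'"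
      have "(\<Sum>i\<in>J \<union> J'. (v i - v' i) * z i) + (b - b' + pi / 2) = (X - Y) + pi / 2"
        "(\<Sum>i\<in>J \<union> J'. (v i + v' i) * z i) + (b + b' - pi / 2) = (X + Y) - pi / 2"
        by (simp_all add: X_def Y_def algebra_simps sum.distrib sum_subtractf)
      moreover have "sin ((X - Y) + pi / 2) = cos (X - Y)" "sin ((X + Y) - pi / 2) = - cos (X + Y)"
        by (simp_all add: sin_add sin_diff)
      ultimately have "(a * a' / 2) * sin ((\<Sum>i\<in>J \<union> J'. (v i - v' i) * z i) + (b - b' + pi / 2)) +
          (a * a' / 2) * sin ((\<Sum>i\<in>J \<union> J'. (v i + v' i) * z i) + (b + b' - pi / 2)) =
          (a * a' / 2) * cos (X - Y) + (a * a' / 2) * - cos (X + Y)"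
        by (simp only:)
      also have "\<dots> = a * sin X * (a' * sin Y)" by (simp add: cos_add cos_diff field_simps)
      finally show ?thesis by (simp only: v v' X_def Y_def)
    qed
    show ?case
      unfolding eq using J sine_unit by (intro sine_span.intros) auto
  next
    case (sine_add f' g')
    then show ?case by (simp only: distrib_left) (intro sine_span.intros)
  qed
next
  case (sine_add f' g')
  then show ?case by (simp only: distrib_right) (intro sine_span.intros)
qed

lemma sine_span_normal_form:
  assumes "sine_span I f"
  shows "\<exists>J n a w b. finite J \<and> J \<subseteq> I \<and> (\<forall>z. f z = (\<Sum>q<(n::nat). a q * sin ((\<Sum>i\<in>J. w q i * z i) + b q)))"
  using assms
proof induction
  case (sine_unit J a w b)
  show ?case
    by (rule exI[of _ J], rule exI[of _ 1], rule exI[of _ "\<lambda>_. a"], rule exI[of _ "\<lambda>_. w"], rule exI[of _ "\<lambda>_. b"])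
       (use sine_unit in simp)
next
  case (sine_add f g)
  obtain J n a w b where 1: "finite J" "J \<subseteq> I" "\<And>z. f z = (\<Sum>q<(n::nat). a q * sin ((\<Sum>i\<in>J. w q i * z i) + b q))"
    using sine_add.IH(1) by blast
  obtain J' n' a' w' b' where 2: "finite J'" "J' \<subseteq> I" "\<And>z. g z = (\<Sum>q<(n'::nat). a' q * sin ((\<Sum>i\<in>J'. w' q i * z i) + b' q))"
    using sine_add.IH(2) by blast
  define A where "A q = (if q < n then a q else a' (q - n))" for q
  define B where "B q = (if q < n then b q else b' (q - n))" for q
  define W where "W q i = (if q < n then (if i \<in> J then w q i else 0) else (if i \<in> J' then w' (q - n) i else 0))" for q i
  have "f z + g z = (\<Sum>q<n + n'. A q * sin ((\<Sum>i\<in>J \<union> J'. W q i * z i) + B q))" for z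
  proof -
    have "(\<Sum>q<n + n'. A q * sin ((\<Sum>i\<in>J \<union> J'. W q i * z i) + B q)) =
        (\<Sum>q<n. A q * sin ((\<Sum>i\<in>J \<union> J'. W q i * z i) + B q)) +
        (\<Sum>q<n'. A (q + n) * sin ((\<Sum>i\<in>J \<union> J'. W (q + n) i * z i) + B (q + n)))"
      by (induction n') (simp_all add: add.commute)
    also have "(\<Sum>q<n. A q * sin ((\<Sum>i\<in>J \<union> J'. W q i * z i) + B q)) = f z"
    proof -
      have "(\<Sum>i\<in>J \<union> J'. W q i * z i) = (\<Sum>i\<in>J. w q i * z i)" if "q < n" for q
        using 1 2 that by (intro sum.mono_neutral_cong_right) (auto simp: W_def)
      then show ?thesis by (simp add: 1(3) A_def B_def)
    qed
    also have "(\<Sum>q<n'. A (q + n) * sin ((\<Sum>i\<in>J \<union> J'. W (q + n) i * z i) + B (q + n))) = g z"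
    proof -
      have "(\<Sum>i\<in>J \<union> J'. W (q + n) i * z i) = (\<Sum>i\<in>J'. w' q i * z i)" for q
        using 1 2 by (intro sum.mono_neutral_cong_right) (auto simp: W_def)
      then show ?thesis by (simp add: 2(3) A_def B_def)
    qed
    finally show ?thesis by simp
  qed
  then show ?case using 1 2
    by (intro exI[of _ "J \<union> J'"] exI[of _ "n + n'"] exI[of _ A] exI[of _ W] exI[of _ B]) auto
qed

lemma sine_span_continuous: "sine_span I f \<Longrightarrow> continuous_on K f"
proof (induction rule: sine_span.induct)
  case (sine_unit J a w b)
  have coord: "continuous_on K (\<lambda>z. z i)" for i
    by (rule continuous_on_subset[OF continuous_on_product_coordinates]) simp
  have "continuous_on UNIV (sin :: real \<Rightarrow> real)" by (intro continuous_intros)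
  then have "continuous_on K (\<lambda>z. sin ((\<Sum>i\<in>J. w i * z i) + b))"
    by (rule continuous_on_compose2) (intro continuous_intros coord, simp)
  then show ?case by (rule continuous_on_mult_left)
qed (intro continuous_intros)

text \<open>The index set \<open>I\<close> may be infinite; each approximant uses only a finite part \<open>J\<close> of it.\<close>

lemma sine_nets_dense:
  fixes K :: "('i::countable \<Rightarrow> real) set"
  assumes K: "compact K" and sep: "\<And>x y. x \<in> K \<Longrightarrow> y \<in> K \<Longrightarrow> x \<noteq> y \<Longrightarrow> \<exists>i\<in>I. x i \<noteq> y i"
    and T: "continuous_on K T" and \<delta>: "\<delta> > 0"
  shows "\<exists>J n a w b. finite J \<and> J \<subseteq> I \<and>
     (\<forall>z\<in>K. \<bar>(\<Sum>q<(n::nat). a q * sin ((\<Sum>i\<in>J. w q i * z i) + b q)) - T z\<bar> < \<delta>)"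
proof -
  have "\<exists>g. sine_span I g \<and> (\<forall>x\<in>K. \<bar>T x - g x\<bar> < \<delta>)"
  proof (rule Stone_Weierstrass_HOL[where P = "sine_span I" and S = K])
    show "sine_span I (\<lambda>_. c)" for c
      using sine_unit[of "{}" I c _ "pi / 2"] by simp
    show "\<exists>f. sine_span I f \<and> f x \<noteq> f y" if xy: "x \<in> K \<and> y \<in> K \<and> x \<noteq> y" for x y
    proof -
      obtain i where i: "i \<in> I" "x i \<noteq> y i" using xy sep by metis
      define d where "d = x i - y i"
      have d: "d \<noteq> 0" using i by (simp add: d_def)
      define c where "c = (pi / 2) / d"
      \<comment> \<open>This sine vanishes at \<open>y\<close> and equals $1$ at \<open>x\<close>.\<close>
      define f where "f = (\<lambda>z. 1 * sin ((\<Sum>j\<in>{i}. c * z j) + - (c * y i)))"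
      have "sine_span I f" unfolding f_def using i by (intro sine_unit) auto
      moreover have "f y = 0" by (simp add: f_def)
      moreover have "f x = 1"
      proof -
        have "c * x i + - (c * y i) = c * d" by (simp add: d_def algebra_simps)
        also have "\<dots> = pi / 2" using d by (simp add: c_def)
        finally have "c * x i + - (c * y i) = pi / 2" .
        moreover have "f x = sin (c * x i + - (c * y i))" by (simp add: f_def)
        ultimately show ?thesis by (simp only: sin_pi_half)
      qed
      ultimately show ?thesis by (metis zero_neq_one)
    qed
  qed (use K T \<delta> sine_span_continuous sine_add sine_span_mult in auto)
  then obtain g where g: "sine_span I g" "\<And>x. x \<in> K \<Longrightarrow> \<bar>T x - g x\<bar> < \<delta>" by blast
  obtain J n a w b where nf: "finite J" "J \<subseteq> I"
    "\<And>z. g z = (\<Sum>q<(n::nat). a q * sin ((\<Sum>i\<in>J. w q i * z i) + b q))"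
    using sine_span_normal_form[OF g(1)] by blast
  have "\<forall>z\<in>K. \<bar>(\<Sum>q<n. a q * sin ((\<Sum>i\<in>J. w q i * z i) + b q)) - T z\<bar> < \<delta>"
    using g(2) unfolding nf(3) by (simp add: abs_minus_commute)
  then show ?thesis using nf(1,2) by blast
qed

text \<open>Hidden units may be indexed by any finite set instead of an initial segment of the naturals.\<close>

lemma mlp_hidden_units:
  assumes "finite Q"
  shows "mlp \<sigma> I J (\<lambda>x j. if j \<in> J then
     (\<Sum>q\<in>Q. A j q * \<sigma> ((\<Sum>i\<in>I. B q i * x i) + b q)) + c j else 0)"
proof -
  obtain h where h: "bij_betw h {..<card Q} Q"
    using ex_bij_betw_nat_finite[OF assms] by (auto simp: atLeast0LessThan)
  have "(\<Sum>q\<in>Q. A j q * \<sigma> ((\<Sum>i\<in>I. B q i * x i) + b q)) =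
      (\<Sum>n<card Q. A j (h n) * \<sigma> (affine_on I {..<card Q} (\<lambda>n. B (h n)) (\<lambda>n. b (h n)) x n))" for j x
    unfolding sum.reindex_bij_betw[OF h, symmetric] by (simp add: affine_on_def)
  then have "(\<lambda>x j. if j \<in> J then (\<Sum>q\<in>Q. A j q * \<sigma> ((\<Sum>i\<in>I. B q i * x i) + b q)) + c j else 0) =
      (\<lambda>x. affine_on {..<card Q} J (\<lambda>j n. A j (h n)) c
        (\<lambda>n. \<sigma> (affine_on I {..<card Q} (\<lambda>n. B (h n)) (\<lambda>n. b (h n)) x n)))"
    by (intro ext) (simp add: affine_on_def)
  then show ?thesis unfolding mlp_def using output_layer by blast
qed

lemma mlp_affine:
  assumes "finite J"
  shows "mlp shifted_sine I J (affine_on I J A b)"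
proof -
  let ?Q = "J \<times> {0, pi}"
  have "affine_on I J A b = (\<lambda>x j. if j \<in> J then
     (\<Sum>q\<in>?Q. (if fst q = j then 1 / 2 else 0) * shifted_sine ((\<Sum>i\<in>I. A (fst q) i * x i) + (b (fst q) + snd q))) + - pi / 2 else 0)"
  proof (intro ext)
    fix x j
    show "affine_on I J A b x j = (if j \<in> J then
     (\<Sum>q\<in>?Q. (if fst q = j then 1 / 2 else 0) * shifted_sine ((\<Sum>i\<in>I. A (fst q) i * x i) + (b (fst q) + snd q))) + - pi / 2 else 0)"
    proof (cases "j \<in> J")
      case True
      define t where "t = (\<Sum>i\<in>I. A j i * x i) + b j"
      have "(\<Sum>q\<in>?Q. (if fst q = j then 1 / 2 else 0) * shifted_sine ((\<Sum>i\<in>I. A (fst q) i * x i) + (b (fst q) + snd q))) =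
         (\<Sum>q\<in>{j} \<times> {0, pi}. (1 / 2) * shifted_sine ((\<Sum>i\<in>I. A (fst q) i * x i) + (b (fst q) + snd q)))"
        using True assms by (intro sum.mono_neutral_cong_right) auto
      also have "\<dots> = (1 / 2) * (shifted_sine t + shifted_sine (t + pi))"
        by (simp add: sum.cartesian_product' t_def add.assoc)
      finally show ?thesis
        using True shifted_sine_id[of t] by (simp add: affine_on_def t_def)
    qed (simp add: affine_on_def)
  qed
  then show ?thesis
    using mlp_hidden_units[of ?Q shifted_sine I J "\<lambda>j q. if fst q = j then 1 / 2 else 0" "\<lambda>q. A (fst q)" "\<lambda>q. b (fst q) + snd q" "\<lambda>_. - pi / 2"] assms
    by simp
qed

lemma mlp_sine:
  assumes "finite Q"
  shows "mlp shifted_sine I J (\<lambda>x j. if j \<in> J then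
     (\<Sum>q\<in>Q. a j q * sin ((\<Sum>i\<in>I. w q i * x i) + b q)) else 0)"
proof -
  let ?Q = "Q \<times> {0, pi}"
  let ?L = "\<lambda>x q. (\<Sum>i\<in>I. w q i * x i) + b q"
  have eq: "(\<Sum>q\<in>Q. a j q * sin (?L x q)) =
      (\<Sum>q\<in>?Q. (if snd q = 0 then a j (fst q) / 2 else - a j (fst q) / 2) *
         shifted_sine ((\<Sum>i\<in>I. w (fst q) i * x i) + (b (fst q) + snd q))) + (\<Sum>q\<in>Q. a j q * pi / 2)" for x j
  proof -
    have "(\<Sum>q\<in>?Q. (if snd q = 0 then a j (fst q) / 2 else - a j (fst q) / 2) *
         shifted_sine ((\<Sum>i\<in>I. w (fst q) i * x i) + (b (fst q) + snd q))) =
       (\<Sum>q\<in>Q. a j q / 2 * shifted_sine (?L x q) + - a j q / 2 * shifted_sine (?L x q + pi))"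
      by (simp add: sum.cartesian_product' add.assoc)
    moreover have "a j q * sin (?L x q) =
        (a j q / 2 * shifted_sine (?L x q) + - a j q / 2 * shifted_sine (?L x q + pi)) + a j q * pi / 2" for q
      by (subst shifted_sine_sin) (simp add: field_simps)
    ultimately show ?thesis by (simp only: sum.distrib)
  qed
  show ?thesis
    unfolding eq by (rule mlp_hidden_units) (simp add: assms)
qed

lemma mlp_cong:
  assumes "mlp \<sigma> I J G" "\<And>i. i \<in> I \<Longrightarrow> x i = y i"
  shows "G x = G y"
proof -
  have "affine_on I {..<w} A b x = affine_on I {..<w} A b y" for w and A :: "nat \<Rightarrow> 'a \<Rightarrow> real" and b
    using assms(2) by (auto simp: affine_on_def)
  then show ?thesis using assms(1) by (auto simp: mlp_def)
qed

text \<open>The finite set \<open>I0\<close> of coordinates that the approximating network uses may be enlarged at will, so that in particular it can be completed to a full frequency box.\<close>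

lemma mlp_dense:
  fixes K :: "('i::countable \<Rightarrow> real) set"
  assumes K: "compact K" and sep: "\<And>x y. x \<in> K \<Longrightarrow> y \<in> K \<Longrightarrow> x \<noteq> y \<Longrightarrow> \<exists>i\<in>I. x i \<noteq> y i"
    and J: "finite J" and T: "\<And>j. j \<in> J \<Longrightarrow> continuous_on K (T j)" and \<delta>: "\<delta> > 0"
  shows "\<exists>I0. finite I0 \<and> I0 \<subseteq> I \<and> (\<forall>I'. finite I' \<and> I0 \<subseteq> I' \<longrightarrow>
     (\<exists>G. mlp shifted_sine I' J G \<and> (\<forall>z\<in>K. \<forall>j\<in>J. \<bar>G z j - T j z\<bar> < \<delta>)))"
proof -
  \<comment> \<open>The parameters of the approximating sums are packed into one tuple for each output.\<close>
  define ok where "ok j net = (case net of (I0, n, a, w, b) \<Rightarrow> finite I0 \<and> I0 \<subseteq> I \<and>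
     (\<forall>z\<in>K. \<bar>(\<Sum>q<(n::nat). a q * sin ((\<Sum>i\<in>I0. w q i * z i) + b q)) - T j z\<bar> < \<delta>))" for j net
  have "\<forall>j\<in>J. \<exists>net. ok j net"
  proof
    fix j assume j: "j \<in> J"
    have "\<exists>I0 n a w b. finite I0 \<and> I0 \<subseteq> I \<and>
       (\<forall>z\<in>K. \<bar>(\<Sum>q<(n::nat). a q * sin ((\<Sum>i\<in>I0. w q i * z i) + b q)) - T j z\<bar> < \<delta>)"
      by (rule sine_nets_dense[OF K sep T[OF j] \<delta>])
    then obtain I0 n a w b where "finite I0 \<and> I0 \<subseteq> I \<and>
       (\<forall>z\<in>K. \<bar>(\<Sum>q<(n::nat). a q * sin ((\<Sum>i\<in>I0. w q i * z i) + b q)) - T j z\<bar> < \<delta>)"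
      by (elim exE) (rule that)
    then have "ok j (I0, n, a, w, b)" by (simp add: ok_def)
    then show "\<exists>net. ok j net" ..
  qed
  then obtain net where ok: "\<forall>j\<in>J. ok j (net j)" by (rule bchoice[THEN exE])
  define I0 where "I0 j = fst (net j)" for j
  define n where "n j = fst (snd (net j))" for j
  define a where "a j = fst (snd (snd (net j)))" for j
  define w where "w j = fst (snd (snd (snd (net j))))" for j
  define b where "b j = snd (snd (snd (snd (net j))))" for j
  have net: "finite (I0 j) \<and> I0 j \<subseteq> I \<and>
     (\<forall>z\<in>K. \<bar>(\<Sum>q<n j. a j q * sin ((\<Sum>i\<in>I0 j. w j q i * z i) + b j q)) - T j z\<bar> < \<delta>)"
    if "j \<in> J" for j
    using ok that by (simp add: ok_def case_prod_beta I0_def n_def a_def w_def b_def)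
  have "\<exists>G. mlp shifted_sine I' J G \<and> (\<forall>z\<in>K. \<forall>j\<in>J. \<bar>G z j - T j z\<bar> < \<delta>)"
    if I': "finite I'" "(\<Union>j\<in>J. I0 j) \<subseteq> I'" for I'
  proof -
    let ?Q = "SIGMA j:J. {..<n j}"
    define G where "G = (\<lambda>z j. if j \<in> J then (\<Sum>q\<in>?Q. (if fst q = j then a j (snd q) else 0) *
        sin ((\<Sum>i\<in>I'. (if i \<in> I0 (fst q) then w (fst q) (snd q) i else 0) * z i) + b (fst q) (snd q))) else 0)"
    have "mlp shifted_sine I' J G"
      unfolding G_def using J by (intro mlp_sine finite_SigmaI) auto
    moreover have "\<bar>G z j - T j z\<bar> < \<delta>" if z: "z \<in> K" and j: "j \<in> J" for z j
    proof -
      have "G z j = (\<Sum>q\<in>{j} \<times> {..<n j}. a j (snd q) *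
          sin ((\<Sum>i\<in>I'. (if i \<in> I0 j then w j (snd q) i else 0) * z i) + b j (snd q)))"
        unfolding G_def if_P[OF j]
      proof (rule sum.mono_neutral_cong_right)
        show "finite ?Q" using J by simp
        show "{j} \<times> {..<n j} \<subseteq> ?Q" using j by auto
        show "\<forall>q\<in>?Q - {j} \<times> {..<n j}. (if fst q = j then a j (snd q) else 0) *
          sin ((\<Sum>i\<in>I'. (if i \<in> I0 (fst q) then w (fst q) (snd q) i else 0) * z i) + b (fst q) (snd q)) = 0"
          by auto
      qed (auto cong: if_cong)
      also have "\<dots> = (\<Sum>q<n j. a j q *
          sin ((\<Sum>i\<in>I'. (if i \<in> I0 j then w j q i else 0) * z i) + b j q))"
        by (simp add: sum.cartesian_product' cong: if_cong)
      also have "\<dots> = (\<Sum>q<n j. a j q * sin ((\<Sum>i\<in>I0 j. w j q i * z i) + b j q))"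
      proof -
        have "(\<Sum>i\<in>I'. (if i \<in> I0 j then w j q i else 0) * z i) = (\<Sum>i\<in>I0 j. w j q i * z i)" for q
          using I' j by (intro sum.mono_neutral_cong_right) auto
        then show ?thesis by simp
      qed
      finally show ?thesis using net[OF j] z by simp
    qed
    ultimately show ?thesis by blast
  qed
  moreover have "finite (\<Union>j\<in>J. I0 j)" "(\<Union>j\<in>J. I0 j) \<subseteq> I" using J net by auto
  ultimately show ?thesis by (intro exI[of _ "\<Union>j\<in>J. I0 j"]) blast
qed

lemma universal_approximation_shifted_sine: "universal_approximation shifted_sine"
  unfolding universal_approximation_def
proof (intro allI impI, elim conjE)
  fix m n and K :: "(nat \<Rightarrow> real) set" and g and \<epsilon> :: real
  assume K: "compactin (Euclidean_space m) K"
    and g: "continuous_map (subtopology (Euclidean_space m) K) (Euclidean_space n) g" and \<epsilon>: "\<epsilon> > 0"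
  have Ke: "K \<subseteq> {x. \<forall>i\<ge>m. x i = 0}" "compact K"
    using K by (simp_all add: Euclidean_space_def compactin_subtopology euclidean_product_topology)
  have sub: "subtopology (Euclidean_space m) K = top_of_set K"
    using Ke(1) by (simp add: Euclidean_space_def subtopology_subtopology euclidean_product_topology Int_absorb1)
  have cont: "continuous_on K (\<lambda>x. g x j)" for j
  proof -
    have "continuous_map (top_of_set K) (powertop_real UNIV) g"
      using g unfolding sub by (simp add: Euclidean_space_def continuous_map_in_subtopology)
    then have "continuous_map (top_of_set K) euclideanreal (\<lambda>x. g x j)"
      by (simp add: continuous_map_componentwise_UNIV)
    then show ?thesis by simp
  qed
  have sep: "\<exists>i\<in>{..<m}. x i \<noteq> y i" if "x \<in> K" "y \<in> K" "x \<noteq> y" for x y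
  proof (rule ccontr)
    assume "\<not> (\<exists>i\<in>{..<m}. x i \<noteq> y i)"
    then have "x i = y i" for i
      using subsetD[OF Ke(1) that(1)] subsetD[OF Ke(1) that(2)] by (cases "i < m") auto
    then show False using that(3) by auto
  qed
  have "\<epsilon> / (real n + 1) > 0" using \<epsilon> by simp
  then have "\<exists>I0. finite I0 \<and> I0 \<subseteq> {..<m} \<and> (\<forall>I'. finite I' \<and> I0 \<subseteq> I' \<longrightarrow>
     (\<exists>F. mlp shifted_sine I' {..<n} F \<and> (\<forall>z\<in>K. \<forall>j\<in>{..<n}. \<bar>F z j - g z j\<bar> < \<epsilon> / (real n + 1))))"
    by (intro mlp_dense Ke(2) sep finite_lessThan cont)
  then obtain F where F: "mlp shifted_sine {..<m} {..<n} F"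
    "\<forall>z\<in>K. \<forall>j\<in>{..<n}. \<bar>F z j - g z j\<bar> < \<epsilon> / (real n + 1)"
    using finite_lessThan[of m] by meson
  have "eucl_dist n (F x) (g x) < \<epsilon>" if "x \<in> K" for x
  proof -
    have "eucl_dist n (F x) (g x) \<le> (\<Sum>i<n. \<bar>F x i - g x i\<bar>)"
      unfolding eucl_dist_def by (rule L2_set_le_sum_abs)
    also have "\<dots> \<le> (\<Sum>i<n. \<epsilon> / (real n + 1))"
      using F(2) that by (intro sum_mono less_imp_le) auto
    also have "\<dots> = real n / (real n + 1) * \<epsilon>" by simp
    also have "\<dots> < 1 * \<epsilon>" using \<epsilon> by (intro mult_strict_right_mono) auto
    finally show ?thesis by simp
  qed
  then show "\<exists>F. mlp shifted_sine {..<m} {..<n} F \<and> (\<forall>x\<in>K. eucl_dist n (F x) (g x) < \<epsilon>)"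
    using F(1) by blast
qed

section \<open>Approximation of continuous functionals by encoders\<close>

lemma coords_inj_on: "inj_on coords (Hs s)"
proof (rule inj_onI)
  fix u v :: "('a, 'b) torus_fun"
  assume uv: "u \<in> Hs s" "v \<in> Hs s" "coords u = coords v"
  have "fourier u k = fourier v k" for k
  proof -
    have "norm (fourier (u - v) k) \<le> 0"
      using norm_fourier_le_coords[of "u - v" k] uv by (simp add: coords_diff)
    then show ?thesis using uv by (simp add: fourier_diff Hs_def)
  qed
  then show "u = v" using uv by (intro torus_fun_eqI) (auto simp: Hs_def)
qed

text \<open>The Fourier coordinates embed the compact set \<open>K\<close> homeomorphically into a product of lines, where \<open>mlp_dense\<close> applies.\<close>

lemma encoder_dense:
  fixes K :: "('d::finite, 'c::finite) torus_fun set"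
  assumes s: "s \<ge> 0" and K: "compactin (Hs_topology s) K" and J: "finite J"
    and T: "\<And>j. j \<in> J \<Longrightarrow> continuous_map (subtopology (Hs_topology s) K) euclideanreal (T j)"
    and \<delta>: "\<delta> > 0"
  shows "\<exists>N G. mlp shifted_sine (freq_box N \<times> UNIV) J G \<and>
     (\<forall>u\<in>K. \<forall>j\<in>J. \<bar>G (fourier_coords N u) j - T j u\<bar> < \<delta>)"
proof -
  let ?X = "subtopology (Hs_topology s) K"
  define Z where "Z = coords ` K"
  have Ks: "K \<subseteq> Hs s" using compactin_subset_topspace[OF K] by (simp add: topspace_Hs)
  have inj: "inj_on coords K" using coords_inj_on Ks by (rule inj_on_subset)
  have topK: "topspace ?X = K" using Ks by (simp add: topspace_Hs Int_absorb1)
  have cont: "continuous_map (Hs_topology s) euclidean (coords :: ('d, 'c) torus_fun \<Rightarrow> _)"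
    unfolding euclidean_product_topology[symmetric] continuous_map_componentwise_UNIV
    using continuous_map_coords[OF s] by blast
  have Z: "compact Z"
    using image_compactin[OF K cont] by (simp add: Z_def)
  have quo: "quotient_map ?X (top_of_set Z) coords"
  proof (rule continuous_closed_imp_quotient_map)
    show c: "continuous_map ?X (top_of_set Z) coords"
      using cont by (auto simp: continuous_map_in_subtopology continuous_map_from_subtopology Z_def topK)
    show "closed_map ?X (top_of_set Z) coords"
    proof (rule continuous_imp_closed_map)
      show "compact_space ?X" using K by (simp add: compact_space_subtopology)
      show "Hausdorff_space (top_of_set Z)" by (simp add: Hausdorff_space_subtopology)
    qed (rule c)
    show "coords ` topspace ?X = topspace (top_of_set Z)" by (simp only: topK Z_def topspace_euclidean_subtopology)
  qed
  define T' where "T' j z = T j (inv_into K coords z)" for j z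
  have T': "T' j (coords u) = T j u" if "u \<in> K" for j u
    using inj that by (simp add: T'_def)
  have "continuous_on Z (T' j)" if "j \<in> J" for j
  proof -
    have "continuous_map ?X euclideanreal (T' j \<circ> coords)"
      using T[OF that] by (rule continuous_map_eq) (simp add: topK T')
    then have "continuous_map (top_of_set Z) euclideanreal (T' j)"
      by (rule continuous_compose_quotient_map[OF quo])
    then show ?thesis by simp
  qed
  note cont' = this
  have sep: "\<exists>i\<in>UNIV. x i \<noteq> y i" if "x \<in> Z" "y \<in> Z" "x \<noteq> y" for x y
    using that by auto
  have "\<exists>I0. finite I0 \<and> I0 \<subseteq> UNIV \<and> (\<forall>I'. finite I' \<and> I0 \<subseteq> I' \<longrightarrow>
     (\<exists>G. mlp shifted_sine I' J G \<and> (\<forall>z\<in>Z. \<forall>j\<in>J. \<bar>G z j - T' j z\<bar> < \<delta>)))"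
    by (rule mlp_dense[OF Z sep J cont' \<delta>])
  then obtain I0 :: "((int^'d) \<times> 'c) set" where I0: "finite I0" "\<forall>I'. finite I' \<and> I0 \<subseteq> I' \<longrightarrow>
     (\<exists>G. mlp shifted_sine I' J G \<and> (\<forall>z\<in>Z. \<forall>j\<in>J. \<bar>G z j - T' j z\<bar> < \<delta>))"
    by blast
  obtain N where N: "fst ` I0 \<subseteq> freq_box N" using finite_subset_freq_box I0(1) by blast
  let ?I = "freq_box N \<times> (UNIV :: 'c set)"
  have "I0 \<subseteq> ?I" using N by force
  moreover have "finite ?I" by (simp add: freq_box_finite)
  ultimately obtain G where G: "mlp shifted_sine ?I J G" "\<forall>z\<in>Z. \<forall>j\<in>J. \<bar>G z j - T' j z\<bar> < \<delta>"
    using I0(2) by blast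
  have "G (fourier_coords N u) = G (coords u)" for u
    by (rule mlp_cong[OF G(1)]) (auto simp: fourier_coords_def coords_def)
  then have "\<bar>G (fourier_coords N u) j - T j u\<bar> < \<delta>" if "u \<in> K" "j \<in> J" for u j
    using G(2) that T'[OF that(1)] by (auto simp: Z_def)
  then show ?thesis using G(1) by blast
qed

section \<open>A model with a phase-modulating residual operator\<close>

text \<open>The only layer of the residual operator.  A channel is a triple of a Fourier slot \<open>p\<close>, a sign with which the angle of \<open>p\<close> is added, and a flag for the shift by $\pi$; \<open>\<gamma>\<close> enumerates the channels, and \<open>e (p, True)\<close> is the latent index of the angle of \<open>p\<close>.  Each channel adds its bias to its own input before the activation; the Fourier multiplier vanishes.\<close>

definition modulation_layer ::
    "(((int^('d::finite)) \<times> 'c) \<times> bool \<Rightarrow> nat) \<Rightarrow> (nat \<Rightarrow> ((int^'d) \<times> 'c) \<times> bool \<times> bool) \<Rightarrow> 'd fno_layer" where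
  "modulation_layer e \<gamma> =
    \<lparr>weight = (\<lambda>i j. if i = j then 1 else 0),
     cond_mat = (\<lambda>i t. case \<gamma> i of (p, up, shift) \<Rightarrow>
       if t = e (p, True) then (if up then 1 else - 1) else 0),
     cond_vec = (\<lambda>i. case \<gamma> i of (p, up, shift) \<Rightarrow>
       char_phase (fst p) + (if shift then pi else 0)),
     modes = {}, multiplier = (\<lambda>_ _ _. 0)\<rparr>"

text \<open>The model with encoder network \<open>G\<close>, encoder cutoff \<open>N\<^sub>E\<close> and cutoff \<open>N\<close> for the output.  The latent vector has \<open>m\<close> entries: \<open>e (p, False)\<close> is the index of the manifold coordinate in slot \<open>p\<close>, and \<open>e (p, True)\<close> that of the angle encoding the residual coordinate in slot \<open>p\<close>, scaled by \<open>R\<close>.\<close>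

definition phase_imno ::
    "nat \<Rightarrow> nat \<Rightarrow> nat \<Rightarrow> nat \<Rightarrow> real \<Rightarrow> (((int^('d::finite)) \<times> ('c::finite) \<Rightarrow> real) \<Rightarrow> nat \<Rightarrow> real) \<Rightarrow>
     (((int^'d) \<times> 'c) \<times> bool \<Rightarrow> nat) \<Rightarrow> (nat \<Rightarrow> ((int^'d) \<times> 'c) \<times> bool \<times> bool) \<Rightarrow> ('d, 'c) imno" where
  "phase_imno N N\<^sub>E m W R G e \<gamma> =
    \<lparr>activation = shifted_sine, latent_dim = m, enc_cutoff = N\<^sub>E, dec_cutoff = N,
     enc_net = G,
     dec_net = affine_on {..<m} (freq_box N \<times> UNIV) (\<lambda>p t. if t = e (p, False) then 1 else 0) (\<lambda>_. 0),
     dyn_net = affine_on {..<m} {..<m} (\<lambda>_ _. 0) (\<lambda>_. 0),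
     width = W,
     lift_net = affine_on UNIV {..<W}
       (\<lambda>i s. case s of Inl _ \<Rightarrow> 0 | Inr d \<Rightarrow> real_of_int (char_freq (fst (fst (\<gamma> i))) $ d)) (\<lambda>_. 0),
     layers = [modulation_layer e \<gamma>],
     proj_net = affine_on {..<W} UNIV
       (\<lambda>j i. case \<gamma> i of (p, up, shift) \<Rightarrow>
         if snd p = j then char_amp (fst p) * R / 4 * (if shift then - 1 else 1) else 0)
       (\<lambda>j. \<Sum>k\<in>(freq_box N :: (int^'d) set). char_amp k * R * pi / 2)\<rparr>"

lemma phase_imno_simps:
  "activation (phase_imno N N\<^sub>E m W R G e \<gamma>) = shifted_sine"
  "latent_dim (phase_imno N N\<^sub>E m W R G e \<gamma>) = m"
  "enc_cutoff (phase_imno N N\<^sub>E m W R G e \<gamma>) = N\<^sub>E"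
  "dec_cutoff (phase_imno N N\<^sub>E m W R G e \<gamma>) = N"
  "enc_net (phase_imno N N\<^sub>E m W R G e \<gamma>) = G"
  "width (phase_imno N N\<^sub>E m W R G e \<gamma>) = W"
  "layers (phase_imno N N\<^sub>E m W R G e \<gamma>) = [modulation_layer e \<gamma>]"
  by (simp_all add: phase_imno_def)

lemma latent_step_phase_imno: "latent_step (phase_imno N N\<^sub>E m W R G e \<gamma>) \<Delta>t h = h"
  by (simp add: latent_step_def phase_imno_def affine_on_def cong: if_cong)

lemma decoder_phase_imno:
  assumes "\<forall>p\<in>freq_box N \<times> UNIV. \<forall>b. e (p, b) < m"
  shows "decoder (phase_imno N N\<^sub>E m W R G e \<gamma>) h =
    fourier_synth N (\<lambda>p. if p \<in> freq_box N \<times> UNIV then h (e (p, False)) else 0)"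
proof -
  have "(\<Sum>t<m. (if t = e (p, False) then 1 else 0) * h t) = h (e (p, False))"
    if "p \<in> freq_box N \<times> UNIV" for p
    using bspec[OF assms that] by (simp add: if_distrib[of "\<lambda>z. z * _"] cong: if_cong)
  then have "dec_net (phase_imno N N\<^sub>E m W R G e \<gamma>) h =
      (\<lambda>p. if p \<in> freq_box N \<times> UNIV then h (e (p, False)) else 0)"
    by (intro ext) (simp add: phase_imno_def affine_on_def)
  then show ?thesis by (simp add: decoder_def phase_imno_simps)
qed

lemma lifting_phase_imno:
  "lifting (phase_imno N N\<^sub>E m W R G e \<gamma>) f x i =
     (if i < W then freq_dot (char_freq (fst (fst (\<gamma> i)))) x else 0)"
proof -
  have "(\<Sum>s\<in>UNIV. (case s of Inl _ \<Rightarrow> 0 | Inr d \<Rightarrow> real_of_int (k $ d)) *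
      (case s of Inl j \<Rightarrow> y $ j | Inr i \<Rightarrow> x $ i)) = freq_dot k x" for k :: "int^'a" and x and y :: "real^'b"
    unfolding UNIV_Plus_UNIV[symmetric] freq_dot_def by (subst sum.Plus) simp_all
  then show ?thesis
    by (simp add: lifting_def phase_imno_def affine_on_def)
qed

lemma kernel_op_modulation_layer: "kernel_op W (modulation_layer e \<gamma>) v x i = 0"
  by (simp add: kernel_op_def modulation_layer_def)

text \<open>The residual operator does not depend on its function argument and returns exactly the trigonometric polynomial with coordinates $R\cos\theta_p$.\<close>

lemma residual_fun_phase_imno:
  fixes e :: "((int^('d::finite)) \<times> ('c::finite)) \<times> bool \<Rightarrow> nat"
  assumes e: "\<forall>p\<in>freq_box N \<times> UNIV. \<forall>b. e (p, b) < m"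
    and \<gamma>: "bij_betw \<gamma> {..<W} ((freq_box N \<times> UNIV) \<times> UNIV \<times> UNIV)"
  shows "residual_fun (phase_imno N N\<^sub>E m W R G e \<gamma>) h f =
    trig_fun N (\<lambda>p. R * cos (h (e (p, True))))"
proof -
  let ?\<Theta> = "phase_imno N N\<^sub>E m W R G e \<gamma>"
  let ?arg = "\<lambda>x p. freq_dot (char_freq (fst p)) x + char_phase (fst p)"
  let ?s = "\<lambda>up. if up then 1 else (- 1 :: real)"
  let ?o = "\<lambda>shift. if shift then pi else 0"
  define val where "val x q = (case q of (p, up, shift) \<Rightarrow>
      shifted_sine (?arg x p + ?s up * h (e (p, True)) + ?o shift))" for x q
  define coef where "coef j q = (case q of (p, up, shift) \<Rightarrow>
      if snd p = j then char_amp (fst p) * R / 4 * (if shift then - 1 else 1 :: real) else 0)" for j :: 'c and q :: "((int^'d) \<times> 'c) \<times> bool \<times> bool"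
  have state: "residual_state ?\<Theta> h (length (layers ?\<Theta>)) f x i = val x (\<gamma> i)" if i: "i < W" for x i
  proof -
    obtain p up shift where q: "\<gamma> i = (p, up, shift)" by (cases "\<gamma> i") auto
    have "\<gamma> i \<in> (freq_box N \<times> UNIV) \<times> UNIV \<times> UNIV" using \<gamma> i by (auto simp: bij_betw_def)
    then have p: "p \<in> freq_box N \<times> UNIV" by (simp add: q)
    have "(\<Sum>j<W. weight (modulation_layer e \<gamma>) i j * lifting ?\<Theta> f x j) = freq_dot (char_freq (fst p)) x"
    proof -
      have "(\<Sum>j<W. weight (modulation_layer e \<gamma>) i j * lifting ?\<Theta> f x j) =
          (\<Sum>j<W. if j = i then lifting ?\<Theta> f x j else 0)"
        by (intro sum.cong) (auto simp: modulation_layer_def)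
      then show ?thesis using i by (simp add: lifting_phase_imno q)
    qed
    moreover have "affine_on {..<m} {..<W} (cond_mat (modulation_layer e \<gamma>)) (cond_vec (modulation_layer e \<gamma>)) h i =
        ?s up * h (e (p, True)) + char_phase (fst p) + ?o shift"
    proof -
      have "(\<Sum>t<m. cond_mat (modulation_layer e \<gamma>) i t * h t) =
          (\<Sum>t<m. if t = e (p, True) then ?s up * h t else 0)"
        by (intro sum.cong) (auto simp: modulation_layer_def q)
      then show ?thesis using i bspec[OF e p]
        by (simp add: affine_on_def modulation_layer_def q)
    qed
    ultimately show ?thesis using i
      by (simp add: residual_state_def phase_imno_simps layer_op_def kernel_op_modulation_layer val_def q add_ac)
  qed
  have "residual_fun ?\<Theta> h f x $ j = trig_fun N (\<lambda>p. R * cos (h (e (p, True)))) x $ j" for x j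
  proof -
    have "residual_fun ?\<Theta> h f x $ j = (\<Sum>i<W. coef j (\<gamma> i) * val x (\<gamma> i)) +
        (\<Sum>k\<in>(freq_box N :: (int^'d) set). char_amp k * R * pi / 2)"
    proof -
      have "residual_fun ?\<Theta> h f x $ j =
          (\<Sum>i<W. coef j (\<gamma> i) * residual_state ?\<Theta> h (length (layers ?\<Theta>)) f x i) +
          (\<Sum>k\<in>(freq_box N :: (int^'d) set). char_amp k * R * pi / 2)"
        unfolding residual_fun_def vec_lambda_beta
        by (subst phase_imno_def) (simp add: affine_on_def coef_def)
      also have "(\<Sum>i<W. coef j (\<gamma> i) * residual_state ?\<Theta> h (length (layers ?\<Theta>)) f x i) =
          (\<Sum>i<W. coef j (\<gamma> i) * val x (\<gamma> i))"
        by (rule sum.cong[OF refl]) (simp only: state lessThan_iff)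
      finally show ?thesis .
    qed
    also have "(\<Sum>i<W. coef j (\<gamma> i) * val x (\<gamma> i)) =
        (\<Sum>q\<in>(freq_box N \<times> UNIV) \<times> UNIV \<times> UNIV. coef j q * val x q)"
      by (rule sum.reindex_bij_betw[OF \<gamma>])
    also have "\<dots> = (\<Sum>q\<in>(freq_box N \<times> {j}) \<times> UNIV \<times> UNIV. coef j q * val x q)"
      by (rule sum.mono_neutral_right) (auto simp: freq_box_finite coef_def split: if_splits)
    also have "\<dots> = (\<Sum>k\<in>freq_box N. \<Sum>up\<in>UNIV. \<Sum>shift\<in>UNIV. coef j ((k, j), up, shift) * val x ((k, j), up, shift))"
      by (simp only: sum.cartesian_product' sum.insert sum.empty finite.emptyI empty_iff not_False_eq_True add_0_right simp_thms)
    also have "\<dots> + (\<Sum>k\<in>(freq_box N :: (int^'d) set). char_amp k * R * pi / 2) =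
        (\<Sum>k\<in>freq_box N. R * cos (h (e ((k, j), True))) *
          (char_amp k * sin (freq_dot (char_freq k) x + char_phase k)))"
      unfolding sum.distrib[symmetric]
    proof (intro sum.cong refl)
      fix k :: "int^'d"
      define X where "X = freq_dot (char_freq k) x + char_phase k"
      define \<theta> where "\<theta> = h (e ((k, j), True))"
      have "(\<Sum>up\<in>UNIV. \<Sum>shift\<in>UNIV. coef j ((k, j), up, shift) * val x ((k, j), up, shift)) =
          char_amp k * R / 4 * ((shifted_sine (X + \<theta>) - shifted_sine (X + \<theta> + pi)) +
            (shifted_sine (X - \<theta>) - shifted_sine (X - \<theta> + pi)))"
        by (simp add: UNIV_bool coef_def val_def X_def \<theta>_def algebra_simps)
      also have "\<dots> = char_amp k * R / 2 * (sin (X + \<theta>) + sin (X - \<theta>)) - char_amp k * R * pi / 2"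
      proof -
        have "shifted_sine t - shifted_sine (t + pi) = 2 * sin t - pi" for t
          by (simp add: shifted_sine_def)
        then have "char_amp k * R / 4 * ((shifted_sine (X + \<theta>) - shifted_sine (X + \<theta> + pi)) +
            (shifted_sine (X - \<theta>) - shifted_sine (X - \<theta> + pi))) =
            char_amp k * R / 4 * ((2 * sin (X + \<theta>) - pi) + (2 * sin (X - \<theta>) - pi))"
          by (simp only:)
        then show ?thesis by (simp add: algebra_simps)
      qed
      also have "\<dots> = R * cos \<theta> * (char_amp k * sin X) - char_amp k * R * pi / 2"
        by (simp add: sin_add sin_diff)
      finally show "(\<Sum>up\<in>UNIV. \<Sum>shift\<in>UNIV. coef j ((k, j), up, shift) * val x ((k, j), up, shift)) +
          char_amp k * R * pi / 2 = R * cos \<theta> * (char_amp k * sin X)"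
        by simp
    qed
    finally show ?thesis by (simp add: trig_fun_def)
  qed
  then show ?thesis by (simp add: fun_eq_iff vec_eq_iff)
qed

lemma residual_op_phase_imno:
  fixes e :: "((int^('d::finite)) \<times> ('c::finite)) \<times> bool \<Rightarrow> nat"
  assumes e: "\<forall>p\<in>freq_box N \<times> UNIV. \<forall>b. e (p, b) < m"
    and \<gamma>: "bij_betw \<gamma> {..<W} ((freq_box N \<times> UNIV) \<times> UNIV \<times> UNIV)"
  shows "residual_op (phase_imno N N\<^sub>E m W R G e \<gamma>) u h =
    fourier_synth N (\<lambda>p. R * cos (h (e (p, True))))"
  unfolding residual_op_def residual_fun_phase_imno[OF e \<gamma>] fourier_synth_trig_fun ..

lemma abs_freq_dot_le:
  assumes "x \<in> cell" shows "\<bar>freq_dot k x\<bar> \<le> (\<Sum>i\<in>UNIV. \<bar>real_of_int (k $ i)\<bar> * (2 * pi))"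
proof -
  have "\<bar>freq_dot k x\<bar> \<le> (\<Sum>i\<in>UNIV. \<bar>real_of_int (k $ i) * x $ i\<bar>)"
    unfolding freq_dot_def by (rule sum_abs)
  also have "\<dots> \<le> (\<Sum>i\<in>UNIV. \<bar>real_of_int (k $ i)\<bar> * (2 * pi))"
    unfolding abs_mult using assms by (intro sum_mono mult_left_mono) (auto simp: cell_def less_imp_le)
  finally show ?thesis .
qed

lemma imno_model_phase_imno:
  fixes e :: "((int^('d::finite)) \<times> ('c::finite)) \<times> bool \<Rightarrow> nat"
  assumes e: "\<forall>p\<in>freq_box N \<times> UNIV. \<forall>b. e (p, b) < m"
    and \<gamma>: "bij_betw \<gamma> {..<W} ((freq_box N \<times> UNIV) \<times> UNIV \<times> UNIV)"
    and "m > 0" "W > 0" and G: "mlp shifted_sine (freq_box N\<^sub>E \<times> UNIV) {..<m} G"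
  shows "imno_model s (phase_imno N N\<^sub>E m W R G e \<gamma>)"
proof -
  let ?\<Theta> = "phase_imno N N\<^sub>E m W R G e \<gamma>"
  have P: "finite (freq_box N \<times> UNIV :: ((int^'d) \<times> 'c) set)" by (simp add: freq_box_finite)
  have nets: "mlp shifted_sine {..<m} (freq_box N \<times> UNIV) (dec_net ?\<Theta>)"
    "mlp shifted_sine {..<m} {..<m} (dyn_net ?\<Theta>)"
    "mlp shifted_sine UNIV {..<W} (lift_net ?\<Theta>)"
    "mlp shifted_sine {..<W} UNIV (proj_net ?\<Theta>)"
    unfolding phase_imno_def imno.simps by (intro mlp_affine finite_lessThan finite P)+
  have "(\<lambda>x. residual_state ?\<Theta> h 0 f x j) \<in> L2_torus" if j: "j < W" for h f j
  proof -
    define k where "k = char_freq (fst (fst (\<gamma> j)))"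
    have "integrable torus (\<lambda>x. (freq_dot k x)\<^sup>2)"
    proof (rule integrable_torus_bounded[where B = "(\<Sum>i\<in>UNIV. \<bar>real_of_int (k $ i)\<bar> * (2 * pi))\<^sup>2"])
      fix x :: "real^'d" assume "x \<in> cell"
      then have "\<bar>freq_dot k x\<bar>\<^sup>2 \<le> (\<Sum>i\<in>UNIV. \<bar>real_of_int (k $ i)\<bar> * (2 * pi))\<^sup>2"
        by (intro power_mono abs_freq_dot_le) simp_all
      then show "norm ((freq_dot k x)\<^sup>2) \<le> (\<Sum>i\<in>UNIV. \<bar>real_of_int (k $ i)\<bar> * (2 * pi))\<^sup>2" by simp
    qed simp
    then show ?thesis
      using j by (simp add: residual_state_def L2_torus_def lifting_phase_imno flip: k_def)
  qed
  moreover have "continuous_on UNIV shifted_sine"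
    unfolding shifted_sine_def by (intro continuous_intros)
  ultimately show ?thesis
    unfolding imno_model_def phase_imno_simps residual_op_phase_imno[OF e \<gamma>]
    using assms nets universal_approximation_shifted_sine
    by (simp add: fourier_synth_in_Hs kernel_op_modulation_layer) (simp add: modulation_layer_def)
qed

lemma abs_cos_diff_le: "\<bar>cos a - cos b\<bar> \<le> \<bar>a - b\<bar>" for a b :: real
proof -
  have "\<bar>cos a - cos b\<bar> = 2 * (\<bar>sin ((a + b) / 2)\<bar> * \<bar>sin ((b - a) / 2)\<bar>)"
    by (simp add: cos_diff_cos abs_mult)
  also have "\<dots> \<le> 2 * (1 * \<bar>(b - a) / 2\<bar>)"
    by (intro mult_left_mono mult_mono abs_sin_le_one abs_sin_x_le_abs_x) auto
  finally show ?thesis by simp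
qed

lemma continuous_map_arccos:
  assumes "continuous_map X euclideanreal f" "\<And>x. x \<in> topspace X \<Longrightarrow> \<bar>f x\<bar> \<le> 1"
  shows "continuous_map X euclideanreal (\<lambda>x. arccos (f x))"
proof -
  have "continuous_map X (top_of_set {-1..1}) f"
    using assms by (auto simp: continuous_map_in_subtopology abs_le_iff minus_le_iff)
  moreover have "continuous_map (top_of_set {-1..1}) euclideanreal arccos"
    by (simp add: continuous_on_arccos')
  ultimately show ?thesis using continuous_map_compose[of X _ f euclideanreal arccos] by (simp add: o_def)
qed

theorem theorem1:
  fixes s \<Delta>t \<mu> \<epsilon> :: real
    and S :: "real \<Rightarrow> ('d::finite, 'c::finite) torus_fun \<Rightarrow> ('d, 'c) torus_fun"
    and phase :: "('d, 'c) torus_fun \<Rightarrow> ('d, 'c) torus_fun"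
    and M K :: "('d, 'c) torus_fun set"
  assumes "s \<ge> 0"
    and "semigroup_on (Hs s) S"
    and "dissipative s S"
    and "\<Delta>t > 0"
    and "continuous_map (Hs_topology s) (Hs_topology s) (S \<Delta>t)"
    and "compactin (Hs_topology s) K"
    and "inertial_manifold s S M"
    and "flow_normally_hyperbolic s S M \<mu>"
    and "asymptotic_phase_map s S M \<mu> phase"
    and "continuous_map (Hs_topology s) (subtopology (Hs_topology s) M) phase"
    and "\<epsilon> > 0"
  shows "\<exists>\<Theta> :: ('d, 'c) imno. imno_model s \<Theta> \<and>
     (SUP u\<in>K. ereal (Hs_norm s (manifold_next \<Theta> \<Delta>t u - phase (S \<Delta>t u)) +
                      Hs_norm s (residual_next \<Theta> \<Delta>t u - (S \<Delta>t u - phase (S \<Delta>t u))))) < ereal \<epsilon> \<and>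
     (SUP u\<in>K. ereal (Hs_norm s (imno_step \<Theta> \<Delta>t u - S \<Delta>t u))) < ereal \<epsilon>"
proof -
  note K = assms(6)
  define g where "g = S \<Delta>t"
  define w where "w u = phase (g u)" for u
  let ?P = "freq_box :: nat \<Rightarrow> (int^'d) set"
  have g: "continuous_map (Hs_topology s) (Hs_topology s) g"
    using assms(5) by (simp add: g_def)
  have phase: "continuous_map (Hs_topology s) (Hs_topology s) phase"
    using assms(10) by (simp add: continuous_map_in_subtopology)
  have w: "continuous_map (Hs_topology s) (Hs_topology s) w"
  proof -
    have "w = phase \<circ> g" by (auto simp: w_def)
    then show ?thesis using continuous_map_compose[OF g phase] by simp
  qed
  have Ks: "u \<in> Hs s" if "u \<in> K" for u
    using compactin_subset_topspace[OF K] that by (auto simp: topspace_Hs)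
  have gs: "g u \<in> Hs s" and ws: "w u \<in> Hs s" if "u \<in> K" for u
    using Ks[OF that] continuous_map_image_subset_topspace[OF g]
      continuous_map_image_subset_topspace[OF w] by (auto simp: topspace_Hs)
  \<comment> \<open>One cutoff serves both components: the tail of the residual \<open>g u - w u\<close> is at most $\varepsilon/8$.\<close>
  obtain N where N: "\<And>u. u \<in> K \<Longrightarrow> band_norm s (- ?P N) (g u) < \<epsilon> / 16"
    "\<And>u. u \<in> K \<Longrightarrow> band_norm s (- ?P N) (w u) < \<epsilon> / 16"
  proof -
    have "\<epsilon> / 16 > 0" using assms(11) by simp
    then obtain N1 N2 where "\<forall>N'\<ge>N1. \<forall>v\<in>g ` K. band_norm s (- ?P N') v < \<epsilon> / 16"
      "\<forall>N'\<ge>N2. \<forall>v\<in>w ` K. band_norm s (- ?P N') v < \<epsilon> / 16"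
      using compact_uniform_tail[OF image_compactin[OF K g]] compact_uniform_tail[OF image_compactin[OF K w]]
      by blast
    then show ?thesis using that[of "max N1 N2"] by auto
  qed
  define P where "P = ?P N \<times> (UNIV :: 'c set)"
  have P: "finite P" "P \<noteq> {}" using zero_in_freq_box by (auto simp: P_def freq_box_finite)
  let ?X = "subtopology (Hs_topology s) K"
  \<comment> \<open>The coordinates of the residual reference, and a bound \<open>R\<close> for them that makes $\arccos$ applicable.\<close>
  define r where "r u p = coords (g u) p - coords (w u) p" for u p
  have coord_g: "continuous_map ?X euclideanreal (\<lambda>u. coords (g u) p)"
    and coord_w: "continuous_map ?X euclideanreal (\<lambda>u. coords (w u) p)" for p
    using continuous_map_compose[OF g continuous_map_coords[OF assms(1), of p]]
      continuous_map_compose[OF w continuous_map_coords[OF assms(1), of p]]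
    by (auto simp: o_def intro: continuous_map_from_subtopology)
  have cont_r: "continuous_map ?X euclideanreal (\<lambda>u. r u p)" for p
    unfolding r_def by (intro continuous_map_diff coord_g coord_w)
  have topX: "topspace ?X = K" using Ks by (auto simp: topspace_Hs)
  have "\<exists>B. \<forall>u\<in>K. \<bar>r u p\<bar> \<le> B" for p
  proof -
    have "compactin ?X K" using K by (simp add: compactin_subtopology)
    then have "compact ((\<lambda>u. r u p) ` K)"
      using image_compactin[OF _ cont_r[of p]] by simp
    then have "bounded ((\<lambda>u. r u p) ` K)" by (rule compact_imp_bounded)
    then show ?thesis by (auto simp: bounded_iff)
  qed
  then obtain B where B: "\<And>u p. u \<in> K \<Longrightarrow> \<bar>r u p\<bar> \<le> B p" by metis
  define R where "R = 1 + (\<Sum>p\<in>P. \<bar>B p\<bar>)"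
  have R: "R \<ge> 1" unfolding R_def by (simp add: sum_nonneg)
  have rR: "\<bar>r u p / R\<bar> \<le> 1" if "u \<in> K" "p \<in> P" for u p
  proof -
    have "\<bar>r u p\<bar> \<le> \<bar>B p\<bar>" using B[OF that(1), of p] by simp
    also have "\<dots> \<le> R" unfolding R_def using member_le_sum[of p P "\<lambda>p. \<bar>B p\<bar>"] that(2) P(1) by simp
    finally show ?thesis using R by (simp add: abs_divide)
  qed
  define m where "m = card (P \<times> (UNIV :: bool set))"
  obtain en where en: "bij_betw en {..<m} (P \<times> (UNIV :: bool set))"
    using ex_bij_betw_nat_finite[of "P \<times> (UNIV :: bool set)"] P(1) by (auto simp: atLeast0LessThan m_def)
  define e where "e = inv_into {..<m} en"
  have e: "e (p, b) < m" and en_e: "en (e (p, b)) = (p, b)" if "p \<in> P" for p b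
  proof -
    have "(p, b) \<in> en ` {..<m}" using en that by (simp add: bij_betw_def)
    then show "e (p, b) < m" "en (e (p, b)) = (p, b)"
      unfolding e_def using inv_into_into[of "(p, b)" en "{..<m}"] by (auto simp: f_inv_into_f)
  qed
  define W where "W = card (P \<times> (UNIV :: (bool \<times> bool) set))"
  obtain \<gamma> where \<gamma>: "bij_betw \<gamma> {..<W} (P \<times> (UNIV :: (bool \<times> bool) set))"
    using ex_bij_betw_nat_finite[of "P \<times> (UNIV :: (bool \<times> bool) set)"] P(1)
    by (auto simp: atLeast0LessThan W_def)
  have pos: "m > 0" "W > 0" using P by (simp_all add: m_def W_def card_gt_0_iff)
  define T where "T i u = (case en i of (p, b) \<Rightarrow>
      if b then arccos (r u p / R) else coords (w u) p)" for i u
  have T: "continuous_map ?X euclideanreal (T i)" if "i \<in> {..<m}" for i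
  proof -
    obtain p b where pb: "en i = (p, b)" by (cases "en i")
    then have p: "p \<in> P" using bspec[OF bij_betwE[OF en] that] by simp
    have "continuous_map ?X euclideanreal (\<lambda>u. arccos (r u p / R))"
    proof (rule continuous_map_arccos)
      show "continuous_map ?X euclideanreal (\<lambda>u. r u p / R)"
        using R by (intro continuous_map_real_divide cont_r) auto
      show "\<bar>r u p / R\<bar> \<le> 1" if "u \<in> topspace ?X" for u using rR p that by (simp only: topX)
    qed
    moreover have "T i = (if b then (\<lambda>u. arccos (r u p / R)) else (\<lambda>u. coords (w u) p))"
      by (auto simp: T_def pb)
    ultimately show ?thesis using coord_w[of p] by simp
  qed
  define C where "C = (\<Sum>k\<in>?P N. sqrt (sobolev_weight s k) * real (2 * CARD('c)))"
  have C: "C \<ge> 0" unfolding C_def using sobolev_weight_pos[of s]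
    by (intro sum_nonneg mult_nonneg_nonneg) (auto intro: less_imp_le)
  \<comment> \<open>An angle error \<open>\<delta>\<close> becomes a coordinate error of at most \<open>R * \<delta>\<close>, and hence an $H^s$ error of at most \<open>C * (R * \<delta>)\<close>.\<close>
  define \<delta> where "\<delta> = \<epsilon> / (8 * ((C + 1) * R))"
  have \<delta>: "\<delta> > 0" unfolding \<delta>_def using C R assms(11) by simp
  have C\<delta>: "C * (R * \<delta>) \<le> \<epsilon> / 8" "C * \<delta> \<le> \<epsilon> / 8"
  proof -
    have "C * (R * \<delta>) = C / (C + 1) * (\<epsilon> / 8)" unfolding \<delta>_def using R by simp
    also have "\<dots> \<le> 1 * (\<epsilon> / 8)" using C assms(11) by (intro mult_right_mono) auto
    finally show 1: "C * (R * \<delta>) \<le> \<epsilon> / 8" by simp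
    have "C * (1 * \<delta>) \<le> C * (R * \<delta>)" using C R \<delta> by (intro mult_left_mono mult_right_mono) auto
    then show "C * \<delta> \<le> \<epsilon> / 8" using 1 by simp
  qed
  obtain N\<^sub>E G where G: "mlp shifted_sine (freq_box N\<^sub>E \<times> UNIV) {..<m} G"
    and GT: "\<And>u i. u \<in> K \<Longrightarrow> i < m \<Longrightarrow> \<bar>G (fourier_coords N\<^sub>E u) i - T i u\<bar> < \<delta>"
    using encoder_dense[OF assms(1) K, of "{..<m}" T \<delta>] T \<delta> by (metis finite_lessThan lessThan_iff)
  define \<Theta> where "\<Theta> = phase_imno N N\<^sub>E m W R G e \<gamma>"
  have e': "\<forall>p\<in>?P N \<times> UNIV. \<forall>b. e (p, b) < m"
    unfolding P_def[symmetric] using e by blast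
  have \<gamma>': "bij_betw \<gamma> {..<W} ((?P N \<times> UNIV) \<times> UNIV \<times> UNIV)" using \<gamma> by (simp add: P_def)
  have model: "imno_model s \<Theta>"
    unfolding \<Theta>_def by (rule imno_model_phase_imno[OF e' \<gamma>' pos G])
  define h where "h u = G (fourier_coords N\<^sub>E u)" for u
  have man: "manifold_next \<Theta> \<Delta>t u = fourier_synth N (\<lambda>p. if p \<in> ?P N \<times> UNIV then h u (e (p, False)) else 0)" for u
    unfolding manifold_next_def \<Theta>_def latent_step_phase_imno decoder_phase_imno[OF e']
    unfolding encoder_def phase_imno_simps h_def ..
  have res: "residual_next \<Theta> \<Delta>t u = fourier_synth N (\<lambda>p. R * cos (h u (e (p, True))))" for u
    unfolding residual_next_def \<Theta>_def latent_step_phase_imno residual_op_phase_imno[OF e' \<gamma>']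
    unfolding encoder_def phase_imno_simps h_def ..
  have total: "Hs_norm s (manifold_next \<Theta> \<Delta>t u - w u) + Hs_norm s (residual_next \<Theta> \<Delta>t u - (g u - w u)) \<le> \<epsilon> / 2"
    and step: "Hs_norm s (imno_step \<Theta> \<Delta>t u - g u) \<le> \<epsilon> / 2" if u: "u \<in> K" for u
  proof -
    have hT: "\<bar>h u (e (p, b)) - T (e (p, b)) u\<bar> \<le> \<delta>" if "p \<in> P" for p b
      using GT[OF u e[OF that]] by (simp add: h_def less_imp_le)
    have "Hs_norm s (manifold_next \<Theta> \<Delta>t u - w u) \<le> band_norm s (- ?P N) (w u) + C * \<delta>"
      unfolding man C_def
    proof (rule Hs_norm_synth_diff_le[OF ws[OF u]])
      fix k j assume "k \<in> ?P N"
      then have "(k, j) \<in> P" by (simp add: P_def)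
      then show "\<bar>(if (k, j) \<in> ?P N \<times> UNIV then h u (e ((k, j), False)) else 0) - coords (w u) (k, j)\<bar> \<le> \<delta>"
        using hT[of "(k, j)" False] en_e[of "(k, j)" False] by (simp add: T_def P_def)
    qed
    then have m4: "Hs_norm s (manifold_next \<Theta> \<Delta>t u - w u) \<le> \<epsilon> / 4"
      using N(2)[OF u] C\<delta>(2) assms(11) by simp
    have "Hs_norm s (residual_next \<Theta> \<Delta>t u - (g u - w u)) \<le> band_norm s (- ?P N) (g u - w u) + C * (R * \<delta>)"
      unfolding res C_def
    proof (rule Hs_norm_synth_diff_le[OF Hs_diff_band(1)[OF gs[OF u] ws[OF u]]])
      fix k j assume "k \<in> ?P N"
      then have p: "(k, j) \<in> P" by (simp add: P_def)
      define q where "q = r u (k, j) / R"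
      have "R * cos (arccos q) = coords (g u - w u) (k, j)"
        using rR[OF u p] R coords_diff[OF gs[OF u] ws[OF u]]
        by (simp add: q_def cos_arccos_abs r_def)
      moreover have "\<bar>cos (h u (e ((k, j), True))) - cos (arccos q)\<bar> \<le> \<delta>"
        using hT[OF p, of True] en_e[OF p, of True]
        by (intro order_trans[OF abs_cos_diff_le]) (simp add: T_def q_def)
      then have "R * \<bar>cos (h u (e ((k, j), True))) - cos (arccos q)\<bar> \<le> R * \<delta>"
        using R by (intro mult_left_mono) auto
      then have "\<bar>R * cos (h u (e ((k, j), True))) - R * cos (arccos q)\<bar> \<le> R * \<delta>"
        using R by (simp add: abs_mult flip: right_diff_distrib)
      ultimately show "\<bar>R * cos (h u (e ((k, j), True))) - coords (g u - w u) (k, j)\<bar> \<le> R * \<delta>"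
        by (simp only:)
    qed
    then have r4: "Hs_norm s (residual_next \<Theta> \<Delta>t u - (g u - w u)) \<le> \<epsilon> / 4"
      using N(1)[OF u] N(2)[OF u] C\<delta>(1) Hs_diff_band(2)[OF gs[OF u] ws[OF u], of "- ?P N"] by simp
    show total: "Hs_norm s (manifold_next \<Theta> \<Delta>t u - w u) + Hs_norm s (residual_next \<Theta> \<Delta>t u - (g u - w u)) \<le> \<epsilon> / 2"
      using m4 r4 by simp
    have "manifold_next \<Theta> \<Delta>t u - w u \<in> Hs s" "residual_next \<Theta> \<Delta>t u - (g u - w u) \<in> Hs s"
      unfolding man res using gs[OF u] ws[OF u] by (auto intro!: Hs_diff_band(1) fourier_synth_in_Hs)
    from Hs_add_band(2)[OF this, of UNIV]
    have "Hs_norm s ((manifold_next \<Theta> \<Delta>t u - w u) + (residual_next \<Theta> \<Delta>t u - (g u - w u))) \<le> \<epsilon> / 2"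
      using total by (simp add: Hs_norm_band)
    moreover have "(manifold_next \<Theta> \<Delta>t u - w u) + (residual_next \<Theta> \<Delta>t u - (g u - w u)) = imno_step \<Theta> \<Delta>t u - g u"
      by (simp add: imno_step_def algebra_simps)
    ultimately show "Hs_norm s (imno_step \<Theta> \<Delta>t u - g u) \<le> \<epsilon> / 2" by simp
  qed
  have "(SUP u\<in>K. ereal (Hs_norm s (manifold_next \<Theta> \<Delta>t u - w u) +
      Hs_norm s (residual_next \<Theta> \<Delta>t u - (g u - w u)))) \<le> ereal (\<epsilon> / 2)"
    using total by (intro SUP_least) simp
  moreover have "(SUP u\<in>K. ereal (Hs_norm s (imno_step \<Theta> \<Delta>t u - g u))) \<le> ereal (\<epsilon> / 2)"
    using step by (intro SUP_least) simp
  moreover have "ereal (\<epsilon> / 2) < ereal \<epsilon>" using assms(11) by simp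
  ultimately show ?thesis
    using model unfolding w_def g_def by (meson le_less_trans)
qed

end
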